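(* Suppose that $G$ is a discrete group with normal subgroup $N$, and that $\mathcal D$ is a Fell bundle over $G/N$, with pull-back bundle $(q^*\mathcal D,G)$. If $(\mathcal D,G/N)$ satisfies Exel's property (EP) and $N$ is amenable, then $(q^*\mathcal D,G)$ satisfies (EP). Conversely, if $(q^*\mathcal D,G)$ satisfies (EP), then $N$ has to be amenable.
   Context: A Fell bundle $(\mathcal A,G)$ over a discrete group $G$ is a family of Banach spaces $A_s$ ($s\in G$) with bilinear associative multiplications $A_s\times A_t\to A_{st}$ and conjugate-linear isometric involutions $A_s\to A_{s^{-1}}$ with $(ab)^*=b^*a^*$, $a^{**}=a$, $\|ab\|\le\|a\|\|b\|$, $\|a^*a\|=\|a\|^2$, and $a^*a\ge0$ in the $C^*$-algebra $A_e$, where $e$ is the identity of $G$. Pull-back: for a Fell bundle $\mathcal D$ over $G/N$ with fibers $D_{sN}$ and quotient map $q:G\to G/N$, $q^*\mathcal D$ is the Fell bundle over $G$ with fibers $q^*D_s=(D_{sN},s)$ (with the Banach space structure of $D_{sN}$), product $(d_{sN},s)(d_{tN},t)=(d_{sN}d_{tN},st)$, and involution $(d_{sN},s)^*=(d_{sN}^*,s^{-1})$. Property (EP): a Fell bundle $\mathcal A$ over a discrete group $G$ has property (EP) if there is a net $(f_i)_{i\in I}$ of functions $f_i:G\to A_e$ with finite supports such that (i) $\sup_{i\in I}\left\|\sum_{s\in G}f_i(s)^*f_i(s)\right\|<\infty$, and (ii) $\lim_i\sum_{s\in G}f_i(ts)^*a_tf_i(s)=a_t$ for all $t\in G$ and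 $a_t\in A_t$. For $\mathcal D$ the same definition is used with $G/N$ in place of $G$.
   Formalization: In the converse, the Fell bundle D is assumed to have at least one nonzero fiber; for the zero bundle the pull-back satisfies (EP) trivially for every N, so the converse fails as stated, e.g. for N a free group on two generators. *)

theory Defs
  imports
    Complex_Main
    "HOL-Algebra.Coset"
    "HOL-Algebra.Module"
begin

section \<open>Banach spaces on a carrier\<close>

text \<open>The fibres of a Fell bundle are Banach spaces varying with the group element, so they are
  carrier-based modules over the complex field. As always for \<^typ>\<open>(_, _) module\<close>, the
  components \<^term>\<open>monoid.mult\<close> and \<^term>\<open>monoid.one\<close> of the record play no role.\<close>

definition complex_ring :: "complex ring" where
  "complex_ring = \<lparr>carrier = UNIV, mult = (*), one = 1, zero = 0, add = (+)\<rparr>"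

lemma cring_complex_ring: "cring complex_ring"
  by (rule cringI; (rule abelian_groupI comm_monoidI)?)
    (auto simp: complex_ring_def algebra_simps intro: exI[of _ "- _"])

record 'a cnormed_space = "(complex, 'a) module" +
  nrm :: "'a \<Rightarrow> real"

locale cbanach_space = module complex_ring V
  for V :: "('a, 'v) cnormed_space_scheme" (structure) +
  assumes nrm_nonneg: "x \<in> carrier V \<Longrightarrow> 0 \<le> nrm V x"
    and nrm_eq_zero: "x \<in> carrier V \<Longrightarrow> nrm V x = 0 \<longleftrightarrow> x = \<zero>\<^bsub>V\<^esub>"
    and nrm_triangle: "\<lbrakk>x \<in> carrier V; y \<in> carrier V\<rbrakk> \<Longrightarrow> nrm V (x \<oplus>\<^bsub>V\<^esub> y) \<le> nrm V x + nrm V y"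
    and nrm_smult: "x \<in> carrier V \<Longrightarrow> nrm V (c \<odot>\<^bsub>V\<^esub> x) = cmod c * nrm V x"
    and nrm_complete:
      "\<lbrakk>\<And>n. X n \<in> carrier V;
        \<And>\<epsilon>. \<epsilon> > 0 \<Longrightarrow> \<exists>M::nat. \<forall>m\<ge>M. \<forall>n\<ge>M. nrm V (X m \<ominus>\<^bsub>V\<^esub> X n) < \<epsilon>\<rbrakk>
       \<Longrightarrow> \<exists>x\<in>carrier V. (\<lambda>n. nrm V (X n \<ominus>\<^bsub>V\<^esub> x)) \<longlonglongrightarrow> 0"

section \<open>Fell bundles over discrete groups\<close>

text \<open>The product of \<open>a \<in> A\<^sub>s\<close> and \<open>b \<in> A\<^sub>t\<close> is \<open>bmult A s t a b\<close>, the adjoint of \<open>a \<in> A\<^sub>s\<close> is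
  \<open>bstar A s a\<close>. As the operations carry their fibre indices, distinct fibres need not be
  disjoint as sets.\<close>

record ('g, 'a) star_bundle =
  fiber :: "'g \<Rightarrow> 'a cnormed_space"
  bmult :: "'g \<Rightarrow> 'g \<Rightarrow> 'a \<Rightarrow> 'a \<Rightarrow> 'a"
  bstar :: "'g \<Rightarrow> 'a \<Rightarrow> 'a"

text \<open>In the last axiom, positivity of \<open>x\<close> in the C*-algebra \<open>A\<^sub>e\<close> means \<open>x = b\<^sup>*b\<close> for some \<open>b \<in> A\<^sub>e\<close>.\<close>

locale fell_bundle = group G
  for G :: "('g, 'm) monoid_scheme" (structure) and A :: "('g, 'a) star_bundle" +
  assumes fiber_banach: "s \<in> carrier G \<Longrightarrow> cbanach_space (fiber A s)"
    and bmult_closed: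
      "\<lbrakk>s \<in> carrier G; t \<in> carrier G; a \<in> carrier (fiber A s); b \<in> carrier (fiber A t)\<rbrakk>
       \<Longrightarrow> bmult A s t a b \<in> carrier (fiber A (s \<otimes> t))"
    and bmult_add_left:
      "\<lbrakk>s \<in> carrier G; t \<in> carrier G; a \<in> carrier (fiber A s); a' \<in> carrier (fiber A s);
        b \<in> carrier (fiber A t)\<rbrakk>
       \<Longrightarrow> bmult A s t (a \<oplus>\<^bsub>fiber A s\<^esub> a') b
         = bmult A s t a b \<oplus>\<^bsub>fiber A (s \<otimes> t)\<^esub> bmult A s t a' b"
    and bmult_add_right:
      "\<lbrakk>s \<in> carrier G; t \<in> carrier G; a \<in> carrier (fiber A s); b \<in> carrier (fiber A t);
        b' \<in> carrier (fiber A t)\<rbrakk>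
       \<Longrightarrow> bmult A s t a (b \<oplus>\<^bsub>fiber A t\<^esub> b')
         = bmult A s t a b \<oplus>\<^bsub>fiber A (s \<otimes> t)\<^esub> bmult A s t a b'"
    and bmult_smult_left:
      "\<lbrakk>s \<in> carrier G; t \<in> carrier G; a \<in> carrier (fiber A s); b \<in> carrier (fiber A t)\<rbrakk>
       \<Longrightarrow> bmult A s t (c \<odot>\<^bsub>fiber A s\<^esub> a) b = c \<odot>\<^bsub>fiber A (s \<otimes> t)\<^esub> bmult A s t a b"
    and bmult_smult_right:
      "\<lbrakk>s \<in> carrier G; t \<in> carrier G; a \<in> carrier (fiber A s); b \<in> carrier (fiber A t)\<rbrakk>
       \<Longrightarrow> bmult A s t a (c \<odot>\<^bsub>fiber A t\<^esub> b) = c \<odot>\<^bsub>fiber A (s \<otimes> t)\<^esub> bmult A s t a b"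
    and bmult_assoc:
      "\<lbrakk>r \<in> carrier G; s \<in> carrier G; t \<in> carrier G;
        a \<in> carrier (fiber A r); b \<in> carrier (fiber A s); d \<in> carrier (fiber A t)\<rbrakk>
       \<Longrightarrow> bmult A (r \<otimes> s) t (bmult A r s a b) d = bmult A r (s \<otimes> t) a (bmult A s t b d)"
    and bstar_closed:
      "\<lbrakk>s \<in> carrier G; a \<in> carrier (fiber A s)\<rbrakk> \<Longrightarrow> bstar A s a \<in> carrier (fiber A (inv s))"
    and bstar_add:
      "\<lbrakk>s \<in> carrier G; a \<in> carrier (fiber A s); b \<in> carrier (fiber A s)\<rbrakk>
       \<Longrightarrow> bstar A s (a \<oplus>\<^bsub>fiber A s\<^esub> b) = bstar A s a \<oplus>\<^bsub>fiber A (inv s)\<^esub> bstar A s b"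
    and bstar_smult:
      "\<lbrakk>s \<in> carrier G; a \<in> carrier (fiber A s)\<rbrakk>
       \<Longrightarrow> bstar A s (c \<odot>\<^bsub>fiber A s\<^esub> a) = cnj c \<odot>\<^bsub>fiber A (inv s)\<^esub> bstar A s a"
    and nrm_bstar:
      "\<lbrakk>s \<in> carrier G; a \<in> carrier (fiber A s)\<rbrakk>
       \<Longrightarrow> nrm (fiber A (inv s)) (bstar A s a) = nrm (fiber A s) a"
    and bstar_bmult:
      "\<lbrakk>s \<in> carrier G; t \<in> carrier G; a \<in> carrier (fiber A s); b \<in> carrier (fiber A t)\<rbrakk>
       \<Longrightarrow> bstar A (s \<otimes> t) (bmult A s t a b) = bmult A (inv t) (inv s) (bstar A t b) (bstar A s a)"
    and bstar_bstar:
      "\<lbrakk>s \<in> carrier G; a \<in> carrier (fiber A s)\<rbrakk> \<Longrightarrow> bstar A (inv s) (bstar A s a) = a"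
    and nrm_bmult:
      "\<lbrakk>s \<in> carrier G; t \<in> carrier G; a \<in> carrier (fiber A s); b \<in> carrier (fiber A t)\<rbrakk>
       \<Longrightarrow> nrm (fiber A (s \<otimes> t)) (bmult A s t a b) \<le> nrm (fiber A s) a * nrm (fiber A t) b"
    and cstar_identity:
      "\<lbrakk>s \<in> carrier G; a \<in> carrier (fiber A s)\<rbrakk>
       \<Longrightarrow> nrm (fiber A \<one>) (bmult A (inv s) s (bstar A s a) a) = (nrm (fiber A s) a)\<^sup>2"
    and positivity:
      "\<lbrakk>s \<in> carrier G; a \<in> carrier (fiber A s)\<rbrakk>
       \<Longrightarrow> \<exists>b\<in>carrier (fiber A \<one>).
             bmult A (inv s) s (bstar A s a) a = bmult A \<one> \<one> (bstar A \<one> b) b"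

text \<open>The index \<open>s\<close> of the family plays the role of the tag in the pairs \<open>(d, s)\<close> with \<open>d \<in> D\<^bsub>sN\<^esub>\<close>.\<close>

definition pullback :: "('g \<Rightarrow> 'h) \<Rightarrow> ('h, 'a) star_bundle \<Rightarrow> ('g, 'a) star_bundle" where
  "pullback q D =
     \<lparr>fiber = (\<lambda>s. fiber D (q s)),
      bmult = (\<lambda>s t. bmult D (q s) (q t)),
      bstar = (\<lambda>s. bstar D (q s))\<rparr>"

lemma fell_bundle_pullback:
  assumes "group_hom G H q" and "fell_bundle H D"
  shows "fell_bundle G (pullback q D)"
proof -
  interpret q: group_hom G H q by fact
  interpret D: fell_bundle H D by fact
  show ?thesis
    by (intro fell_bundle.intro fell_bundle_axioms.intro q.G.is_group)
      (simp_all add: pullback_def D.fiber_banach D.bmult_closed D.bmult_add_left D.bmult_add_right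
        D.bmult_smult_left D.bmult_smult_right D.bmult_assoc D.bstar_closed D.bstar_add
        D.bstar_smult D.nrm_bstar D.bstar_bmult D.bstar_bstar D.nrm_bmult D.cstar_identity
        D.positivity)
qed

section \<open>Exel's property (EP)\<close>

definition bundle_support ::
  "('g, 'm) monoid_scheme \<Rightarrow> ('g, 'a) star_bundle \<Rightarrow> ('g \<Rightarrow> 'a) \<Rightarrow> 'g set" where
  "bundle_support G A f = {s \<in> carrier G. f s \<noteq> \<zero>\<^bsub>fiber A \<one>\<^bsub>G\<^esub>\<^esub>}"

text \<open>For \<open>f\<close> of finite support, \<open>\<Sum>\<^bsub>s \<in> G\<^esub> f(s)\<^sup>* f(s)\<close> and \<open>\<Sum>\<^bsub>s \<in> G\<^esub> f(ts)\<^sup>* a f(s)\<close>. Both sums run over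
  the support of \<open>f\<close>, outside of which the summands vanish.\<close>

definition EP_square ::
  "('g, 'm) monoid_scheme \<Rightarrow> ('g, 'a) star_bundle \<Rightarrow> ('g \<Rightarrow> 'a) \<Rightarrow> 'a" where
  "EP_square G A f =
     (\<Oplus>\<^bsub>fiber A \<one>\<^bsub>G\<^esub>\<^esub> s \<in> bundle_support G A f.
        bmult A \<one>\<^bsub>G\<^esub> \<one>\<^bsub>G\<^esub> (bstar A \<one>\<^bsub>G\<^esub> (f s)) (f s))"

definition EP_sum ::
  "('g, 'm) monoid_scheme \<Rightarrow> ('g, 'a) star_bundle \<Rightarrow> ('g \<Rightarrow> 'a) \<Rightarrow> 'g \<Rightarrow> 'a \<Rightarrow> 'a" where
  "EP_sum G A f t a =
     (\<Oplus>\<^bsub>fiber A t\<^esub> s \<in> bundle_support G A f.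
        bmult A t \<one>\<^bsub>G\<^esub> (bmult A \<one>\<^bsub>G\<^esub> t (bstar A \<one>\<^bsub>G\<^esub> (f (t \<otimes>\<^bsub>G\<^esub> s))) a) (f s))"

definition directed_preorder :: "'i set \<Rightarrow> ('i \<Rightarrow> 'i \<Rightarrow> bool) \<Rightarrow> bool" where
  "directed_preorder I leq \<longleftrightarrow>
     I \<noteq> {} \<and>
     (\<forall>i\<in>I. leq i i) \<and>
     (\<forall>i\<in>I. \<forall>j\<in>I. \<forall>k\<in>I. leq i j \<longrightarrow> leq j k \<longrightarrow> leq i k) \<and>
     (\<forall>i\<in>I. \<forall>j\<in>I. \<exists>k\<in>I. leq i k \<and> leq j k)"

definition EP_net ::
  "('g, 'm) monoid_scheme \<Rightarrow> ('g, 'a) star_bundle \<Rightarrow>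
    'i set \<Rightarrow> ('i \<Rightarrow> 'i \<Rightarrow> bool) \<Rightarrow> ('i \<Rightarrow> 'g \<Rightarrow> 'a) \<Rightarrow> bool" where
  "EP_net G A I leq f \<longleftrightarrow>
     directed_preorder I leq \<and>
     (\<forall>i\<in>I. f i \<in> carrier G \<rightarrow> carrier (fiber A \<one>\<^bsub>G\<^esub>) \<and> finite (bundle_support G A (f i))) \<and>
     (\<exists>C. \<forall>i\<in>I. nrm (fiber A \<one>\<^bsub>G\<^esub>) (EP_square G A (f i)) \<le> C) \<and>
     (\<forall>t\<in>carrier G. \<forall>a\<in>carrier (fiber A t). \<forall>\<epsilon>>0. \<exists>i\<^sub>0\<in>I. \<forall>i\<in>I. leq i\<^sub>0 i \<longrightarrow>
        nrm (fiber A t) (EP_sum G A (f i) t a \<ominus>\<^bsub>fiber A t\<^esub> a) < \<epsilon>)"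

text \<open>HOL cannot quantify over the type of the index set. A net can always be re-indexed by the
  pairs \<open>(f\<^sub>i, {f\<^sub>j | j \<ge> i})\<close>, so fixing the type of such pairs is no restriction, which is the content
  of the lemma below.\<close>

definition property_EP :: "('g, 'm) monoid_scheme \<Rightarrow> ('g, 'a) star_bundle \<Rightarrow> bool" where
  "property_EP G A \<longleftrightarrow>
     (\<exists>(I :: (('g \<Rightarrow> 'a) \<times> ('g \<Rightarrow> 'a) set) set) leq f. EP_net G A I leq f)"

lemma EP_net_imp_property_EP:
  fixes I :: "'i set"
  assumes net: "EP_net G A I leq f"
  shows "property_EP G A"
proof -
  define T where "T i = f ` {j \<in> I. leq i j}" for i
  define J where "J = (\<lambda>i. (f i, T i)) ` I"
  define leq' where "leq' p p' \<longleftrightarrow> snd p' \<subseteq> snd p"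
    for p p' :: "('a \<Rightarrow> 'c) \<times> ('a \<Rightarrow> 'c) set"
  have dir: "directed_preorder I leq"
    using net by (simp add: EP_net_def)
  have T_mono: "T j \<subseteq> T i" if "i \<in> I" "j \<in> I" "leq i j" for i j
    using dir that unfolding T_def directed_preorder_def by blast
  have "directed_preorder J leq'"
    unfolding directed_preorder_def
  proof (intro conjI)
    show "J \<noteq> {}"
      using dir by (auto simp: J_def directed_preorder_def)
    show "\<forall>p\<in>J. \<forall>p'\<in>J. \<exists>p''\<in>J. leq' p p'' \<and> leq' p' p''"
    proof (intro ballI)
      fix p p' assume "p \<in> J" "p' \<in> J"
      then obtain i j where ij: "i \<in> I" "j \<in> I" "p = (f i, T i)" "p' = (f j, T j)"
        by (auto simp: J_def)
      then obtain k where k: "k \<in> I" "leq i k" "leq j k"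
        using dir unfolding directed_preorder_def by blast
      then have "(f k, T k) \<in> J"
        by (simp add: J_def)
      moreover have "leq' p (f k, T k)" "leq' p' (f k, T k)"
        using T_mono ij k by (simp_all add: leq'_def)
      ultimately show "\<exists>p''\<in>J. leq' p p'' \<and> leq' p' p''" by blast
    qed
  qed (auto simp: leq'_def)
  moreover have "\<exists>p\<^sub>0\<in>J. \<forall>p\<in>J. leq' p\<^sub>0 p \<longrightarrow>
      nrm (fiber A t) (EP_sum G A (fst p) t a \<ominus>\<^bsub>fiber A t\<^esub> a) < \<epsilon>"
    if "t \<in> carrier G" "a \<in> carrier (fiber A t)" "\<epsilon> > 0" for t a and \<epsilon> :: real
  proof -
    have "\<exists>i0\<in>I. \<forall>i\<in>I. leq i0 i \<longrightarrow>
        nrm (fiber A t) (EP_sum G A (f i) t a \<ominus>\<^bsub>fiber A t\<^esub> a) < \<epsilon>"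
      using net that unfolding EP_net_def by simp
    then obtain i0 where i0: "i0 \<in> I"
      "\<And>i. i \<in> I \<Longrightarrow> leq i0 i \<Longrightarrow> nrm (fiber A t) (EP_sum G A (f i) t a \<ominus>\<^bsub>fiber A t\<^esub> a) < \<epsilon>"
      by blast
    have "nrm (fiber A t) (EP_sum G A (fst p) t a \<ominus>\<^bsub>fiber A t\<^esub> a) < \<epsilon>"
      if p: "p \<in> J" "leq' (f i0, T i0) p" for p
    proof -
      obtain i where i: "i \<in> I" "p = (f i, T i)" using p by (auto simp: J_def)
      then have "f i \<in> T i" using dir by (auto simp: T_def directed_preorder_def)
      then have "f i \<in> T i0" using p i by (auto simp: leq'_def)
      then obtain j where "j \<in> I" "leq i0 j" "f i = f j" by (auto simp: T_def)
      then show ?thesis using i0 i by simp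
    qed
    moreover have "(f i0, T i0) \<in> J" using i0(1) by (simp add: J_def)
    ultimately show ?thesis by blast
  qed
  moreover have "\<forall>p\<in>J. fst p \<in> carrier G \<rightarrow> carrier (fiber A \<one>\<^bsub>G\<^esub>)
      \<and> finite (bundle_support G A (fst p))"
    using net by (auto simp: J_def EP_net_def)
  moreover have "\<exists>C. \<forall>p\<in>J. nrm (fiber A \<one>\<^bsub>G\<^esub>) (EP_square G A (fst p)) \<le> C"
    using net by (auto simp: J_def EP_net_def)
  ultimately have "EP_net G A J leq' fst"
    unfolding EP_net_def by blast
  then show ?thesis
    unfolding property_EP_def by blast
qed

section \<open>Amenability of discrete groups\<close>

text \<open>\<open>left_invariant_mean G m\<close>: \<open>m\<close> restricts to a left invariant mean on the real space \<open>\<ell>\<^sup>\<infinity>(G)\<close>.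
  Functions are total, but positivity and additivity make \<open>m h\<close> depend on the restriction
  of \<open>h\<close> to the carrier only.\<close>

definition bounded_on_group :: "('g, 'm) monoid_scheme \<Rightarrow> ('g \<Rightarrow> real) \<Rightarrow> bool" where
  "bounded_on_group G h \<longleftrightarrow> (\<exists>K. \<forall>s\<in>carrier G. \<bar>h s\<bar> \<le> K)"

definition left_invariant_mean :: "('g, 'm) monoid_scheme \<Rightarrow> (('g \<Rightarrow> real) \<Rightarrow> real) \<Rightarrow> bool" where
  "left_invariant_mean G m \<longleftrightarrow>
     (\<forall>h k. bounded_on_group G h \<longrightarrow> bounded_on_group G k \<longrightarrow> m (\<lambda>s. h s + k s) = m h + m k) \<and>
     (\<forall>c h. bounded_on_group G h \<longrightarrow> m (\<lambda>s. c * h s) = c * m h) \<and>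
     (\<forall>h. bounded_on_group G h \<longrightarrow> (\<forall>s\<in>carrier G. 0 \<le> h s) \<longrightarrow> 0 \<le> m h) \<and>
     m (\<lambda>s. 1) = 1 \<and>
     (\<forall>h. \<forall>t\<in>carrier G. bounded_on_group G h \<longrightarrow> m (\<lambda>s. h (t \<otimes>\<^bsub>G\<^esub> s)) = m h)"

definition amenable :: "('g, 'm) monoid_scheme \<Rightarrow> bool" where
  "amenable G \<longleftrightarrow> (\<exists>m. left_invariant_mean G m)"

end

theory Submission
  imports Defs "HOL-Library.Poly_Mapping" "HOL-Library.Function_Algebras"
begin

text \<open>Write \<open>q : G \<rightarrow> H\<close> for the quotient map and \<open>N\<close> for its kernel. Both halves of the theorem compare property
  (EP) with Reiter's condition for \<open>N\<close>: the existence of finitely supported probability vectors that are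
  almost invariant under finitely many given translations.

  Suppose \<open>N\<close> is amenable, and choose representatives \<open>c(x) \<in> G\<close> of the \<open>x \<in> H\<close>. Every \<open>s \<in> G\<close> is uniquely
  \<open>c(x) n\<close> with \<open>n \<in> N\<close>, and left translation by \<open>t\<close> sends \<open>c(x) n\<close> to \<open>c(q(t) x) k n\<close> with \<open>k \<in> N\<close> depending
  only on \<open>t\<close> and \<open>x\<close>. Given an approximate (EP) function \<open>f\<close> on \<open>H\<close> and a Reiter vector \<open>\<phi>\<close> on \<open>N\<close>, put
  \<open>F(c(x) n) = sqrt(\<phi>(n)) f(x)\<close>. Then \<open>F\<close> and \<open>f\<close> have the same sum of squares, and the (EP) sum of \<open>F\<close> is
  that of \<open>f\<close> with the summand at \<open>x\<close> multiplied by \<open>\<Sum>\<^sub>n sqrt(\<phi>(kn) \<phi>(n))\<close>. This factor is close to \<open>1\<close> for the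
  finitely many \<open>k\<close> that occur (lemma \<open>property_EP_pullback\<close>).

  Conversely, for \<open>n \<in> N\<close> the fibre of the pull-back over \<open>n\<close> is the unit fibre \<open>A\<close> of \<open>D\<close>, a nonzero
  C*-algebra. Take a positive functional \<open>\<tau>\<close> on \<open>A\<close> and a self-adjoint \<open>u\<close> with \<open>\<tau>(u\<^sup>2) > 0\<close>. If \<open>f\<close> is an
  approximate (EP) function on \<open>G\<close> and \<open>v(s) = u f(s)\<close>, then (EP) at \<open>a = u\<^sup>2\<close> says that
  \<open>\<Sum>\<^sub>s \<tau>(v(ns)\<^sup>* v(s))\<close> is close to \<open>\<tau>(u\<^sup>2)\<close>, for \<open>n = 1\<close> as well: the vector \<open>v\<close> is almost invariant in the
  Hilbert space norm. Hence \<open>P(s) = \<tau>(v(s)\<^sup>* v(s))\<close> is almost invariant in the \<open>l\<^sup>1\<close> norm, which gives Reiter's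
  condition for \<open>N\<close> acting on \<open>G\<close> (lemma \<open>reiter_kernel_if_property_EP_pullback\<close>).

  What remains is functional analysis: amenability is equivalent to Reiter's condition
  (\<open>reiter_if_amenable\<close>, \<open>amenable_if_reiter\<close>), and a nonzero C*-algebra has a suitable positive functional
  (\<open>positive_functional\<close>). All three rest on one Hahn--Banach theorem, stated for additive functionals on
  abelian groups. For the last one, Hahn--Banach is applied to \<open>lim\<^sub>t (\<parallel>t + x\<parallel> - t)\<close>, which
  is sublinear because the norm is; everything then depends on \<open>\<parallel>t - x\<^sup>* x\<parallel> \<le> t\<close> for large \<open>t\<close>, up to an
  error that vanishes in the limit. This is proved by polynomial identities, without spectral theory. To
  calculate with ring identities and a unit, the C*-algebra is replaced by the free unital *-algebra on its
  elements with the operator seminorm of left multiplication.\<close>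

section \<open>A Hahn--Banach theorem for additive groups\<close>

definition add_subgroup :: "'b::ab_group_add set \<Rightarrow> bool" where
  "add_subgroup S \<longleftrightarrow> 0 \<in> S \<and> (\<forall>x\<in>S. \<forall>y\<in>S. x + y \<in> S) \<and> (\<forall>x\<in>S. - x \<in> S)"

text \<open>Homogeneity is only required for natural multiples. The functionals obtained are additive; in each
  application they are also bounded, which yields real linearity where it is wanted.\<close>

definition sublinear_on :: "'b::ring_1 set \<Rightarrow> ('b \<Rightarrow> real) \<Rightarrow> bool" where
  "sublinear_on S q \<longleftrightarrow>
     (\<forall>x\<in>S. \<forall>y\<in>S. q (x + y) \<le> q x + q y) \<and> (\<forall>n. \<forall>x\<in>S. q (of_nat n * x) = real n * q x)"

lemma add_subgroup_of_nat_mult: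
  fixes x :: "'b::ring_1"
  assumes "add_subgroup S" "x \<in> S"
  shows "of_nat n * x \<in> S"
  by (induction n) (use assms in \<open>auto simp: add_subgroup_def distrib_right\<close>)

lemma sublinear_on_zero:
  assumes "sublinear_on S q" "add_subgroup S"
  shows "q 0 = 0"
proof -
  have "q (of_nat 0 * 0) = real 0 * q 0"
    using assms unfolding sublinear_on_def add_subgroup_def by blast
  then show ?thesis by simp
qed

lemma sublinear_on_uminus:
  assumes "sublinear_on S q" "add_subgroup S" "x \<in> S"
  shows "- q (- x) \<le> q x"
proof -
  have "q (x + - x) \<le> q x + q (- x)"
    using assms unfolding sublinear_on_def add_subgroup_def by blast
  then show ?thesis using sublinear_on_zero[OF assms(1,2)] by simp
qed

lemma le_cInf_add:
  fixes c :: real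
  assumes "X \<noteq> {}" "Y \<noteq> {}" "\<And>x y. x \<in> X \<Longrightarrow> y \<in> Y \<Longrightarrow> c \<le> x + y"
  shows "c \<le> Inf X + Inf Y"
proof -
  have "c - x \<le> Inf Y" if "x \<in> X" for x
    using assms(2) assms(3)[OF that] by (intro cInf_greatest) (auto simp: diff_le_eq add.commute)
  then have "c - Inf Y \<le> Inf X"
    using assms(1) by (intro cInf_greatest) (auto simp: diff_le_eq add.commute)
  then show ?thesis by simp
qed

text \<open>The largest sublinear function below \<open>q\<close> whose value at \<open>- y\<close> is at most \<open>- q y\<close>. A minimal sublinear function
  equals all of its tilts, and this forces it to be additive. The expressions of which the infimum is taken
  decrease with \<open>n\<close>.\<close>

definition tilt :: "('b::ring_1 \<Rightarrow> real) \<Rightarrow> 'b \<Rightarrow> 'b \<Rightarrow> real" where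
  "tilt q y x = (INF n. q (x + of_nat n * y) - real n * q y)"

context
  fixes S :: "'b::ring_1 set" and q :: "'b \<Rightarrow> real" and y :: 'b
  assumes S: "add_subgroup S" and q: "sublinear_on S q" and y: "y \<in> S"
begin

lemma tilt_term_lower:
  assumes "x \<in> S"
  shows "- q (- x) \<le> q (x + of_nat n * y) - real n * q y"
proof -
  have "q (- x + (x + of_nat n * y)) \<le> q (- x) + q (x + of_nat n * y)"
    using q S assms y add_subgroup_of_nat_mult[OF S y]
    unfolding sublinear_on_def add_subgroup_def by blast
  moreover have "q (of_nat n * y) = real n * q y"
    using q y unfolding sublinear_on_def by blast
  ultimately show ?thesis by (simp add: add.assoc[symmetric])
qed

lemma tilt_bdd_below:
  assumes "x \<in> S"
  shows "bdd_below (range (\<lambda>n. q (x + of_nat n * y) - real n * q y))"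
  using tilt_term_lower[OF assms] by (auto intro!: bdd_belowI)

lemma tilt_le:
  assumes "x \<in> S"
  shows "tilt q y x \<le> q (x + of_nat n * y) - real n * q y"
  unfolding tilt_def by (rule cINF_lower[OF tilt_bdd_below[OF assms]]) simp

lemma tilt_greatest:
  assumes "\<And>n. c \<le> q (x + of_nat n * y) - real n * q y"
  shows "c \<le> tilt q y x"
  unfolding tilt_def by (rule cINF_greatest) (use assms in auto)

lemma tilt_le_self: "x \<in> S \<Longrightarrow> tilt q y x \<le> q x"
  using tilt_le[of x 0] by simp

lemma tilt_uminus_le: "tilt q y (- y) \<le> - q y"
proof -
  have "- y \<in> S" using S y by (auto simp: add_subgroup_def)
  from tilt_le[OF this, of 1] show ?thesis
    using sublinear_on_zero[OF q S] by simp
qed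

lemma tilt_add:
  assumes "x \<in> S" "z \<in> S"
  shows "tilt q y (x + z) \<le> tilt q y x + tilt q y z"
proof -
  have xz: "x + z \<in> S" using S assms by (auto simp: add_subgroup_def)
  have *: "tilt q y (x + z) \<le> (q (x + of_nat m * y) - real m * q y) + (q (z + of_nat n * y) - real n * q y)"
    for m n
  proof -
    have "x + of_nat m * y \<in> S" "z + of_nat n * y \<in> S"
      using S assms add_subgroup_of_nat_mult[OF S y] by (auto simp: add_subgroup_def)
    then have "q ((x + of_nat m * y) + (z + of_nat n * y)) \<le> q (x + of_nat m * y) + q (z + of_nat n * y)"
      using q by (auto simp: sublinear_on_def)
    moreover have "(x + of_nat m * y) + (z + of_nat n * y) = (x + z) + of_nat (m + n) * y"
      by (simp add: algebra_simps)
    ultimately show ?thesis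
      using tilt_le[OF xz, of "m + n"] by (simp add: algebra_simps)
  qed
  show ?thesis
    unfolding tilt_def[of q y x] tilt_def[of q y z] by (rule le_cInf_add) (use * in auto)
qed

lemma tilt_decreasing:
  assumes "x \<in> S" "m \<le> n"
  shows "q (x + of_nat n * y) - real n * q y \<le> q (x + of_nat m * y) - real m * q y"
proof -
  have "of_nat (n - m) * y \<in> S" by (rule add_subgroup_of_nat_mult[OF S y])
  moreover have "x + of_nat m * y \<in> S"
    using S assms(1) add_subgroup_of_nat_mult[OF S y] by (auto simp: add_subgroup_def)
  ultimately have "q ((x + of_nat m * y) + of_nat (n - m) * y) \<le> q (x + of_nat m * y) + q (of_nat (n - m) * y)"
    using q by (auto simp: sublinear_on_def)
  moreover have "(x + of_nat m * y) + of_nat (n - m) * y = x + of_nat n * y"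
    using \<open>m \<le> n\<close> by (simp add: algebra_simps of_nat_diff)
  moreover have "q (of_nat (n - m) * y) = real (n - m) * q y"
    using q y unfolding sublinear_on_def by blast
  ultimately show ?thesis using \<open>m \<le> n\<close> by (simp add: algebra_simps of_nat_diff)
qed

lemma tilt_homogeneous:
  assumes "x \<in> S"
  shows "tilt q y (of_nat k * x) = real k * tilt q y x"
proof (cases "k = 0")
  case True
  have "0 \<in> S" using S by (auto simp: add_subgroup_def)
  have hom: "q (of_nat n * y) = real n * q y" for n
    using q y by (auto simp: sublinear_on_def)
  have "tilt q y 0 = 0"
    unfolding tilt_def by (simp add: hom)
  then show ?thesis using True by simp
next
  case False
  have kx: "of_nat k * x \<in> S" by (rule add_subgroup_of_nat_mult[OF S assms])
  have scaled: "q (of_nat k * x + of_nat (k * m) * y) - real (k * m) * q y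
      = real k * (q (x + of_nat m * y) - real m * q y)" for m
  proof -
    have "x + of_nat m * y \<in> S"
      using S assms add_subgroup_of_nat_mult[OF S y] by (auto simp: add_subgroup_def)
    then have "q (of_nat k * (x + of_nat m * y)) = real k * q (x + of_nat m * y)"
      using q by (auto simp: sublinear_on_def)
    then show ?thesis by (simp add: algebra_simps)
  qed
  show ?thesis
  proof (rule antisym)
    have "tilt q y (of_nat k * x) / real k \<le> tilt q y x"
    proof (rule tilt_greatest)
      fix m
      have "tilt q y (of_nat k * x) \<le> real k * (q (x + of_nat m * y) - real m * q y)"
        using tilt_le[OF kx, of "k * m"] scaled[of m] by simp
      then show "tilt q y (of_nat k * x) / real k \<le> q (x + of_nat m * y) - real m * q y"
        using False by (simp add: field_simps)
    qed
    then show "tilt q y (of_nat k * x) \<le> real k * tilt q y x"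
      using False by (simp add: field_simps)
    show "real k * tilt q y x \<le> tilt q y (of_nat k * x)"
    proof (rule tilt_greatest)
      fix n
      have "real k * tilt q y x \<le> real k * (q (x + of_nat n * y) - real n * q y)"
        using tilt_le[OF assms] by (intro mult_left_mono) auto
      also have "\<dots> \<le> q (of_nat k * x + of_nat n * y) - real n * q y"
        using tilt_decreasing[OF kx, of n "k * n"] scaled[of n] False by simp
      finally show "real k * tilt q y x \<le> q (of_nat k * x + of_nat n * y) - real n * q y" .
    qed
  qed
qed

lemma sublinear_on_tilt: "sublinear_on S (tilt q y)"
  unfolding sublinear_on_def using tilt_add tilt_homogeneous by blast

end

text \<open>The values at \<open>x\<close> are bounded below by \<open>- p (- x)\<close>, so the infimum is finite. Comparability of the members is
  what makes it subadditive: of two members the smaller one can be used for both summands.\<close>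

lemma sublinear_on_cInf_chain:
  assumes S: "add_subgroup S" and "C \<noteq> {}"
    and C: "\<And>q. q \<in> C \<Longrightarrow> sublinear_on S q" "\<And>q x. q \<in> C \<Longrightarrow> x \<in> S \<Longrightarrow> q x \<le> p x"
    and chain: "\<And>q r. q \<in> C \<Longrightarrow> r \<in> C \<Longrightarrow> q \<le> r \<or> r \<le> q"
  shows "sublinear_on S (\<lambda>x. INF q\<in>C. q x)"
    and "\<And>q x. q \<in> C \<Longrightarrow> x \<in> S \<Longrightarrow> (INF q\<in>C. q x) \<le> q x"
proof -
  have bdd: "bdd_below ((\<lambda>q. q x) ` C)" if "x \<in> S" for x
  proof (rule bdd_belowI2)
    fix q assume "q \<in> C"
    have "- x \<in> S" using S that by (auto simp: add_subgroup_def)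
    show "- p (- x) \<le> q x"
      using sublinear_on_uminus[OF C(1)[OF \<open>q \<in> C\<close>] S that] C(2)[OF \<open>q \<in> C\<close> \<open>- x \<in> S\<close>] by simp
  qed
  show le: "(INF q\<in>C. q x) \<le> q x" if "q \<in> C" "x \<in> S" for q x
    by (rule cINF_lower[OF bdd]) (use that in auto)
  show "sublinear_on S (\<lambda>x. INF q\<in>C. q x)"
    unfolding sublinear_on_def
  proof (intro conjI ballI allI)
    fix x y assume xy: "x \<in> S" "y \<in> S"
    then have "x + y \<in> S" using S by (auto simp: add_subgroup_def)
    have *: "(INF q\<in>C. q (x + y)) \<le> q x + r y" if "q \<in> C" "r \<in> C" for q r
    proof (cases "q \<le> r")
      case True
      have "(INF q\<in>C. q (x + y)) \<le> q (x + y)" using le that \<open>x + y \<in> S\<close> by blast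
      also have "\<dots> \<le> q x + q y" using C(1) that xy by (auto simp: sublinear_on_def)
      also have "\<dots> \<le> q x + r y" using True by (auto simp: le_fun_def)
      finally show ?thesis .
    next
      case False
      then have "r \<le> q" using chain that by blast
      have "(INF q\<in>C. q (x + y)) \<le> r (x + y)" using le that \<open>x + y \<in> S\<close> by blast
      also have "\<dots> \<le> r x + r y" using C(1) that xy by (auto simp: sublinear_on_def)
      also have "\<dots> \<le> q x + r y" using \<open>r \<le> q\<close> by (auto simp: le_fun_def)
      finally show ?thesis .
    qed
    show "(INF q\<in>C. q (x + y)) \<le> (INF q\<in>C. q x) + (INF q\<in>C. q y)"
      by (rule le_cInf_add) (use \<open>C \<noteq> {}\<close> * in auto)
  next
    fix n x assume x: "x \<in> S"
    have eq: "(INF q\<in>C. q (of_nat n * x)) = (INF q\<in>C. real n * q x)"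
      by (rule INF_cong) (use C(1) x in \<open>auto simp: sublinear_on_def\<close>)
    show "(INF q\<in>C. q (of_nat n * x)) = real n * (INF q\<in>C. q x)"
    proof (cases "n = 0")
      case True
      then show ?thesis unfolding eq using \<open>C \<noteq> {}\<close> by simp
    next
      case False
      have "(INF q\<in>C. real n * q x) = real n * (INF q\<in>C. q x)"
      proof (rule antisym)
        obtain M where "\<And>q. q \<in> C \<Longrightarrow> M \<le> q x"
          using bdd[OF x] by (auto simp: bdd_below_def)
        then have bdd': "bdd_below ((\<lambda>q. real n * q x) ` C)"
          by (intro bdd_belowI2[where m = "real n * M"] mult_left_mono) auto
        have "(INF q\<in>C. real n * q x) / real n \<le> (INF q\<in>C. q x)"
        proof (rule cINF_greatest[OF \<open>C \<noteq> {}\<close>])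
          fix q assume "q \<in> C"
          then have "(INF q\<in>C. real n * q x) \<le> real n * q x"
            by (rule cINF_lower[OF bdd'])
          then show "(INF q\<in>C. real n * q x) / real n \<le> q x"
            using False by (simp add: field_simps)
        qed
        then show "(INF q\<in>C. real n * q x) \<le> real n * (INF q\<in>C. q x)"
          using False by (simp add: field_simps)
        show "real n * (INF q\<in>C. q x) \<le> (INF q\<in>C. real n * q x)"
          by (rule cINF_greatest[OF \<open>C \<noteq> {}\<close>]) (use le x in \<open>auto intro!: mult_left_mono\<close>)
      qed
      then show ?thesis unfolding eq .
    qed
  qed
qed

text \<open>Zorn's lemma is applied to the sublinear functions themselves, not to partially defined functionals. For
  a minimal \<open>m\<close> the tilt by \<open>y\<close> is \<open>m\<close> again, and the term \<open>n = 1\<close> of its infimum gives \<open>m x \<le> m (x + y) - m y\<close>.\<close>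

lemma additive_below_sublinear:
  fixes S :: "'b::ring_1 set"
  assumes S: "add_subgroup S" and p: "sublinear_on S p"
  obtains w where "\<And>x z. x \<in> S \<Longrightarrow> z \<in> S \<Longrightarrow> w (x + z) = w x + w z"
    and "\<And>x. x \<in> S \<Longrightarrow> w x \<le> p x"
proof -
  \<comment> \<open>Values outside \<open>S\<close> are fixed, so that minimal in the pointwise order means minimal on \<open>S\<close>.\<close>
  define A where "A = {q. sublinear_on S q \<and> (\<forall>x\<in>S. q x \<le> p x) \<and> (\<forall>x. x \<notin> S \<longrightarrow> q x = 0)}"
  have S_cl: "0 \<in> S" "\<And>x y. x \<in> S \<Longrightarrow> y \<in> S \<Longrightarrow> x + y \<in> S" "\<And>x. x \<in> S \<Longrightarrow> - x \<in> S"
    using S by (auto simp: add_subgroup_def)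
  have cong: "sublinear_on S q' " if "sublinear_on S q" "\<And>x. x \<in> S \<Longrightarrow> q' x = q x" for q q'
    using that S_cl add_subgroup_of_nat_mult[OF S] unfolding sublinear_on_def by auto
  have "\<exists>m\<in>A. \<forall>a\<in>A. a \<le> m \<longrightarrow> a = m"
  proof -
    have "\<exists>m\<in>A. \<forall>a\<in>A. m \<ge> a \<longrightarrow> a = m"
    proof (rule predicate_Zorn)
      show "partial_order_on A (relation_of (\<ge>) A)"
        by (rule partial_order_on_relation_ofI) auto
      fix C assume C: "C \<in> Chains (relation_of (\<ge>) A)"
      have CA: "C \<subseteq> A" and tot: "\<And>q r. q \<in> C \<Longrightarrow> r \<in> C \<Longrightarrow> q \<le> r \<or> r \<le> q"
        using C by (auto simp: Chains_def relation_of_def)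
      show "\<exists>u\<in>A. \<forall>a\<in>C. a \<ge> u"
      proof (cases "C = {}")
        case True
        have "(\<lambda>x. if x \<in> S then p x else 0) \<in> A"
          unfolding A_def using cong[OF p] by auto
        then show ?thesis using True by blast
      next
        case False
        note inf = sublinear_on_cInf_chain[OF S False, of p]
        have C1: "\<And>q. q \<in> C \<Longrightarrow> sublinear_on S q" "\<And>q x. q \<in> C \<Longrightarrow> x \<in> S \<Longrightarrow> q x \<le> p x"
          "\<And>q x. q \<in> C \<Longrightarrow> x \<notin> S \<Longrightarrow> q x = 0"
          using CA by (auto simp: A_def)
        define u where "u x = (if x \<in> S then INF q\<in>C. q x else 0)" for x
        have sub: "sublinear_on S u"
          by (rule cong[OF inf(1)]) (use C1 tot in \<open>auto simp: u_def\<close>)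
        have low: "u \<le> q" if "q \<in> C" for q
          using inf(2)[of q] C1(1,2) C1(3)[OF that] tot that by (auto simp: u_def le_fun_def)
        obtain q0 where "q0 \<in> C" using False by blast
        have "u x \<le> p x" if "x \<in> S" for x
          using low[OF \<open>q0 \<in> C\<close>] C1(2)[OF \<open>q0 \<in> C\<close> that] by (meson le_funD order_trans)
        then have "u \<in> A" using sub by (simp add: A_def u_def)
        then show ?thesis using low by blast
      qed
    qed
    then show ?thesis by blast
  qed
  then obtain m where m: "m \<in> A" "\<And>a. a \<in> A \<Longrightarrow> a \<le> m \<Longrightarrow> a = m" by blast
  then have msub: "sublinear_on S m" and mle: "\<And>x. x \<in> S \<Longrightarrow> m x \<le> p x"
    and m0: "\<And>x. x \<notin> S \<Longrightarrow> m x = 0" by (auto simp: A_def)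
  have "m (x + y) = m x + m y" if "x \<in> S" "y \<in> S" for x y
  proof -
    define r where "r z = (if z \<in> S then tilt m y z else 0)" for z
    have "sublinear_on S r"
      by (rule cong[OF sublinear_on_tilt[OF S msub \<open>y \<in> S\<close>]]) (simp add: r_def)
    moreover have "r \<le> m"
      using tilt_le_self[OF S msub \<open>y \<in> S\<close>] m0 by (auto simp: r_def le_fun_def)
    moreover have "r z \<le> p z" if "z \<in> S" for z
      using \<open>r \<le> m\<close> mle[OF that] by (meson le_funD order_trans)
    ultimately have "r \<in> A" by (simp add: A_def r_def)
    then have "r = m" using m(2) \<open>r \<le> m\<close> by blast
    then have "m x \<le> m (x + y) - m y"
      using tilt_le[OF S msub \<open>y \<in> S\<close> \<open>x \<in> S\<close>, of 1] \<open>x \<in> S\<close> fun_cong[OF \<open>r = m\<close>, of x]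
      unfolding r_def by simp
    moreover have "m (x + y) \<le> m x + m y" using msub that by (auto simp: sublinear_on_def)
    ultimately show ?thesis by simp
  qed
  then show thesis using that mle by blast
qed

text \<open>Attaining the value \<open>p y\<close> at one given point comes for free by starting from the tilt of \<open>p\<close> by \<open>y\<close>.\<close>

theorem hahn_banach_additive:
  fixes S :: "'b::ring_1 set"
  assumes S: "add_subgroup S" and p: "sublinear_on S p" and y: "y \<in> S"
  obtains w where "\<And>x z. x \<in> S \<Longrightarrow> z \<in> S \<Longrightarrow> w (x + z) = w x + w z"
    and "\<And>x. x \<in> S \<Longrightarrow> w x \<le> p x" and "w y = p y"
proof -
  obtain w where w: "\<And>x z. x \<in> S \<Longrightarrow> z \<in> S \<Longrightarrow> w (x + z) = w x + w z"
    and w_le: "\<And>x. x \<in> S \<Longrightarrow> w x \<le> tilt p y x"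
    using additive_below_sublinear[OF S sublinear_on_tilt[OF S p y]] by blast
  have le: "w x \<le> p x" if "x \<in> S" for x
    using w_le[OF that] tilt_le_self[OF S p y that] by simp
  have my: "- y \<in> S" "0 \<in> S" using S y by (auto simp: add_subgroup_def)
  have "w 0 = 0" using w[OF my(2) my(2)] by simp
  then have "w (- y) = - w y" using w[OF y my(1)] by simp
  then have "p y \<le> w y" using w_le[OF my(1)] tilt_uminus_le[OF S p y] by simp
  then have "w y = p y" using le[OF y] by simp
  then show thesis using that w le by blast
qed

section \<open>Positive functionals for C*-seminorms\<close>

text \<open>With \<open>c = M / 3\<close> this is the factorisation of \<open>4/27 M\<^sup>3 - h (M - h)\<^sup>2\<close>, where \<open>4/27 M\<^sup>3\<close> is the maximum of the cubic
  \<open>h (M - h)\<^sup>2\<close> on \<open>[0, M]\<close>, attained at \<open>M / 3\<close>. Writing out multiples of \<open>c\<close> as sums keeps everything in an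
  arbitrary ring.\<close>

lemma cubic_sandwich:
  fixes h c :: "'b::ring"
  assumes hc: "h * c = c * h"
  shows "(c * c * c + c * c * c + c * c * c + c * c * c) - (c + c + c - h) * h * (c + c + c - h)
    = (h - c) * (c + c + c + c - h) * (h - c)"
proof -
  have hc': "h * (c * x) = c * (h * x)" for x by (metis hc mult.assoc)
  show ?thesis by (simp add: algebra_simps hc hc')
qed

text \<open>With \<open>c = M\<close> this bounds \<open>- M\<^sup>2 h\<close> above by \<open>- h (M - h)\<^sup>2\<close> as long as \<open>2M - h\<close> is positive.\<close>

lemma quadratic_sandwich:
  fixes h c :: "'b::ring"
  assumes hc: "h * c = c * h"
  shows "c * c * h - (c - h) * h * (c - h) = h * (c + c - h) * h"
proof -
  have hc': "h * (c * x) = c * (h * x)" for x by (metis hc mult.assoc)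
  show ?thesis by (simp add: algebra_simps hc hc')
qed

text \<open>The seminorm may vanish on nonzero elements and need not be complete, because the intended model is a free
  *-algebra acting, in general not faithfully, on a C*-algebra. Scalars are real; the central element \<open>im\<close>
  provides the imaginary unit, which turns self-adjoint elements into skew ones.\<close>

locale cstar_seminorm =
  fixes N :: "'b::real_algebra_1 \<Rightarrow> real" and st :: "'b \<Rightarrow> 'b" and im :: 'b
  assumes N_triangle: "N (x + y) \<le> N x + N y"
    and N_scaleR: "N (r *\<^sub>R x) = \<bar>r\<bar> * N x"
    and N_mult: "N (x * y) \<le> N x * N y"
    and N_one: "N 1 = 1"
    and N_cstar: "(N x)\<^sup>2 \<le> N (st x * x)"
    and st_add: "st (x + y) = st x + st y"
    and st_scaleR: "st (r *\<^sub>R x) = r *\<^sub>R st x"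
    and st_mult: "st (x * y) = st y * st x"
    and st_st: "st (st x) = x"
    and im_central: "im * x = x * im"
    and im_square: "im * im = - 1"
    and st_im: "st im = - im"
begin

lemma N_zero: "N 0 = 0"
  using N_scaleR[of 0 0] by simp

lemma N_minus: "N (- x) = N x"
  using N_scaleR[of "- 1" x] by simp

lemma N_nonneg: "0 \<le> N x"
  using N_triangle[of x "- x"] N_zero N_minus by simp

lemma N_diff: "N (x - y) \<le> N x + N y"
  using N_triangle[of x "- y"] N_minus by simp

lemma N_of_real: "N (of_real r) = \<bar>r\<bar>"
  using N_scaleR[of r 1] N_one by (simp add: of_real_def)

lemma st_one: "st 1 = 1"
proof -
  have "st (st 1 * 1) = st 1 * st (st 1)" by (simp only: st_mult)
  then show ?thesis by (simp add: st_st)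
qed

lemma st_of_real: "st (of_real r) = of_real r"
  by (simp add: of_real_def st_scaleR st_one)

lemma st_minus: "st (- x) = - st x"
  using st_scaleR[of "- 1" x] by simp

lemma st_diff: "st (x - y) = st x - st y"
  using st_add[of x "- y"] st_minus by simp

lemma st_zero: "st 0 = 0"
  using st_scaleR[of 0 0] by simp

lemmas st_simps = st_add st_diff st_minus st_mult st_scaleR st_of_real st_one st_st st_im st_zero

lemma N_st: "N (st x) = N x"
proof -
  have *: "N x \<le> N (st x)" for x
  proof (cases "N x = 0")
    case False
    then have "N x > 0" using N_nonneg[of x] by simp
    have "N x * N x \<le> N (st x) * N x"
      using N_cstar[of x] N_mult[of "st x" x] by (simp add: power2_eq_square)
    then show ?thesis using \<open>N x > 0\<close> by simp
  qed (use N_nonneg in simp)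
  show ?thesis using *[of x] *[of "st x"] by (simp add: st_st)
qed

lemma N_self_adjoint_square:
  assumes "st x = x"
  shows "N (x * x) = (N x)\<^sup>2"
  using N_cstar[of x] N_mult[of x x] assms by (simp add: power2_eq_square)

lemma N_power_le: "N (x ^ n) \<le> N x ^ n"
proof (induction n)
  case (Suc n)
  have "N (x ^ Suc n) \<le> N x * N (x ^ n)" using N_mult by simp
  also have "\<dots> \<le> N x * N x ^ n" using Suc N_nonneg by (intro mult_left_mono) auto
  finally show ?case by simp
qed (simp add: N_one)

lemma st_power: "st (x ^ n) = st x ^ n"
  by (induction n) (simp_all add: st_one st_mult power_commutes)

lemma N_self_adjoint_power:
  assumes "st x = x"
  shows "N (x ^ (2 ^ j)) = N x ^ (2 ^ j)"
proof (induction j)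
  case (Suc j)
  have "x ^ (2 ^ Suc j) = x ^ (2 ^ j) * x ^ (2 ^ j)"
    by (simp add: power_add[symmetric] mult_2)
  then have "N (x ^ (2 ^ Suc j)) = (N (x ^ (2 ^ j)))\<^sup>2"
    using N_self_adjoint_square[of "x ^ (2 ^ j)"] assms by (simp add: st_power)
  then show ?case using Suc by (simp add: power_mult[symmetric] mult.commute)
qed simp

text \<open>For self-adjoint \<open>x\<close> in a C*-algebra this is the maximum of the spectrum. The expression decreases with \<open>t\<close>, so
  the infimum is a limit at infinity and the triangle inequality for \<open>N\<close> makes it sublinear.\<close>

definition upper :: "'b \<Rightarrow> real" where
  "upper x = (INF t\<in>{0<..}. N (of_real t + x) - t)"

lemma upper_term_lower: "t > 0 \<Longrightarrow> - N x \<le> N (of_real t + x) - t"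
proof -
  assume "t > 0"
  have "N ((of_real t + x) - x) \<le> N (of_real t + x) + N x" by (rule N_diff)
  then show ?thesis using \<open>t > 0\<close> by (simp add: N_of_real)
qed

lemma upper_le: "t > 0 \<Longrightarrow> upper x \<le> N (of_real t + x) - t"
  unfolding upper_def
  by (rule cINF_lower) (auto intro!: bdd_belowI2[where m = "- N x"] upper_term_lower)

lemma upper_greatest: "(\<And>t. t > 0 \<Longrightarrow> c \<le> N (of_real t + x) - t) \<Longrightarrow> c \<le> upper x"
  unfolding upper_def by (rule cINF_greatest) auto

lemma upper_lessE:
  assumes "upper x < c"
  obtains t where "t > 0" "N (of_real t + x) < t + c"
proof -
  have "\<exists>t>0. N (of_real t + x) < t + c"
  proof (rule ccontr)
    assume "\<not> ?thesis"
    then have "c \<le> upper x" by (intro upper_greatest) (force simp: not_less algebra_simps)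
    then show False using assms by simp
  qed
  then show ?thesis using that by blast
qed

lemma upper_le_N: "upper x \<le> N x"
  using upper_le[of 1 x] N_triangle[of 1 x] N_one by simp

lemma upper_add: "upper (x + y) \<le> upper x + upper y"
proof -
  have *: "upper (x + y) \<le> (N (of_real s + x) - s) + (N (of_real t + y) - t)" if "s > 0" "t > 0" for s t
  proof -
    have "N (of_real (s + t) + (x + y)) \<le> N (of_real s + x) + N (of_real t + y)"
      using N_triangle[of "of_real s + x" "of_real t + y"] by (simp add: algebra_simps)
    then show ?thesis using upper_le[of "s + t" "x + y"] that by simp
  qed
  show ?thesis
    unfolding upper_def[of x] upper_def[of y] by (rule le_cInf_add) (use * in auto)
qed

lemma upper_scaleR_pos:
  assumes "r > 0"
  shows "upper (r *\<^sub>R x) = r * upper x"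
proof -
  have *: "upper (r *\<^sub>R x) \<le> r * upper x" if "r > 0" for r x
  proof -
    have "upper (r *\<^sub>R x) / r \<le> upper x"
    proof (rule upper_greatest)
      fix t :: real assume "t > 0"
      have "of_real (r * t) + r *\<^sub>R x = r *\<^sub>R (of_real t + x)"
        by (simp add: of_real_def scaleR_add_right)
      then have "upper (r *\<^sub>R x) \<le> r * N (of_real t + x) - r * t"
        using upper_le[of "r * t" "r *\<^sub>R x"] that \<open>t > 0\<close> by (simp add: N_scaleR)
      then show "upper (r *\<^sub>R x) / r \<le> N (of_real t + x) - t"
        using that by (simp add: field_simps)
    qed
    then show ?thesis using that by (simp add: field_simps)
  qed
  have "upper ((1 / r) *\<^sub>R (r *\<^sub>R x)) \<le> (1 / r) * upper (r *\<^sub>R x)"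
    using *[of "1 / r" "r *\<^sub>R x"] assms by simp
  then have "r * upper x \<le> upper (r *\<^sub>R x)" using assms by (simp add: field_simps)
  then show ?thesis using *[OF assms, of x] by simp
qed

lemma upper_of_real_le: "upper (of_real c) \<le> c"
proof -
  have "upper (of_real c) \<le> N (of_real (\<bar>c\<bar> + 1) + of_real c) - (\<bar>c\<bar> + 1)"
    by (rule upper_le) simp
  also have "\<dots> = c" unfolding of_real_add[symmetric] N_of_real by simp
  finally show ?thesis .
qed

lemma upper_zero: "upper 0 = 0"
proof (rule antisym)
  show "upper 0 \<le> 0" using upper_of_real_le[of 0] by simp
  show "0 \<le> upper 0" by (rule upper_greatest) (simp add: N_of_real)
qed

lemma sublinear_upper: "sublinear_on UNIV upper"
  unfolding sublinear_on_def
proof (intro conjI ballI allI)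
  fix x y :: 'b show "upper (x + y) \<le> upper x + upper y" by (rule upper_add)
next
  fix n and x :: 'b
  have "of_nat n * x = real n *\<^sub>R x" by (simp add: scaleR_conv_of_real)
  then show "upper (of_nat n * x) = real n * upper x"
    by (cases "n = 0") (simp_all add: upper_zero upper_scaleR_pos)
qed

definition pos :: "'b \<Rightarrow> bool" where
  "pos x \<longleftrightarrow> upper (- x) \<le> 0"

lemma pos_scaleR: "r \<ge> 0 \<Longrightarrow> pos x \<Longrightarrow> pos (r *\<^sub>R x)"
  using upper_scaleR_pos[of r "- x"]
  by (cases "r = 0") (auto simp: pos_def upper_zero mult_nonneg_nonpos)

lemma upper_mono:
  assumes "pos (y - x)"
  shows "upper x \<le> upper y"
  using upper_add[of y "x - y"] assms by (simp add: pos_def)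

text \<open>The element \<open>v = 1 + sk + (sk)\<^sup>2/2\<close> agrees with the unitary \<open>exp(sk)\<close> to second order, and
  \<open>v\<^sup>* v = 1 + (sk)\<^sup>4/4\<close> has no lower order terms. So \<open>v + v\<^sup>* = 2 + s\<^sup>2 k\<^sup>2\<close> has norm at most \<open>2 + O(s\<^sup>4)\<close>; dividing by
  \<open>s\<^sup>2\<close> and letting \<open>s\<close> tend to zero gives the claim.\<close>

lemma pos_minus_skew_square:
  assumes "st k = - k"
  shows "pos (- (k * k))"
proof -
  define K where "K = N (k * k * k * k)"
  have bound: "upper (k * k) \<le> K / (2 * t)" if "t > 0" for t
  proof -
    define s where "s = sqrt (2 / t)"
    have s: "s > 0" "s * s = 2 / t" using that by (auto simp: s_def)
    define a where "a = s *\<^sub>R k"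
    have sta: "st a = - a" by (simp add: a_def st_simps assms)
    have a2: "a * a = (s * s) *\<^sub>R (k * k)" and a4: "a * a * a * a = (s * s * s * s) *\<^sub>R (k * k * k * k)"
      by (simp_all add: a_def algebra_simps)
    define v where "v = 1 + a + (1 / 2) *\<^sub>R (a * a)"
    have stv: "st v = 1 - a + (1 / 2) *\<^sub>R (a * a)"
      by (simp add: v_def st_simps sta)
    have half: "(1 / 2) *\<^sub>R x + ((1 / 2) *\<^sub>R x + y) = x + y" for x y :: 'b
      by (simp add: add.assoc[symmetric] flip: scaleR_left.add)
    have vv: "st v * v = 1 + (s * s * s * s / 4) *\<^sub>R (k * k * k * k)"
      unfolding stv unfolding v_def using a4 by (simp add: algebra_simps half)
    have "(N v)\<^sup>2 \<le> 1 + s * s * s * s / 4 * K"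
    proof -
      have "(N v)\<^sup>2 \<le> N (1 + (s * s * s * s / 4) *\<^sub>R (k * k * k * k))" using N_cstar[of v] vv by simp
      also have "\<dots> \<le> 1 + s * s * s * s / 4 * K"
        using N_triangle[of 1 "(s * s * s * s / 4) *\<^sub>R (k * k * k * k)"] s
        by (simp add: N_one N_scaleR K_def)
      finally show ?thesis .
    qed
    also have "\<dots> \<le> 1 + s * s * s * s / 4 * K + (s * s * s * s / 8 * K)\<^sup>2" by simp
    also have "\<dots> = (1 + s * s * s * s / 8 * K)\<^sup>2"
      by (simp add: power2_eq_square algebra_simps)
    finally have Nv: "N v \<le> 1 + s * s * s * s / 8 * K"
      by (rule power2_le_imp_le) (use s N_nonneg in \<open>auto simp: K_def\<close>)
    have "v + st v = (s * s) *\<^sub>R (of_real t + k * k)"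
      unfolding stv unfolding v_def a2 s(2) using that
      by (simp add: algebra_simps of_real_def half flip: scaleR_2 mult_2)
    then have "(s * s) * N (of_real t + k * k) \<le> 2 * N v"
      using N_triangle[of v "st v"] s(1) by (simp add: N_scaleR N_st)
    also have "\<dots> \<le> 2 + s * s * s * s / 4 * K" using Nv by simp
    also have "\<dots> = (s * s) * (t + K / (2 * t))"
      using that s by (simp add: field_simps s(2)) 
    finally have "N (of_real t + k * k) \<le> t + K / (2 * t)"
      using s(1) by simp
    then show ?thesis using upper_le[OF that, of "k * k"] by simp
  qed
  have "upper (k * k) \<le> 0"
  proof (rule field_le_epsilon)
    fix e :: real assume "e > 0"
    have K: "K \<ge> 0" by (simp add: K_def N_nonneg)
    have "upper (k * k) \<le> K / (2 * ((K + 1) / e))"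
      by (rule bound) (use \<open>e > 0\<close> K in auto)
    also have "\<dots> = (K / (2 * (K + 1))) * e" by simp
    also have "\<dots> \<le> 1 * e" by (rule mult_right_mono) (use K \<open>e > 0\<close> in \<open>auto simp: field_simps\<close>)
    finally show "upper (k * k) \<le> 0 + e" by simp
  qed
  then show ?thesis by (simp add: pos_def)
qed

lemma pos_square:
  assumes "st u = u"
  shows "pos (u * u)"
proof -
  have "st (im * u) = - (im * u)" by (simp add: st_simps assms im_central)
  then have "pos (- ((im * u) * (im * u)))" by (rule pos_minus_skew_square)
  moreover have "(im * u) * (im * u) = (im * im) * (u * u)"
    by (metis im_central mult.assoc)
  ultimately show ?thesis by (simp add: im_square)
qed

lemma pos_add: "pos x \<Longrightarrow> pos y \<Longrightarrow> pos (x + y)"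
  using upper_add[of "- x" "- y"] by (simp add: pos_def)

text \<open>Iterating \<open>w \<mapsto> (z + w\<^sup>2) / 2\<close> from \<open>0\<close> converges to a solution of \<open>(1 - w)\<^sup>2 = 1 - z\<close>. In the absence of completeness
  an iterate is used instead of the limit; its defect \<open>(1 - w\<^sub>n)\<^sup>2 - (1 - z)\<close> is \<open>2 (w\<^sub>n\<^sub>+\<^sub>1 - w\<^sub>n)\<close>, which decays like
  \<open>N(z)\<^sup>n\<close>. All iterates are polynomials in \<open>z\<close>, hence self-adjoint and in the bicommutant of \<open>z\<close>.\<close>

lemma approx_sqrt_one_minus:
  assumes "st z = z" "N z < 1" "e > 0"
  obtains w where "st w = w" "\<And>y. y * z = z * y \<Longrightarrow> y * w = w * y" "N (w * w - (1 - z)) < e"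
proof -
  define W where "W n = rec_nat 0 (\<lambda>_ w. (1 / 2) *\<^sub>R (z + w * w)) n" for n
  have W0: "W 0 = 0" and WS: "W (Suc n) = (1 / 2) *\<^sub>R (z + W n * W n)" for n
    by (simp_all add: W_def)
  define r where "r = N z"
  have r: "0 \<le> r" "r < 1" using assms N_nonneg by (auto simp: r_def)
  have st_W: "st (W n) = W n" for n
    by (induction n) (simp_all add: W0 WS st_simps assms)
  have comm: "y * W n = W n * y" if "y * z = z * y" for y n
  proof (induction n)
    case (Suc n)
    have "y * (W n * W n) = (W n * W n) * y" by (metis Suc mult.assoc)
    then show ?case by (simp add: WS that algebra_simps)
  qed (simp add: W0)
  have NW: "N (W n) \<le> r" for n
  proof (induction n)
    case (Suc n)
    have "N (W (Suc n)) \<le> (1 / 2) * (N z + N (W n) * N (W n))"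
      using N_triangle[of z "W n * W n"] N_mult[of "W n" "W n"] by (simp add: WS N_scaleR)
    also have "\<dots> \<le> (1 / 2) * (r + r * r)"
      using Suc N_nonneg[of "W n"] r by (intro mult_left_mono add_mono mult_mono) (auto simp: r_def)
    also have "\<dots> \<le> r" using r mult_left_mono[of r 1 r] by simp
    finally show ?case .
  qed (simp add: W0 N_zero r)
  have step: "N (W (Suc n) - W n) \<le> r ^ n" for n
  proof (induction n)
    case 0
    show ?case using NW[of 1] r by (simp add: W0)
  next
    case (Suc n)
    let ?d = "W (Suc n) - W n"
    have "W (Suc (Suc n)) - W (Suc n) = (1 / 2) *\<^sub>R (W (Suc n) * ?d + ?d * W n)"
      by (subst (1 2) WS) (simp add: algebra_simps)
    then have "N (W (Suc (Suc n)) - W (Suc n)) \<le> (1 / 2) * (N (W (Suc n)) * N ?d + N ?d * N (W n))"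
      using N_triangle[of "W (Suc n) * ?d" "?d * W n"] N_mult[of "W (Suc n)" ?d] N_mult[of ?d "W n"]
      by (simp add: N_scaleR)
    also have "\<dots> \<le> (1 / 2) * (r * N ?d + N ?d * r)"
      by (intro mult_left_mono add_mono mult_right_mono NW N_nonneg) auto
    also have "\<dots> = r * N ?d" by simp
    also have "\<dots> \<le> r * r ^ n" using Suc r by (intro mult_left_mono) auto
    finally show ?case by simp
  qed
  have "(\<lambda>n. r ^ n) \<longlonglongrightarrow> 0" using r by (intro LIMSEQ_power_zero) auto
  then have "\<forall>\<^sub>F n in sequentially. r ^ n < e / 2"
    using \<open>e > 0\<close> by (intro order_tendstoD) auto
  then obtain n where n: "r ^ n < e / 2"
    by (auto simp: eventually_sequentially)
  define w where "w = 1 - W n"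
  have "w * w - (1 - z) = 2 *\<^sub>R (W (Suc n) - W n)"
    by (simp add: WS w_def algebra_simps scaleR_2)
  then have "N (w * w - (1 - z)) < e"
    using step[of n] n by (simp add: N_scaleR)
  moreover have "st w = w" by (simp add: w_def st_simps st_W)
  moreover have "y * w = w * y" if "y * z = z * y" for y
    using comm[OF that] by (simp add: w_def algebra_simps)
  ultimately show thesis using that by blast
qed

lemma approx_sqrt:
  assumes "st x = x" "upper (- x) < 0" "e > 0"
  obtains w where "st w = w" "\<And>y. y * x = x * y \<Longrightarrow> y * w = w * y" "N (w * w - x) < e"
proof -
  obtain t where t: "t > 0" "N (of_real t + - x) < t + 0"
    using upper_lessE[OF assms(2)] by blast
  define z where "z = 1 - (1 / t) *\<^sub>R x"
  have "z = (1 / t) *\<^sub>R (of_real t + - x)"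
    using t by (simp add: z_def algebra_simps of_real_def)
  then have "N z < 1" using t by (simp add: N_scaleR)
  moreover have "st z = z" by (simp add: z_def st_simps assms)
  moreover have "e / t > 0" using assms t by simp
  ultimately obtain w where w: "st w = w" "\<And>y. y * z = z * y \<Longrightarrow> y * w = w * y"
    "N (w * w - (1 - z)) < e / t"
    using approx_sqrt_one_minus by blast
  define v where "v = sqrt t *\<^sub>R w"
  have "v * v - x = t *\<^sub>R (w * w - (1 - z))"
    using t by (simp add: v_def z_def algebra_simps)
  then have "N (v * v - x) = t * N (w * w - (1 - z))" using t by (simp add: N_scaleR)
  then have "N (v * v - x) < e" using w(3) t by (simp add: pos_less_divide_eq mult.commute)
  moreover have "st v = v" by (simp add: v_def st_simps w)
  moreover have "y * v = v * y" if "y * x = x * y" for y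
  proof -
    have "y * z = z * y" by (simp add: z_def algebra_simps that)
    then show ?thesis by (simp add: v_def w)
  qed
  ultimately show thesis using that by blast
qed

text \<open>With an approximate square root \<open>w\<close> of \<open>x\<close> commuting with \<open>s\<close>, the element \<open>s x s\<close> is close to the square of the
  self-adjoint \<open>s w\<close>.\<close>

lemma pos_sandwich:
  assumes "st x = x" "upper (- x) < 0" "st s = s" "s * x = x * s"
  shows "pos (s * x * s)"
  unfolding pos_def
proof (rule field_le_epsilon)
  fix e :: real assume "e > 0"
  define d where "d = e / ((N s)\<^sup>2 + 1)"
  have den: "(N s)\<^sup>2 + 1 > 0" by (simp add: add_nonneg_pos)
  then have "d > 0" using \<open>e > 0\<close> by (simp add: d_def)
  obtain w where w: "st w = w" "\<And>y. y * x = x * y \<Longrightarrow> y * w = w * y" "N (w * w - x) < d"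
    using approx_sqrt[OF assms(1,2) \<open>d > 0\<close>] by blast
  have sw: "s * w = w * s" using w(2) assms(4) by blast
  have "pos ((s * w) * (s * w))"
    by (rule pos_square) (simp add: st_simps w(1) assms(3) sw)
  then have "upper (- ((s * w) * (s * w))) \<le> 0" by (simp add: pos_def)
  moreover have "- (s * x * s) = - ((s * w) * (s * w)) + s * (w * w - x) * s"
  proof -
    have "(s * w) * (s * w) = s * (w * w) * s" by (metis sw mult.assoc)
    then show ?thesis by (simp add: algebra_simps)
  qed
  ultimately have "upper (- (s * x * s)) \<le> N (s * (w * w - x) * s)"
    using upper_add[of "- ((s * w) * (s * w))" "s * (w * w - x) * s"]
      upper_le_N[of "s * (w * w - x) * s"] by simp
  also have "\<dots> \<le> (N s * N (w * w - x)) * N s"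
    by (rule order_trans[OF N_mult mult_right_mono[OF N_mult N_nonneg]])
  also have "\<dots> \<le> (N s * d) * N s"
    using w(3) by (intro mult_right_mono mult_left_mono N_nonneg) auto
  also have "\<dots> \<le> e"
    using den \<open>e > 0\<close> by (simp add: d_def field_simps power2_eq_square)
  finally show "upper (- (s * x * s)) \<le> 0 + e" by simp
qed

text \<open>If \<open>P > upper (u\<^sup>2)\<close>, then \<open>P - u\<^sup>2\<close> is nearly \<open>w\<^sup>2\<close> with \<open>w\<close> commuting with \<open>u\<close>, so \<open>u + iw\<close> is nearly \<open>sqrt P\<close> times a
  unitary and \<open>u\<close> is its real part.\<close>

lemma N_square_le_upper_square:
  assumes "st u = u"
  shows "(N u)\<^sup>2 \<le> upper (u * u)"
proof (rule field_le_epsilon)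
  fix e :: real assume "e > 0"
  define P where "P = upper (u * u) + e / 2"
  define x where "x = of_real P - u * u"
  have "upper (- x) \<le> upper (u * u) + upper (of_real (- P))"
    using upper_add[of "u * u" "of_real (- P)"] by (simp add: x_def)
  also have "\<dots> < 0" using upper_of_real_le[of "- P"] \<open>e > 0\<close> by (simp add: P_def)
  finally have "upper (- x) < 0" .
  moreover have "st x = x" by (simp add: x_def st_simps assms)
  ultimately obtain w where w: "st w = w" "\<And>y. y * x = x * y \<Longrightarrow> y * w = w * y"
    "N (w * w - x) < e / 2"
    using approx_sqrt[of x "e / 2"] half_gt_zero[OF \<open>e > 0\<close>] by blast
  have "u * x = x * u" by (simp add: x_def algebra_simps of_real_def)
  then have uw: "u * w = w * u" by (rule w(2))
  define v where "v = u + im * w"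
  have stv: "st v = u - im * w" by (simp add: v_def st_simps assms w(1) im_central[of w])
  have "u * (im * w) = (im * u) * w"
    by (simp only: mult.assoc[symmetric] im_central[of u])
  then have "u * (im * w) = (im * w) * u"
    by (simp only: mult.assoc uw)
  moreover have "(im * w) * (im * w) = im * (w * im) * w"
    by (simp only: mult.assoc)
  then have "(im * w) * (im * w) = im * (im * w) * w"
    by (simp only: im_central[of w, symmetric])
  then have "(im * w) * (im * w) = (im * im) * (w * w)"
    by (simp only: mult.assoc)
  ultimately have "st v * v = u * u - (im * im) * (w * w)"
    unfolding stv unfolding v_def left_diff_distrib distrib_left by simp
  then have "st v * v = of_real P + (w * w - x)" by (simp add: im_square x_def)
  then have "(N v)\<^sup>2 \<le> \<bar>P\<bar> + e / 2"
    using N_cstar[of v] N_triangle[of "of_real P" "w * w - x"] w(3) by (simp add: N_of_real)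
  moreover have "P \<ge> 0"
  proof -
    have "- upper (- (u * u)) \<le> upper (u * u)"
      using upper_add[of "u * u" "- (u * u)"] by (simp add: upper_zero)
    then show ?thesis using pos_square[OF assms] \<open>e > 0\<close> by (simp add: P_def pos_def)
  qed
  moreover have "2 * N u \<le> 2 * N v"
    using N_triangle[of v "st v"] N_scaleR[of 2 u] stv by (simp add: N_st v_def scaleR_2)
  then have "(N u)\<^sup>2 \<le> (N v)\<^sup>2" using N_nonneg by (intro power_mono) auto
  ultimately show "(N u)\<^sup>2 \<le> upper (u * u) + e" by (simp add: P_def)
qed

lemma le_one_if_power_le_linear:
  fixes r c :: real
  assumes "\<And>j. r ^ (2 ^ j) \<le> 1 + 2 ^ j * c"
  shows "r \<le> 1"
proof (rule ccontr)
  assume "\<not> r \<le> 1"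
  then have r: "r > 1" by simp
  then have r': "norm (1 / r) < 1" by simp
  have "(\<lambda>n. real n * (1 / r) ^ n) \<longlonglongrightarrow> 0"
    using powser_times_n_limit_0[OF r'] by simp
  from tendsto_add[OF LIMSEQ_power_zero[OF r'] tendsto_mult_left[OF this, of c]]
  have "(\<lambda>n. (1 / r) ^ n + c * (real n * (1 / r) ^ n)) \<longlonglongrightarrow> 0 + c * 0" .
  then have "\<forall>\<^sub>F n in sequentially. (1 / r) ^ n + c * (real n * (1 / r) ^ n) < 1"
    by (intro order_tendstoD) auto
  then obtain m where m: "\<And>n. n \<ge> m \<Longrightarrow> (1 / r) ^ n + c * (real n * (1 / r) ^ n) < 1"
    by (auto simp: eventually_sequentially)
  have "m \<le> 2 ^ m" by (simp add: less_imp_le)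
  from m[OF this] have "1 + c * real (2 ^ m) < r ^ (2 ^ m)"
    using r by (simp add: power_one_over field_simps)
  then show False using assms[of m] by (simp add: mult.commute)
qed

text \<open>The products \<open>y y\<^sup>*\<close> and \<open>y\<^sup>* y\<close> have the same nonzero spectrum. In terms of norms: \<open>k (t - k)\<^sup>n = y (t - h)\<^sup>n y\<^sup>*\<close> for
  \<open>k = y y\<^sup>*\<close> and \<open>h = y\<^sup>* y\<close>, so the norm of \<open>(t - k)\<^sup>n\<close> grows at most like \<open>n b\<^sup>n\<close>, where \<open>b\<close> is the right-hand side of
  the claim. For \<open>n\<close> a power of two this norm is \<open>N(t - k)\<^sup>n\<close>, and the linear factor is lost in the limit.\<close>

lemma N_of_real_minus_flip:
  assumes "t > 0"
  shows "N (of_real t - y * st y) \<le> max t (N (of_real t - st y * y))"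
proof -
  define h k where "h = st y * y" and "k = y * st y"
  define b C where "b = max t (N (of_real t - h))" and "C = (N y)\<^sup>2"
  have b: "b > 0" "t \<le> b" using assms by (auto simp: b_def)
  have C: "C \<ge> 0" by (simp add: C_def)
  have intertwine: "k * (of_real t - k) ^ n = y * (of_real t - h) ^ n * st y" for n
  proof (induction n)
    case (Suc n)
    have "k * (of_real t - k) ^ Suc n = (k * (of_real t - k) ^ n) * (of_real t - k)"
      by (simp add: power_Suc2 mult.assoc del: power_Suc)
    also have "\<dots> = y * (of_real t - h) ^ n * (st y * (of_real t - k))"
      by (simp add: Suc mult.assoc)
    also have "st y * (of_real t - k) = (of_real t - h) * st y"
      by (simp add: h_def k_def left_diff_distrib right_diff_distrib of_real_def mult.assoc)
    finally show ?case by (simp add: power_Suc2 mult.assoc del: power_Suc)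
  next
    case 0
    show ?case by (simp add: k_def)
  qed
  have bound: "b * N ((of_real t - k) ^ n) \<le> (b + real n * C) * b ^ n" for n
  proof (induction n)
    case (Suc n)
    have "(of_real t - k) ^ Suc n = t *\<^sub>R (of_real t - k) ^ n - k * (of_real t - k) ^ n"
      by (simp add: algebra_simps scaleR_conv_of_real)
    then have "N ((of_real t - k) ^ Suc n) \<le> t * N ((of_real t - k) ^ n) + N (y * (of_real t - h) ^ n * st y)"
      using N_diff[of "t *\<^sub>R (of_real t - k) ^ n" "k * (of_real t - k) ^ n"] assms
      by (simp add: intertwine N_scaleR)
    also have "N (y * (of_real t - h) ^ n * st y) \<le> (N y * b ^ n) * N y"
    proof -
      have "N ((of_real t - h) ^ n) \<le> b ^ n"
        by (rule order_trans[OF N_power_le power_mono]) (auto simp: b_def N_nonneg)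
      then have "N (y * (of_real t - h) ^ n) \<le> N y * b ^ n"
        by (intro order_trans[OF N_mult] mult_left_mono N_nonneg)
      then have "N (y * (of_real t - h) ^ n) * N (st y) \<le> (N y * b ^ n) * N y"
        by (simp only: N_st) (intro mult_right_mono N_nonneg)
      then show ?thesis by (rule order_trans[OF N_mult])
    qed
    also have "t * N ((of_real t - k) ^ n) \<le> b * N ((of_real t - k) ^ n)"
      using b by (intro mult_right_mono N_nonneg)
    finally have "N ((of_real t - k) ^ Suc n) \<le> (b + real n * C) * b ^ n + C * b ^ n"
      using Suc by (simp add: C_def power2_eq_square mult.commute mult.left_commute)
    then have "b * N ((of_real t - k) ^ Suc n) \<le> b * ((b + real n * C) * b ^ n + C * b ^ n)"
      using b by (intro mult_left_mono) auto
    then show ?case by (simp add: algebra_simps)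
  qed (simp add: N_one)
  have "N (of_real t - k) / b \<le> 1"
  proof (rule le_one_if_power_le_linear)
    fix j
    have "st (of_real t - k) = of_real t - k" by (simp add: k_def st_simps)
    then have "b * N (of_real t - k) ^ (2 ^ j) \<le> (b + 2 ^ j * C) * b ^ (2 ^ j)"
      using bound[of "2 ^ j"] N_self_adjoint_power[of "of_real t - k" j] by simp
    then show "(N (of_real t - k) / b) ^ (2 ^ j) \<le> 1 + 2 ^ j * (C / b)"
      using b by (simp add: power_divide field_simps)
  qed
  then show ?thesis using b by (simp add: field_simps b_def h_def k_def)
qed

lemma upper_minus_flip: "upper (- (y * st y)) \<le> max 0 (upper (- (st y * y)))"
proof (rule dense_ge)
  fix c assume "max 0 (upper (- (st y * y))) < c"
  then have c: "c > 0" "upper (- (st y * y)) < c" by auto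
  obtain t where t: "t > 0" "N (of_real t + - (st y * y)) < t + c"
    using upper_lessE[OF c(2)] by blast
  show "upper (- (y * st y)) \<le> c"
    using upper_le[OF t(1), of "- (y * st y)"] N_of_real_minus_flip[OF t(1), of y] t(2) c(1)
    by (auto simp: max_def split: if_splits)
qed

text \<open>The sum \<open>y y\<^sup>* + y\<^sup>* y\<close> is half the square of \<open>y + y\<^sup>*\<close> minus half the square of the skew \<open>y - y\<^sup>*\<close>, hence positive.
  So \<open>- y y\<^sup>*\<close> is bounded above by \<open>y\<^sup>* y\<close>, and \<open>y y\<^sup>*\<close> may be exchanged for \<open>y\<^sup>* y\<close> by the previous lemma: the
  negative part of \<open>y\<^sup>* y\<close> is never larger than its positive part.\<close>

lemma upper_minus_le_upper: "upper (- (st y * y)) \<le> max 0 (upper (st y * y))"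
proof -
  define a d where "a = y + st y" and "d = y - st y"
  have "pos (a * a)" by (rule pos_square) (simp add: a_def st_simps)
  moreover have "pos (- (d * d))"
    by (rule pos_minus_skew_square) (simp add: d_def st_simps)
  ultimately have "pos ((1 / 2) *\<^sub>R (a * a + - (d * d)))"
    by (intro pos_scaleR pos_add) auto
  moreover have "a * a + - (d * d) = 2 *\<^sub>R (y * st y + st y * y)"
    by (simp add: a_def d_def algebra_simps scaleR_2)
  ultimately have "pos (st y * y - - (y * st y))" by (simp add: add.commute)
  then have "upper (- (y * st y)) \<le> upper (st y * y)" by (rule upper_mono)
  moreover have "upper (- (st y * y)) \<le> max 0 (upper (- (y * st y)))"
    using upper_minus_flip[of "st y"] by (simp add: st_st)
  ultimately show ?thesis by auto
qed

text \<open>Passing from \<open>x\<close> to \<open>y = x (M - h)\<close>, with \<open>h = x\<^sup>* x\<close>, replaces \<open>h\<close> by \<open>h (M - h)\<^sup>2\<close>. On the positive part of the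
  spectrum this is at most \<open>4/27 M\<^sup>3\<close>, while the negative part is multiplied by at least \<open>M\<^sup>2\<close>. Hence the ratio of the
  negative to the positive bound grows by the factor \<open>27/4\<close> in each step, although it can never exceed one.\<close>

lemma upper_minus_geometric:
  assumes "M > 0" "upper (st x * x) \<le> M"
  shows "upper (- (st x * x)) \<le> M * (4 / 27) ^ n"
  using assms
proof (induction n arbitrary: x M)
  case 0
  then show ?case using upper_minus_le_upper[of x] by simp
next
  case (Suc n)
  define h where "h = st x * x"
  have sth: "st h = h" by (simp add: h_def st_simps)
  define y where "y = x * (of_real M - h)"
  have yy: "st y * y = (of_real M - h) * h * (of_real M - h)"
    by (simp add: y_def st_simps sth) (simp add: h_def mult.assoc)
  have strict: "upper (- (of_real c - h)) < 0" if "c > M" for c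
  proof -
    have "upper (- (of_real c - h)) \<le> upper h + upper (of_real (- c))"
      using upper_add[of h "of_real (- c)"] by simp
    also have "\<dots> < 0" using upper_of_real_le[of "- c"] Suc.prems(2) that by (simp add: h_def)
    finally show ?thesis .
  qed
  have sandwich: "pos (s * (of_real c - h) * s)" if "c > M" "st s = s" "s * h = h * s" for c s
  proof (rule pos_sandwich[OF _ strict[OF that(1)] that(2)])
    show "st (of_real c - h) = of_real c - h" by (simp add: st_simps sth)
    show "s * (of_real c - h) = (of_real c - h) * s"
      by (simp add: left_diff_distrib right_diff_distrib of_real_def that(3))
  qed
  have "upper (st y * y) \<le> upper (of_real (4 / 27 * M ^ 3))"
  proof (rule upper_mono)
    let ?s = "h - of_real (M / 3)"
    let ?c = "of_real (M / 3) :: 'b"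
    have "h * ?c = ?c * h" by (simp add: of_real_def)
    from cubic_sandwich[OF this]
    have "of_real (4 / 27 * M ^ 3) - st y * y = ?s * (of_real (4 / 3 * M) - h) * ?s"
      by (simp add: yy power3_eq_cube mult.assoc flip: of_real_add of_real_mult)
    moreover have "pos \<dots>"
      by (rule sandwich) (use \<open>M > 0\<close> in \<open>simp_all add: st_simps sth algebra_simps of_real_def\<close>)
    ultimately show "pos (of_real (4 / 27 * M ^ 3) - st y * y)" by simp
  qed
  also have "\<dots> \<le> 4 / 27 * M ^ 3" by (rule upper_of_real_le)
  finally have "upper (- (st y * y)) \<le> 4 / 27 * M ^ 3 * (4 / 27) ^ n"
    using \<open>M > 0\<close> by (intro Suc.IH) auto
  moreover have "upper (- (M\<^sup>2 *\<^sub>R h)) \<le> upper (- (st y * y))"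
  proof (rule upper_mono)
    let ?c = "of_real M :: 'b"
    have "h * ?c = ?c * h" by (simp add: of_real_def)
    from quadratic_sandwich[OF this]
    have "- (st y * y) - - (M\<^sup>2 *\<^sub>R h) = h * (of_real (2 * M) - h) * h"
      by (simp add: yy scaleR_conv_of_real power2_eq_square flip: of_real_add of_real_mult)
    moreover have "pos \<dots>"
      by (rule sandwich) (use \<open>M > 0\<close> in \<open>simp_all add: sth\<close>)
    ultimately show "pos (- (st y * y) - - (M\<^sup>2 *\<^sub>R h))" by simp
  qed
  moreover have "upper (- (M\<^sup>2 *\<^sub>R h)) = M\<^sup>2 * upper (- h)"
    using upper_scaleR_pos[of "M\<^sup>2" "- h"] \<open>M > 0\<close> by simp
  ultimately have "M\<^sup>2 * upper (- h) \<le> M\<^sup>2 * (M * (4 / 27) ^ Suc n)"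
    by (simp add: power2_eq_square power3_eq_cube mult_ac)
  then show ?case using \<open>M > 0\<close> by (simp add: h_def)
qed

theorem pos_star_mult_self: "pos (st x * x)"
proof -
  define M where "M = N (st x * x) + 1"
  have M: "M > 0" "upper (st x * x) \<le> M"
    using N_nonneg[of "st x * x"] upper_le_N[of "st x * x"] by (simp_all add: M_def)
  have "(\<lambda>n. M * (4 / 27) ^ n) \<longlonglongrightarrow> M * 0"
    by (intro tendsto_intros LIMSEQ_power_zero) auto
  then have "upper (- (st x * x)) \<le> M * 0"
    by (rule LIMSEQ_le_const) (use upper_minus_geometric[OF M] in auto)
  then show ?thesis by (simp add: pos_def)
qed

text \<open>Hahn--Banach for \<open>upper\<close> gives a functional with the value \<open>upper (u\<^sup>2)\<close> at \<open>u\<^sup>2\<close>. It is positive because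
  \<open>upper (- x\<^sup>* x) \<le> 0\<close>; averaging with its composition with the involution makes it symmetric.\<close>

theorem positive_functional_exists:
  assumes "st u = u"
  obtains w where "\<And>x y. w (x + y) = w x + w y" and "\<And>x. \<bar>w x\<bar> \<le> N x"
    and "\<And>x. w (st x) = w x" and "\<And>x. 0 \<le> w (st x * x)" and "(N u)\<^sup>2 \<le> w (u * u)"
proof -
  have "add_subgroup (UNIV :: 'b set)" by (simp add: add_subgroup_def)
  then obtain w0 where w0: "\<And>x y. w0 (x + y) = w0 x + w0 y" "\<And>x. w0 x \<le> upper x"
    "w0 (u * u) = upper (u * u)"
    by (rule hahn_banach_additive[OF _ sublinear_upper UNIV_I]) blast
  have "w0 0 = 0" using w0(1)[of 0 0] by simp
  then have neg: "w0 (- x) = - w0 x" for x using w0(1)[of x "- x"] by simp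
  have bound: "\<bar>w0 x\<bar> \<le> N x" for x
    using w0(2)[of x] w0(2)[of "- x"] upper_le_N[of x] upper_le_N[of "- x"] neg[of x] N_minus[of x]
    by simp
  have w0_pos: "0 \<le> w0 (st x * x)" for x
    using w0(2)[of "- (st x * x)"] pos_star_mult_self[of x] neg[of "st x * x"] by (simp add: pos_def)
  define w where "w x = (w0 x + w0 (st x)) / 2" for x
  show thesis
  proof (rule that[of w])
    show "\<bar>w x\<bar> \<le> N x" for x
      using bound[of x] bound[of "st x"] by (simp add: w_def N_st)
    show "(N u)\<^sup>2 \<le> w (u * u)"
      using N_square_le_upper_square[OF assms] w0(3) by (simp add: w_def st_simps assms)
    show "w (x + y) = w x + w y" for x y
      by (simp add: w_def w0(1) st_add add_divide_distrib)
    show "w (st x) = w x" for x by (simp add: w_def st_st)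
    show "0 \<le> w (st x * x)" for x using w0_pos[of x] by (simp add: w_def st_mult st_st)
  qed
qed

end

section \<open>The free unital *-algebra on a set\<close>

text \<open>A copy of the lists, so that their monoid structure can be written additively and the finitely
  supported functions on words form a ring under convolution.\<close>

datatype 'a word = Word (letters: "'a list")

instantiation word :: (type) monoid_add
begin
definition "0 = Word []"
definition "v + w = Word (letters v @ letters w)"
instance
  by standard (auto simp: zero_word_def plus_word_def)
end

lemma poly_mapping_single_induct [case_names zero single add]:
  fixes b :: "'k \<Rightarrow>\<^sub>0 'c::comm_monoid_add"
  assumes "P 0" "\<And>k c. P (Poly_Mapping.single k c)" "\<And>b b'. P b \<Longrightarrow> P b' \<Longrightarrow> P (b + b')"
  shows "P b"
proof (induction b rule: update_induct)
  case const
  show ?case by (rule assms)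
next
  case (update f a c)
  have "Poly_Mapping.update a c f = Poly_Mapping.single a c + f"
    using update(1)
    by (intro poly_mapping_eqI) (auto simp: lookup_update lookup_add lookup_single in_keys_iff when_def)
  then show ?case using assms update by simp
qed

instantiation poly_mapping :: (type, real_vector) real_vector
begin
definition scaleR_poly_mapping :: "real \<Rightarrow> ('a \<Rightarrow>\<^sub>0 'b) \<Rightarrow> 'a \<Rightarrow>\<^sub>0 'b" where
  "scaleR_poly_mapping r = Poly_Mapping.map ((*\<^sub>R) r)"
lemma lookup_scaleR: "Poly_Mapping.lookup (r *\<^sub>R b) k = r *\<^sub>R Poly_Mapping.lookup b k" for b :: "'a \<Rightarrow>\<^sub>0 'b"
  by (auto simp: scaleR_poly_mapping_def map.rep_eq when_def)
instance
  by standard (auto intro!: poly_mapping_eqI simp: lookup_scaleR lookup_add algebra_simps)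
end

lemma scaleR_single: "r *\<^sub>R Poly_Mapping.single k c = Poly_Mapping.single k (r *\<^sub>R c)"
  by (rule poly_mapping_eqI) (simp add: lookup_scaleR lookup_single when_def)

lemma single_zero_central:
  fixes b :: "'k::monoid_add \<Rightarrow>\<^sub>0 'c::comm_semiring_0"
  shows "Poly_Mapping.single 0 c * b = b * Poly_Mapping.single 0 c"
  by (induction b rule: poly_mapping_single_induct) (simp_all add: mult_single algebra_simps)

instance poly_mapping :: (monoid_add, real_algebra_1) real_algebra_1
proof
  fix r and x y :: "'a \<Rightarrow>\<^sub>0 'b"
  have scaleR_mult_single: "r *\<^sub>R (Poly_Mapping.single k c) * Poly_Mapping.single l d
      = r *\<^sub>R (Poly_Mapping.single k c * Poly_Mapping.single l d)"
    "Poly_Mapping.single k c * r *\<^sub>R (Poly_Mapping.single l d)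
      = r *\<^sub>R (Poly_Mapping.single k c * Poly_Mapping.single l d)" for k l :: 'a and c d :: 'b
    by (simp_all add: scaleR_single mult_single)
  show "r *\<^sub>R x * y = r *\<^sub>R (x * y)"
  proof (induction x rule: poly_mapping_single_induct)
    case (single k c)
    show ?case
      by (induction y rule: poly_mapping_single_induct) (simp_all add: scaleR_mult_single algebra_simps)
  qed (simp_all add: algebra_simps)
  show "x * r *\<^sub>R y = r *\<^sub>R (x * y)"
  proof (induction x rule: poly_mapping_single_induct)
    case (single k c)
    show ?case
      by (induction y rule: poly_mapping_single_induct) (simp_all add: scaleR_mult_single algebra_simps)
  qed (simp_all add: algebra_simps)
qed

text \<open>The flag of a letter tells whether the generator or its formal adjoint is meant. The involution is
  therefore defined without reference to a particular C*-algebra and is an involution on all words.\<close>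

type_synonym 'a free_star_algebra = "('a \<times> bool) word \<Rightarrow>\<^sub>0 complex"

definition word_star :: "('a \<times> bool) word \<Rightarrow> ('a \<times> bool) word" where
  "word_star w = Word (rev (map (apsnd Not) (letters w)))"

lemma word_star_word_star: "word_star (word_star w) = w"
  by (cases w) (simp add: word_star_def rev_map apsnd_def comp_def map_prod_def case_prod_unfold)

lemma inj_word_star: "inj word_star"
  by (rule inj_on_inverseI[where g = word_star]) (rule word_star_word_star)

lemma word_star_add: "word_star (v + w) = word_star w + word_star v"
  by (simp add: word_star_def plus_word_def)

lemma word_star_zero: "word_star 0 = 0"
  by (simp add: word_star_def zero_word_def)

definition free_star :: "'a free_star_algebra \<Rightarrow> 'a free_star_algebra" where
  "free_star b = Poly_Mapping.map_key word_star (Poly_Mapping.map cnj b)"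

lemma lookup_free_star: "Poly_Mapping.lookup (free_star b) w = cnj (Poly_Mapping.lookup b (word_star w))"
  by (auto simp: free_star_def map_key.rep_eq[OF inj_word_star] map.rep_eq when_def)

lemma free_star_add: "free_star (b + b') = free_star b + free_star b'"
  by (rule poly_mapping_eqI) (simp add: lookup_free_star lookup_add)

lemma free_star_scaleR: "free_star (r *\<^sub>R b) = r *\<^sub>R free_star b"
  by (rule poly_mapping_eqI) (simp add: lookup_free_star lookup_scaleR)

lemma free_star_free_star: "free_star (free_star b) = b"
  by (rule poly_mapping_eqI) (simp add: lookup_free_star word_star_word_star)

lemma free_star_zero: "free_star 0 = 0"
  by (rule poly_mapping_eqI) (simp add: lookup_free_star)

lemma free_star_single:
  "free_star (Poly_Mapping.single w c) = Poly_Mapping.single (word_star w) (cnj c)"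
  by (rule poly_mapping_eqI)
    (auto simp: lookup_free_star lookup_single when_def word_star_word_star)

lemma free_star_mult: "free_star (b * b') = free_star b' * free_star b"
proof (induction b rule: poly_mapping_single_induct)
  case (single w c)
  show ?case
    by (induction b' rule: poly_mapping_single_induct)
      (simp_all add: free_star_zero free_star_single free_star_add mult_single word_star_add
        algebra_simps)
qed (simp_all add: free_star_zero free_star_add algebra_simps)

section \<open>Positive functionals on C*-algebras\<close>

lemma complex_ring_simps [simp]:
  "carrier complex_ring = UNIV" "add complex_ring = (+)" "mult complex_ring = (*)"
  "one complex_ring = 1" "zero complex_ring = 0"
  by (simp_all add: complex_ring_def)

lemma a_inv_complex_ring [simp]: "a_inv complex_ring c = - c"
proof -
  interpret cring complex_ring by (rule cring_complex_ring)
  show ?thesis by (rule minus_equality) simp_all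
qed

context cbanach_space
begin

lemma smult_closed' [simp, intro]: "x \<in> carrier V \<Longrightarrow> c \<odot> x \<in> carrier V"
  by (rule smult_closed) simp_all

lemma smult_add_left: "x \<in> carrier V \<Longrightarrow> (c + d) \<odot> x = c \<odot> x \<oplus> d \<odot> x"
  using smult_l_distr[of c d x] by simp

lemma smult_add_right: "x \<in> carrier V \<Longrightarrow> y \<in> carrier V \<Longrightarrow> c \<odot> (x \<oplus> y) = c \<odot> x \<oplus> c \<odot> y"
  using smult_r_distr[of c x y] by simp

lemma smult_smult: "x \<in> carrier V \<Longrightarrow> c \<odot> (d \<odot> x) = (c * d) \<odot> x"
  using smult_assoc1[of c d x] by simp

lemma smult_one' [simp]: "x \<in> carrier V \<Longrightarrow> 1 \<odot> x = x"
  using smult_one[of x] by simp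

lemma smult_zero_left [simp]: "x \<in> carrier V \<Longrightarrow> 0 \<odot> x = \<zero>"
  using smult_l_null[of x] by simp

lemma smult_zero_right [simp]: "c \<odot> \<zero> = \<zero>"
  using smult_r_null[of c] by simp

lemma smult_minus_one: "x \<in> carrier V \<Longrightarrow> (- 1) \<odot> x = \<ominus> x"
  using smult_l_minus[of 1 x] by simp

lemma minus_eq_smult: "x \<in> carrier V \<Longrightarrow> y \<in> carrier V \<Longrightarrow> x \<ominus> y = x \<oplus> (- 1) \<odot> y"
  by (simp add: a_minus_def smult_minus_one)

lemma nrm_zero [simp]: "nrm V \<zero> = 0"
  using nrm_eq_zero[of \<zero>] by simp

lemma nrm_finsum_le:
  assumes "finite A" "f \<in> A \<rightarrow> carrier V"
  shows "nrm V (finsum V f A) \<le> (\<Sum>x\<in>A. nrm V (f x))"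
  using assms
proof (induction A rule: finite_induct)
  case (insert x A)
  have "nrm V (f x \<oplus> finsum V f A) \<le> nrm V (f x) + nrm V (finsum V f A)"
    by (rule nrm_triangle) (use insert in \<open>auto intro!: finsum_closed\<close>)
  then show ?case using insert by (simp add: finsum_insert Pi_def)
qed simp

end

text \<open>The structure of the unit fibre of a Fell bundle, which need not contain a unit element.\<close>

locale cstar_algebra = cbanach_space V for V :: "('a, 'v) cnormed_space_scheme" (structure) +
  fixes mul :: "'a \<Rightarrow> 'a \<Rightarrow> 'a" (infixl \<open>\<cdot>\<close> 72) and adj :: "'a \<Rightarrow> 'a"
  assumes mul_closed [simp, intro]: "\<lbrakk>a \<in> carrier V; b \<in> carrier V\<rbrakk> \<Longrightarrow> a \<cdot> b \<in> carrier V"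
    and mul_add_left: "\<lbrakk>a \<in> carrier V; a' \<in> carrier V; b \<in> carrier V\<rbrakk> \<Longrightarrow> (a \<oplus> a') \<cdot> b = a \<cdot> b \<oplus> a' \<cdot> b"
    and mul_add_right: "\<lbrakk>a \<in> carrier V; b \<in> carrier V; b' \<in> carrier V\<rbrakk> \<Longrightarrow> a \<cdot> (b \<oplus> b') = a \<cdot> b \<oplus> a \<cdot> b'"
    and mul_smult_left: "\<lbrakk>a \<in> carrier V; b \<in> carrier V\<rbrakk> \<Longrightarrow> (c \<odot> a) \<cdot> b = c \<odot> (a \<cdot> b)"
    and mul_smult_right: "\<lbrakk>a \<in> carrier V; b \<in> carrier V\<rbrakk> \<Longrightarrow> a \<cdot> (c \<odot> b) = c \<odot> (a \<cdot> b)"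
    and mul_assoc: "\<lbrakk>a \<in> carrier V; b \<in> carrier V; d \<in> carrier V\<rbrakk> \<Longrightarrow> (a \<cdot> b) \<cdot> d = a \<cdot> (b \<cdot> d)"
    and adj_closed [simp, intro]: "a \<in> carrier V \<Longrightarrow> adj a \<in> carrier V"
    and adj_add: "\<lbrakk>a \<in> carrier V; b \<in> carrier V\<rbrakk> \<Longrightarrow> adj (a \<oplus> b) = adj a \<oplus> adj b"
    and adj_smult: "a \<in> carrier V \<Longrightarrow> adj (c \<odot> a) = cnj c \<odot> adj a"
    and adj_mul: "\<lbrakk>a \<in> carrier V; b \<in> carrier V\<rbrakk> \<Longrightarrow> adj (a \<cdot> b) = adj b \<cdot> adj a"
    and adj_adj: "a \<in> carrier V \<Longrightarrow> adj (adj a) = a"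
    and nrm_adj: "a \<in> carrier V \<Longrightarrow> nrm V (adj a) = nrm V a"
    and nrm_mul: "\<lbrakk>a \<in> carrier V; b \<in> carrier V\<rbrakk> \<Longrightarrow> nrm V (a \<cdot> b) \<le> nrm V a * nrm V b"
    and nrm_adj_mul: "a \<in> carrier V \<Longrightarrow> nrm V (adj a \<cdot> a) = (nrm V a)\<^sup>2"
begin

lemma mul_zero_left [simp]: "a \<in> carrier V \<Longrightarrow> \<zero> \<cdot> a = \<zero>"
  using mul_smult_left[of \<zero> a 0] by simp

lemma mul_zero_right [simp]: "a \<in> carrier V \<Longrightarrow> a \<cdot> \<zero> = \<zero>"
  using mul_smult_right[of a \<zero> 0] by simp

lemma adj_zero [simp]: "adj \<zero> = \<zero>"
  using adj_smult[of \<zero> 0] by simp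

text \<open>Letters outside the carrier act as zero, so every word over the whole type acts on the carrier.\<close>

definition letter :: "'a \<times> bool \<Rightarrow> 'a" where
  "letter l = (if fst l \<in> carrier V then (if snd l then adj (fst l) else fst l) else \<zero>)"

lemma letter_closed [simp, intro]: "letter l \<in> carrier V"
  by (simp add: letter_def)

lemma adj_letter: "adj (letter l) = letter (apsnd Not l)"
  by (cases l) (simp add: letter_def adj_adj)

definition word_act :: "('a \<times> bool) word \<Rightarrow> 'a \<Rightarrow> 'a" where
  "word_act w c = foldr (\<lambda>l x. letter l \<cdot> x) (letters w) c"

lemma word_act_closed [simp, intro]: "c \<in> carrier V \<Longrightarrow> word_act w c \<in> carrier V"
proof -
  assume "c \<in> carrier V"
  then have "foldr (\<lambda>l x. letter l \<cdot> x) ls c \<in> carrier V" for ls by (induction ls) auto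
  then show ?thesis by (simp add: word_act_def)
qed

lemma word_act_zero [simp]: "word_act 0 c = c"
  by (simp add: word_act_def zero_word_def)

lemma word_act_plus: "word_act (v + w) c = word_act v (word_act w c)"
  by (simp add: word_act_def plus_word_def)

lemma word_act_add:
  assumes "c \<in> carrier V" "d \<in> carrier V"
  shows "word_act w (c \<oplus> d) = word_act w c \<oplus> word_act w d"
proof -
  have "foldr (\<lambda>l x. letter l \<cdot> x) ls (c \<oplus> d) = word_act (Word ls) c \<oplus> word_act (Word ls) d" for ls
  proof (induction ls)
    case (Cons l ls)
    have "word_act (Word (l # ls)) c = letter l \<cdot> word_act (Word ls) c" for l ls c
      by (simp add: word_act_def)
    then show ?case using Cons assms by (simp add: mul_add_right)
  qed (simp add: word_act_def)
  then show ?thesis by (cases w) (simp add: word_act_def)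
qed

lemma word_act_smult:
  assumes "c \<in> carrier V"
  shows "word_act w (k \<odot> c) = k \<odot> word_act w c"
proof -
  have "foldr (\<lambda>l x. letter l \<cdot> x) ls (k \<odot> c) = k \<odot> word_act (Word ls) c" for ls
  proof (induction ls)
    case (Cons l ls)
    have "word_act (Word (l # ls)) c = letter l \<cdot> word_act (Word ls) c" for l ls c
      by (simp add: word_act_def)
    then show ?case using Cons assms by (simp add: mul_smult_right)
  qed (simp add: word_act_def)
  then show ?thesis by (cases w) (simp add: word_act_def)
qed

lemma adj_word_act:
  assumes "c \<in> carrier V" "d \<in> carrier V"
  shows "adj (word_act w c) \<cdot> d = adj c \<cdot> word_act (word_star w) d"
proof -
  have "adj (word_act (Word ls) c) \<cdot> d = adj c \<cdot> word_act (word_star (Word ls)) d"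
    if "d \<in> carrier V" for ls d
    using that
  proof (induction ls arbitrary: d)
    case (Cons l ls)
    have eq: "word_act (Word (l # ls)) c = letter l \<cdot> word_act (Word ls) c"
      by (simp add: word_act_def)
    have "word_act (word_star (Word (l # ls))) d
        = word_act (word_star (Word ls)) (letter (apsnd Not l) \<cdot> d)"
      by (simp add: word_act_def word_star_def)
    moreover have "adj (word_act (Word (l # ls)) c) \<cdot> d
        = adj (word_act (Word ls) c) \<cdot> (letter (apsnd Not l) \<cdot> d)"
      using assms(1) Cons.prems by (simp add: eq adj_mul adj_letter mul_assoc)
    moreover have "\<dots> = adj c \<cdot> word_act (word_star (Word ls)) (letter (apsnd Not l) \<cdot> d)"
      using Cons.prems by (intro Cons.IH) simp
    ultimately show ?case by simp
  qed (simp add: word_act_def word_star_def)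
  then show ?thesis using assms by (cases w) simp
qed

definition act :: "'a free_star_algebra \<Rightarrow> 'a \<Rightarrow> 'a" where
  "act b c = (\<Oplus>w\<in>Poly_Mapping.keys b. Poly_Mapping.lookup b w \<odot> word_act w c)"

lemma act_closed [simp, intro]: "c \<in> carrier V \<Longrightarrow> act b c \<in> carrier V"
  unfolding act_def by (rule finsum_closed) auto

lemma act_superset:
  assumes "finite K" "Poly_Mapping.keys b \<subseteq> K" "c \<in> carrier V"
  shows "act b c = (\<Oplus>w\<in>K. Poly_Mapping.lookup b w \<odot> word_act w c)"
  unfolding act_def
  by (rule add.finprod_mono_neutral_cong_left) (use assms in \<open>auto simp: in_keys_iff\<close>)

lemma act_zero [simp]: "act 0 c = \<zero>"
  by (simp add: act_def)

lemma act_single: "c \<in> carrier V \<Longrightarrow> act (Poly_Mapping.single w k) c = k \<odot> word_act w c"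
  using act_superset[of "{w}" "Poly_Mapping.single w k" c] by (simp add: finsum_insert)

lemma act_add:
  assumes "c \<in> carrier V"
  shows "act (b + b') c = act b c \<oplus> act b' c"
proof -
  let ?K = "Poly_Mapping.keys b \<union> Poly_Mapping.keys b'"
  have "act (b + b') c = (\<Oplus>w\<in>?K. Poly_Mapping.lookup (b + b') w \<odot> word_act w c)"
    by (rule act_superset) (use assms Poly_Mapping.keys_add[of b b'] in auto)
  also have "\<dots> = (\<Oplus>w\<in>?K. Poly_Mapping.lookup b w \<odot> word_act w c \<oplus> Poly_Mapping.lookup b' w \<odot> word_act w c)"
    by (rule finsum_cong) (use assms in \<open>auto simp: lookup_add smult_add_left simp_implies_def\<close>)
  also have "\<dots> = act b c \<oplus> act b' c"
    using assms by (subst finsum_addf) (auto simp: act_superset[of ?K])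
  finally show ?thesis .
qed

lemma act_add_right:
  assumes "c \<in> carrier V" "d \<in> carrier V"
  shows "act b (c \<oplus> d) = act b c \<oplus> act b d"
proof (induction b rule: poly_mapping_single_induct)
  case (single w k)
  show ?case using assms by (simp add: act_single word_act_add smult_add_right)
qed (use assms in \<open>simp_all add: act_add a_ac\<close>)

lemma act_smult_right:
  assumes "c \<in> carrier V"
  shows "act b (k \<odot> c) = k \<odot> act b c"
proof (induction b rule: poly_mapping_single_induct)
  case (single w k)
  show ?case using assms by (simp add: act_single word_act_smult smult_smult mult.commute)
qed (use assms in \<open>simp_all add: act_add smult_add_right\<close>)

lemma act_mult:
  assumes "c \<in> carrier V"
  shows "act (b * b') c = act b (act b' c)"
proof (induction b rule: poly_mapping_single_induct)
  case (single w k)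
  show ?case
  proof (induction b' rule: poly_mapping_single_induct)
    case (single w' k')
    show ?case
      using assms by (simp add: mult_single act_single word_act_plus word_act_smult smult_smult)
  next
    case zero
    show ?case using act_smult_right[of \<zero> "Poly_Mapping.single w k" 0] by simp
  next
    case (add x y)
    then show ?case using assms by (simp add: distrib_left act_add act_add_right)
  qed
qed (use assms in \<open>simp_all add: act_add distrib_right\<close>)

lemma act_one [simp]: "c \<in> carrier V \<Longrightarrow> act 1 c = c"
  unfolding single_one[symmetric] by (simp add: act_single del: single_one)

lemma act_scaleR: "c \<in> carrier V \<Longrightarrow> act (r *\<^sub>R b) c = complex_of_real r \<odot> act b c"
proof (induction b rule: poly_mapping_single_induct)
  case (single w k)
  then show ?case by (simp only: scaleR_single act_single smult_smult word_act_closed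
        scaleR_conv_of_real[where 'a = complex])
qed (simp_all add: act_add scaleR_add_right smult_add_right)

lemma act_diff: "c \<in> carrier V \<Longrightarrow> act (b - b') c = act b c \<ominus> act b' c"
  using act_add[of c b "- 1 *\<^sub>R b'"] act_scaleR[of c "- 1" b'] by (simp add: minus_eq_smult)

lemma adj_act:
  assumes "c \<in> carrier V" "d \<in> carrier V"
  shows "adj (act b c) \<cdot> d = adj c \<cdot> act (free_star b) d"
proof (induction b rule: poly_mapping_single_induct)
  case (single w k)
  show ?case
    using assms
    by (simp add: act_single free_star_single adj_smult mul_smult_left mul_smult_right adj_word_act)
qed (use assms in \<open>simp_all add: act_add free_star_zero free_star_add adj_add mul_add_left mul_add_right\<close>)

lemma nrm_act_bounded: "\<exists>K. \<forall>c\<in>carrier V. nrm V (act b c) \<le> K * nrm V c"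
proof (induction b rule: poly_mapping_single_induct)
  case zero
  show ?case by (intro exI[of _ 0]) simp
next
  case (single w k)
  have "\<exists>K. \<forall>c\<in>carrier V. nrm V (word_act (Word ls) c) \<le> K * nrm V c" for ls
  proof (induction ls)
    case Nil
    show ?case by (intro exI[of _ 1]) (simp add: word_act_def)
  next
    case (Cons l ls)
    then obtain K where K: "\<And>c. c \<in> carrier V \<Longrightarrow> nrm V (word_act (Word ls) c) \<le> K * nrm V c"
      by blast
    have "nrm V (word_act (Word (l # ls)) c) \<le> (nrm V (letter l) * K) * nrm V c"
      if c: "c \<in> carrier V" for c
    proof -
      have "word_act (Word (l # ls)) c = letter l \<cdot> word_act (Word ls) c"
        by (simp add: word_act_def)
      then have "nrm V (word_act (Word (l # ls)) c) \<le> nrm V (letter l) * nrm V (word_act (Word ls) c)"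
        using nrm_mul c by simp
      also have "\<dots> \<le> nrm V (letter l) * (K * nrm V c)"
        by (intro mult_left_mono K c nrm_nonneg letter_closed)
      finally show ?thesis by (simp add: mult.assoc)
    qed
    then show ?case by blast
  qed
  then obtain K where K: "\<And>c. c \<in> carrier V \<Longrightarrow> nrm V (word_act w c) \<le> K * nrm V c"
    by (cases w) blast
  have "nrm V (act (Poly_Mapping.single w k) c) \<le> (cmod k * K) * nrm V c" if "c \<in> carrier V" for c
    using mult_left_mono[OF K[OF that], of "cmod k"] that
    by (simp add: act_single nrm_smult mult.assoc)
  then show ?case by blast
next
  case (add b b')
  then obtain K K' where K: "\<And>c. c \<in> carrier V \<Longrightarrow> nrm V (act b c) \<le> K * nrm V c"
    "\<And>c. c \<in> carrier V \<Longrightarrow> nrm V (act b' c) \<le> K' * nrm V c" by blast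
  have "nrm V (act (b + b') c) \<le> (K + K') * nrm V c" if "c \<in> carrier V" for c
    using nrm_triangle[of "act b c" "act b' c"] K[OF that] that
    by (simp add: act_add distrib_right)
  then show ?case by blast
qed

definition op_nrm :: "'a free_star_algebra \<Rightarrow> real" where
  "op_nrm b = (SUP c\<in>{c \<in> carrier V. nrm V c \<le> 1}. nrm V (act b c))"

lemma op_nrm_le:
  assumes "\<And>c. c \<in> carrier V \<Longrightarrow> nrm V (act b c) \<le> K * nrm V c" "0 \<le> K"
  shows "op_nrm b \<le> K"
  unfolding op_nrm_def
proof (rule cSUP_least)
  show "{c \<in> carrier V. nrm V c \<le> 1} \<noteq> {}" using zero_closed nrm_zero by fastforce
  fix c assume "c \<in> {c \<in> carrier V. nrm V c \<le> 1}"
  then show "nrm V (act b c) \<le> K"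
    using assms(1)[of c] mult_left_mono[of "nrm V c" 1 K] assms(2) by simp
qed

lemma bdd_above_act: "bdd_above ((\<lambda>c. nrm V (act b c)) ` {c \<in> carrier V. nrm V c \<le> 1})"
proof -
  obtain K where K: "\<And>c. c \<in> carrier V \<Longrightarrow> nrm V (act b c) \<le> K * nrm V c"
    using nrm_act_bounded[of b] by blast
  have "nrm V (act b c) \<le> \<bar>K\<bar>" if "c \<in> carrier V" "nrm V c \<le> 1" for c
  proof -
    have "K * nrm V c \<le> \<bar>K\<bar> * 1"
      using that nrm_nonneg[of c] by (intro mult_mono) auto
    then show ?thesis using K[OF that(1)] by simp
  qed
  then show ?thesis by (intro bdd_aboveI2) auto
qed

lemma op_nrm_nonneg: "0 \<le> op_nrm b"
proof -
  have "nrm V (act b \<zero>) \<le> op_nrm b"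
    unfolding op_nrm_def by (rule cSUP_upper[OF _ bdd_above_act]) simp
  then show ?thesis using nrm_nonneg[of "act b \<zero>"] by simp
qed

lemma nrm_act_le:
  assumes "c \<in> carrier V"
  shows "nrm V (act b c) \<le> op_nrm b * nrm V c"
proof (cases "nrm V c = 0")
  case True
  obtain K where "\<And>c. c \<in> carrier V \<Longrightarrow> nrm V (act b c) \<le> K * nrm V c"
    using nrm_act_bounded[of b] by blast
  from this[OF assms] show ?thesis using True by simp
next
  case False
  define r where "r = nrm V c"
  have r: "r > 0" using False nrm_nonneg[OF assms] by (simp add: r_def)
  define d where "d = complex_of_real (1 / r) \<odot> c"
  have "nrm V (act b d) \<le> op_nrm b"
    unfolding op_nrm_def
    by (rule cSUP_upper[OF _ bdd_above_act]) (use assms r in \<open>simp add: d_def nrm_smult norm_divide flip: r_def\<close>)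
  moreover have "nrm V (act b d) = nrm V (act b c) / r"
    using assms r by (simp add: d_def act_smult_right nrm_smult norm_divide)
  ultimately show ?thesis using r by (simp add: field_simps flip: r_def)
qed

text \<open>On the left multiplications the C*-identity of the algebra passes to operator norms in the usual way,
  \<open>\<parallel>b c\<parallel>\<^sup>2 = \<parallel>c\<^sup>* (b\<^sup>* b) c\<parallel> \<le> \<parallel>c\<parallel>\<^sup>2 \<parallel>b\<^sup>* b\<parallel>\<close>, with the adjoint relation \<open>(b c)\<^sup>* d = c\<^sup>* (b\<^sup>* d)\<close> in the place of an inner
  product. A nonzero algebra is needed for the unit to have norm one.\<close>

lemma cstar_seminorm_op_nrm:
  assumes "carrier V \<noteq> {\<zero>}"
  shows "cstar_seminorm op_nrm free_star (Poly_Mapping.single 0 \<i>)"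
proof
  fix b b' :: "'a free_star_algebra" and r :: real
  show "op_nrm (b + b') \<le> op_nrm b + op_nrm b'"
  proof (rule op_nrm_le)
    fix c assume c: "c \<in> carrier V"
    show "nrm V (act (b + b') c) \<le> (op_nrm b + op_nrm b') * nrm V c"
      using nrm_triangle[of "act b c" "act b' c"] nrm_act_le[OF c, of b] nrm_act_le[OF c, of b'] c
      by (simp add: act_add distrib_right)
  qed (simp add: op_nrm_nonneg)
  have scale: "op_nrm (r *\<^sub>R b) \<le> \<bar>r\<bar> * op_nrm b" for r and b :: "'a free_star_algebra"
  proof (rule op_nrm_le)
    fix c assume c: "c \<in> carrier V"
    show "nrm V (act (r *\<^sub>R b) c) \<le> \<bar>r\<bar> * op_nrm b * nrm V c"
      using mult_left_mono[OF nrm_act_le[OF c, of b], of "\<bar>r\<bar>"] c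
      by (simp add: act_scaleR nrm_smult mult.assoc)
  qed (simp add: op_nrm_nonneg)
  show "op_nrm (r *\<^sub>R b) = \<bar>r\<bar> * op_nrm b"
  proof (cases "r = 0")
    case True
    then show ?thesis using scale[of 0 b] op_nrm_nonneg[of 0] by simp
  next
    case False
    have "\<bar>r\<bar> * op_nrm b \<le> op_nrm (r *\<^sub>R b)"
      using scale[of "1 / r" "r *\<^sub>R b"] False by (simp add: field_simps)
    then show ?thesis using scale[of r b] by simp
  qed
  show "op_nrm (b * b') \<le> op_nrm b * op_nrm b'"
  proof (rule op_nrm_le)
    fix c assume c: "c \<in> carrier V"
    have "nrm V (act (b * b') c) \<le> op_nrm b * nrm V (act b' c)"
      using c by (simp add: act_mult nrm_act_le)
    also have "\<dots> \<le> op_nrm b * (op_nrm b' * nrm V c)"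
      by (intro mult_left_mono nrm_act_le op_nrm_nonneg c)
    finally show "nrm V (act (b * b') c) \<le> op_nrm b * op_nrm b' * nrm V c"
      by (simp add: mult.assoc)
  qed (simp add: op_nrm_nonneg)
  show "op_nrm 1 = 1"
  proof (rule antisym)
    show "op_nrm 1 \<le> 1" by (rule op_nrm_le) simp_all
    obtain c where c: "c \<in> carrier V" "c \<noteq> \<zero>" using assms zero_closed by blast
    then have "nrm V c > 0" using nrm_nonneg[of c] nrm_eq_zero[of c] by simp
    then show "1 \<le> op_nrm 1" using nrm_act_le[OF c(1), of 1] c by simp
  qed
  show "(op_nrm b)\<^sup>2 \<le> op_nrm (free_star b * b)"
  proof -
    let ?K = "op_nrm (free_star b * b)"
    have "op_nrm b \<le> sqrt ?K"
    proof (rule op_nrm_le)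
      fix c assume c: "c \<in> carrier V"
      have "(nrm V (act b c))\<^sup>2 = nrm V (adj c \<cdot> act (free_star b * b) c)"
        using c by (simp add: act_mult flip: nrm_adj_mul adj_act)
      also have "\<dots> \<le> nrm V c * nrm V (act (free_star b * b) c)"
        using nrm_mul[of "adj c" "act (free_star b * b) c"] c by (simp add: nrm_adj)
      also have "\<dots> \<le> nrm V c * (?K * nrm V c)"
        by (intro mult_left_mono nrm_act_le nrm_nonneg c)
      also have "\<dots> = (sqrt ?K * nrm V c)\<^sup>2"
        by (simp add: power_mult_distrib op_nrm_nonneg power2_eq_square)
      finally show "nrm V (act b c) \<le> sqrt ?K * nrm V c"
        by (rule power2_le_imp_le) (simp add: op_nrm_nonneg nrm_nonneg c)
    qed (simp add: op_nrm_nonneg)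
    then have "(op_nrm b)\<^sup>2 \<le> (sqrt ?K)\<^sup>2" by (intro power_mono op_nrm_nonneg)
    then show ?thesis by (simp add: op_nrm_nonneg)
  qed
  show "Poly_Mapping.single 0 \<i> * b = b * Poly_Mapping.single 0 \<i>"
    by (rule single_zero_central)
  show "Poly_Mapping.single 0 \<i> * Poly_Mapping.single 0 \<i> = (- 1 :: 'a free_star_algebra)"
    by (simp add: mult_single single_uminus)
  show "free_star (Poly_Mapping.single 0 \<i>) = - Poly_Mapping.single 0 \<i>"
    by (simp add: free_star_single word_star_zero single_uminus)
qed (simp_all add: free_star_add free_star_scaleR free_star_mult free_star_free_star)

text \<open>The functional on the free algebra takes equal values on elements with equal action, since their
  difference has seminorm zero. Restricted to generators it is therefore additive on the C*-algebra, although
  the embedding of generators is not. Requiring positivity at an element \<open>u\<^sup>2\<close> of the algebra itself excludes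
  functionals such as a character at infinity, which sees only the adjoined unit.\<close>

theorem positive_functional:
  assumes "carrier V \<noteq> {\<zero>}"
  obtains \<tau> u where "\<And>a b. a \<in> carrier V \<Longrightarrow> b \<in> carrier V \<Longrightarrow> \<tau> (a \<oplus> b) = \<tau> a + \<tau> b"
    and "\<And>a. a \<in> carrier V \<Longrightarrow> \<bar>\<tau> a\<bar> \<le> nrm V a"
    and "\<And>a. a \<in> carrier V \<Longrightarrow> \<tau> (adj a) = \<tau> a"
    and "\<And>a. a \<in> carrier V \<Longrightarrow> 0 \<le> \<tau> (adj a \<cdot> a)"
    and "u \<in> carrier V" "adj u = u" "0 < \<tau> (u \<cdot> u)"
proof -
  interpret B: cstar_seminorm op_nrm free_star "Poly_Mapping.single 0 \<i>"
    by (rule cstar_seminorm_op_nrm[OF assms])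
  define gen :: "'a \<Rightarrow> 'a free_star_algebra" where
    "gen a = Poly_Mapping.single (Word [(a, False)]) 1" for a
  have act_gen: "act (gen a) c = a \<cdot> c" if "a \<in> carrier V" "c \<in> carrier V" for a c
    using that by (simp add: gen_def act_single word_act_def letter_def)
  have act_gen_star: "act (free_star (gen a)) c = adj a \<cdot> c"
    if "a \<in> carrier V" "c \<in> carrier V" for a c
    using that by (simp add: gen_def free_star_single word_star_def act_single word_act_def letter_def)
  obtain e where e: "e \<in> carrier V" "e \<noteq> \<zero>" using assms zero_closed by blast
  define u where "u = adj e \<cdot> e"
  have u: "u \<in> carrier V" "adj u = u" using e by (simp_all add: u_def adj_mul adj_adj)
  have "nrm V e > 0" using e nrm_nonneg[of e] nrm_eq_zero[of e] by simp
  then have nrm_u: "nrm V u > 0" using e by (simp add: u_def nrm_adj_mul)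
  \<comment> \<open>The generator of \<open>u\<close> is not self-adjoint in the free algebra, but this average is, with the same action.\<close>
  define U where "U = (1 / 2) *\<^sub>R (gen u + free_star (gen u))"
  have stU: "free_star U = U"
    by (simp add: U_def B.st_simps add.commute)
  have act_U: "act U c = u \<cdot> c" if "c \<in> carrier V" for c
  proof -
    have "act U c = complex_of_real (1 / 2) \<odot> (u \<cdot> c \<oplus> u \<cdot> c)"
      using that u by (simp only: U_def act_scaleR act_add act_gen act_gen_star)
    also have "u \<cdot> c \<oplus> u \<cdot> c = 2 \<odot> (u \<cdot> c)"
      using that u smult_add_left[of "u \<cdot> c" 1 1] by simp
    finally show ?thesis using that u by (simp add: smult_smult)
  qed
  obtain w where w: "\<And>x y. w (x + y) = w x + w y" "\<And>x. \<bar>w x\<bar> \<le> op_nrm x"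
    "\<And>x. w (free_star x) = w x" "\<And>x. 0 \<le> w (free_star x * x)" "(op_nrm U)\<^sup>2 \<le> w (U * U)"
    using B.positive_functional_exists[OF stU] by blast
  have cong: "w b = w b'" if "\<And>c. c \<in> carrier V \<Longrightarrow> act b c = act b' c" for b b'
  proof -
    have "op_nrm (b - b') \<le> 0"
      by (rule op_nrm_le) (use that in \<open>simp_all add: act_diff a_minus_def r_neg\<close>)
    then have "w (b - b') = 0" using w(2)[of "b - b'"] by simp
    then show ?thesis using w(1)[of "b - b'" b'] by simp
  qed
  show thesis
  proof (rule that[of "\<lambda>a. w (gen a)" u])
    fix a b assume a: "a \<in> carrier V" and b: "b \<in> carrier V"
    have "w (gen (a \<oplus> b)) = w (gen a + gen b)"
      by (rule cong) (use a b in \<open>simp add: act_gen act_add mul_add_left\<close>)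
    then show "w (gen (a \<oplus> b)) = w (gen a) + w (gen b)" by (simp add: w(1))
  next
    fix a assume a: "a \<in> carrier V"
    have "op_nrm (gen a) \<le> nrm V a"
      by (rule op_nrm_le) (use a in \<open>simp_all add: act_gen nrm_mul nrm_nonneg\<close>)
    then show "\<bar>w (gen a)\<bar> \<le> nrm V a" using w(2)[of "gen a"] by simp
    have "w (gen (adj a)) = w (free_star (gen a))"
      by (rule cong) (use a in \<open>simp add: act_gen act_gen_star\<close>)
    then show "w (gen (adj a)) = w (gen a)" by (simp add: w(3))
    have "w (gen (adj a \<cdot> a)) = w (free_star (gen a) * gen a)"
      by (rule cong) (use a in \<open>simp add: act_gen act_gen_star act_mult mul_assoc\<close>)
    then show "0 \<le> w (gen (adj a \<cdot> a))" using w(4)[of "gen a"] by simp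
  next
    have "w (gen (u \<cdot> u)) = w (U * U)"
      by (rule cong) (use u in \<open>simp add: act_gen act_U act_mult mul_assoc\<close>)
    moreover have "(nrm V u)\<^sup>2 \<le> op_nrm U * nrm V u"
      using nrm_act_le[OF u(1), of U] act_U[OF u(1)] nrm_adj_mul[OF u(1)] u(2) by simp
    then have "op_nrm U > 0" using nrm_u by (simp add: power2_eq_square)
    then have "(op_nrm U)\<^sup>2 > 0" by simp
    ultimately show "0 < w (gen (u \<cdot> u))" using w(5) by linarith
  qed (use u in simp_all)
qed

end

lemma (in fell_bundle) cstar_algebra_unit_fiber:
  "cstar_algebra (fiber A \<one>) (bmult A \<one> \<one>) (bstar A \<one>)"
proof (intro cstar_algebra.intro cstar_algebra_axioms.intro)
  show "cbanach_space (fiber A \<one>)" by (rule fiber_banach) simp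
qed (insert bmult_closed[of \<one> \<one>] bmult_add_left[of \<one> \<one>] bmult_add_right[of \<one> \<one>]
    bmult_smult_left[of \<one> \<one>] bmult_smult_right[of \<one> \<one>] bmult_assoc[of \<one> \<one> \<one>]
    bstar_closed[of \<one>] bstar_add[of \<one>] bstar_smult[of \<one>] bstar_bmult[of \<one> \<one>]
    bstar_bstar[of \<one>] nrm_bstar[of \<one>] nrm_bmult[of \<one> \<one>] cstar_identity[of \<one>], simp_all)

section \<open>Amenability and Reiter's condition\<close>

text \<open>Reiter's condition for the left translation action of \<open>H\<close> on \<open>G\<close>. The sum runs over a set \<open>S\<close> carrying \<open>\<phi>\<close>,
  as the sums in property (EP) do, not over all of \<open>G\<close>. This costs at most a factor of two in \<open>\<epsilon>\<close>: the mass that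
  translation moves out of \<open>S\<close> equals the deficit inside \<open>S\<close>.\<close>

definition reiter :: "('g, 'm) monoid_scheme \<Rightarrow> 'g set \<Rightarrow> bool" where
  "reiter G H \<longleftrightarrow>
     (\<forall>F \<epsilon>. finite F \<and> F \<subseteq> H \<and> (0::real) < \<epsilon> \<longrightarrow>
        (\<exists>\<phi> S. finite S \<and> S \<subseteq> carrier G \<and> (\<forall>s. 0 \<le> \<phi> s) \<and> (\<forall>s. s \<notin> S \<longrightarrow> \<phi> s = 0) \<and>
           sum \<phi> S = 1 \<and> (\<forall>t\<in>F. (\<Sum>s\<in>S. \<bar>\<phi> (t \<otimes>\<^bsub>G\<^esub> s) - \<phi> s\<bar>) < \<epsilon>)))"

text \<open>After the substitution \<open>s \<mapsto> t s\<close> in the second sum both sums have the same values of \<open>g\<close>, and the weights differ by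
  at most \<open>\<epsilon>\<close> on \<open>S\<close> and by at most \<open>\<epsilon>\<close> outside.\<close>

lemma (in group) sum_left_shift_le:
  fixes \<phi> g :: "'a \<Rightarrow> real"
  assumes t: "t \<in> carrier G" and S: "finite S" "S \<subseteq> carrier G"
    and \<phi>: "\<And>s. 0 \<le> \<phi> s" "\<And>s. s \<notin> S \<Longrightarrow> \<phi> s = 0" "sum \<phi> S = 1"
    and \<epsilon>: "(\<Sum>s\<in>S. \<bar>\<phi> (t \<otimes> s) - \<phi> s\<bar>) < \<epsilon>"
    and g: "\<And>s. s \<in> carrier G \<Longrightarrow> \<bar>g s\<bar> \<le> K"
  shows "\<bar>(\<Sum>s\<in>S. \<phi> s * g (t \<otimes> s)) - (\<Sum>s\<in>S. \<phi> s * g s)\<bar> \<le> 2 * K * \<epsilon>"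
proof -
  define S' where "S' = (\<lambda>s. inv t \<otimes> s) ` S"
  have S': "finite S'" "S' \<subseteq> carrier G" using S t by (auto simp: S'_def)
  have inj: "inj_on (\<lambda>s. t \<otimes> s) S'" 
    using S'(2) t by (intro inj_onI) (metis Units_eq Units_l_cancel subsetD)
  have img: "(\<lambda>s. t \<otimes> s) ` S' = S"
  proof -
    have "t \<otimes> (inv t \<otimes> s) = s" if "s \<in> S" for s
      using that S(2) t by (auto simp: m_assoc[symmetric])
    then show ?thesis unfolding S'_def image_image by force
  qed
  have shift: "(\<Sum>s\<in>S'. f (t \<otimes> s)) = (\<Sum>s\<in>S. f s)" for f :: "'a \<Rightarrow> real"
    using sum.reindex[OF inj, of f] img by (simp add: comp_def)
  have notin: "\<phi> (t \<otimes> s) = 0" if "s \<in> S - S'" for s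
  proof (rule \<phi>(2))
    show "t \<otimes> s \<notin> S"
    proof
      assume "t \<otimes> s \<in> S"
      then have "inv t \<otimes> (t \<otimes> s) \<in> S'" by (simp add: S'_def)
      then show False using that S(2) t by (auto simp: m_assoc[symmetric])
    qed
  qed
  let ?U = "S \<union> S'"
  have U: "finite ?U" using S S' by simp
  have "K \<ge> 0" using g[OF t] by simp
  have one: "(\<Sum>s\<in>?U. f (t \<otimes> s)) = (\<Sum>s\<in>S. f s)" if "\<And>s. \<phi> s = 0 \<Longrightarrow> f s = 0" for f :: "'a \<Rightarrow> real"
    unfolding shift[symmetric, of f]
    by (rule sum.mono_neutral_right[OF U]) (use notin that in auto)
  have two: "(\<Sum>s\<in>?U. f s) = (\<Sum>s\<in>S. f s)" if "\<And>s. \<phi> s = 0 \<Longrightarrow> f s = 0" for f :: "'a \<Rightarrow> real"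
    by (rule sum.mono_neutral_right[OF U]) (use \<phi>(2) that in auto)
  have outside: "(\<Sum>s\<in>?U - S. \<bar>\<phi> (t \<otimes> s) - \<phi> s\<bar>) \<le> \<epsilon>"
  proof -
    have "(\<Sum>s\<in>?U - S. \<bar>\<phi> (t \<otimes> s) - \<phi> s\<bar>) = (\<Sum>s\<in>?U - S. \<phi> (t \<otimes> s))"
      by (rule sum.cong) (use \<phi> in auto)
    also have "\<dots> = (\<Sum>s\<in>?U. \<phi> (t \<otimes> s)) - (\<Sum>s\<in>S. \<phi> (t \<otimes> s))"
      by (rule sum_diff) (use U in auto)
    also have "\<dots> = (\<Sum>s\<in>S. \<phi> s - \<phi> (t \<otimes> s))"
      using one[of \<phi>] by (simp add: sum_subtractf)
    also have "\<dots> \<le> (\<Sum>s\<in>S. \<bar>\<phi> (t \<otimes> s) - \<phi> s\<bar>)" by (rule sum_mono) auto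
    finally show ?thesis using \<epsilon> by simp
  qed
  have total: "(\<Sum>s\<in>?U. \<bar>\<phi> (t \<otimes> s) - \<phi> s\<bar>) \<le> 2 * \<epsilon>"
    using sum.subset_diff[of S ?U "\<lambda>s. \<bar>\<phi> (t \<otimes> s) - \<phi> s\<bar>"] U outside \<epsilon> by simp
  have "(\<Sum>s\<in>S. \<phi> s * g (t \<otimes> s)) - (\<Sum>s\<in>S. \<phi> s * g s)
      = (\<Sum>s\<in>?U. \<phi> s * g (t \<otimes> s)) - (\<Sum>s\<in>?U. \<phi> (t \<otimes> s) * g (t \<otimes> s))"
    using one[of "\<lambda>s. \<phi> s * g s"] two[of "\<lambda>s. \<phi> s * g (t \<otimes> s)"] by simp
  also have "\<bar>\<dots>\<bar> = \<bar>\<Sum>s\<in>?U. (\<phi> s - \<phi> (t \<otimes> s)) * g (t \<otimes> s)\<bar>"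
    by (simp add: sum_subtractf left_diff_distrib)
  also have "\<dots> \<le> (\<Sum>s\<in>?U. \<bar>\<phi> (t \<otimes> s) - \<phi> s\<bar> * K)"
  proof (rule order_trans[OF sum_abs sum_mono])
    fix s assume "s \<in> ?U"
    then have "t \<otimes> s \<in> carrier G" using S S' t by auto
    then show "\<bar>(\<phi> s - \<phi> (t \<otimes> s)) * g (t \<otimes> s)\<bar> \<le> \<bar>\<phi> (t \<otimes> s) - \<phi> s\<bar> * K"
      by (simp add: abs_mult abs_minus_commute mult_left_mono g)
  qed
  also have "\<dots> \<le> 2 * \<epsilon> * K"
    unfolding sum_distrib_right[symmetric] using total \<open>K \<ge> 0\<close> by (rule mult_right_mono)
  finally show ?thesis by (simp add: mult_ac)
qed

text \<open>The difference from the linear function \<open>x f(1)\<close> is additive and vanishes at the integers, so it is periodic and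
  bounded; a bounded additive function is zero.\<close>

lemma additive_bounded_imp_real_linear:
  fixes f :: "real \<Rightarrow> real"
  assumes add: "\<And>x y. f (x + y) = f x + f y" and bound: "\<And>x. \<bar>f x\<bar> \<le> C * \<bar>x\<bar>"
  shows "f x = x * f 1"
proof -
  define d where "d x = f x - x * f 1" for x
  have d_add: "d (x + y) = d x + d y" for x y by (simp add: d_def add algebra_simps)
  have d0: "d 0 = 0" using d_add[of 0 0] by simp
  have d1: "d 1 = 0" by (simp add: d_def)
  have d_minus: "d (- x) = - d x" for x using d_add[of x "- x"] d0 by simp
  have d_nat: "d (real n * x) = real n * d x" for n x
    by (induction n) (simp_all add: d0 d_add distrib_right)
  have d_int: "d (of_int k) = 0" for k
  proof (cases k)
    case (nonneg n)
    then show ?thesis using d_nat[of n 1] d1 by simp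
  next
    case (neg n)
    then show ?thesis using d_nat[of "Suc n" 1] d1 d_minus[of "real (Suc n)"] by simp
  qed
  define C' where "C' = \<bar>C\<bar> + \<bar>f 1\<bar>"
  have bounded: "\<bar>d x\<bar> \<le> C'" for x
  proof -
    have "d x = d (frac x)" using d_add[of "frac x" "of_int \<lfloor>x\<rfloor>"] d_int by (simp add: frac_def)
    moreover have "\<bar>d (frac x)\<bar> \<le> \<bar>f (frac x)\<bar> + \<bar>frac x * f 1\<bar>" by (simp add: d_def)
    moreover have "\<bar>f (frac x)\<bar> \<le> \<bar>C\<bar> * 1"
    proof (rule order_trans[OF bound mult_mono])
      show "\<bar>frac x\<bar> \<le> 1" using frac_lt_1[of x] by simp
    qed auto
    moreover have "\<bar>frac x * f 1\<bar> \<le> 1 * \<bar>f 1\<bar>"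
      unfolding abs_mult using frac_lt_1[of x] by (intro mult_right_mono) auto
    ultimately show ?thesis by (simp add: C'_def)
  qed
  have "d x = 0"
  proof (rule ccontr)
    assume "d x \<noteq> 0"
    then obtain n where "C' < real n * \<bar>d x\<bar>"
      using reals_Archimedean3[of "\<bar>d x\<bar>"] by auto
    then show False using bounded[of "real n * x"] by (simp add: d_nat abs_mult)
  qed
  then show ?thesis by (simp add: d_def)
qed

text \<open>The mean is a Hahn--Banach limit of the averages \<open>h \<mapsto> \<Sum>\<^sub>s \<phi>(s) h(\<theta>(s))\<close>, where \<open>\<theta> : G \<rightarrow> H\<close> is an equivariant map
  obtained from representatives of the right cosets of \<open>H\<close>. It transports functions on the subgroup to \<open>G\<close>, on
  which the vectors \<open>\<phi>\<close> live. The sublinear functional is the upper limit of the averages as \<open>\<phi>\<close> becomes invariant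
  under more elements with smaller error.\<close>

lemma (in group) amenable_if_reiter:
  assumes H: "subgroup H G" and reiter: "reiter G H"
  shows "amenable (G\<lparr>carrier := H\<rparr>)"
proof -
  let ?H = "G\<lparr>carrier := H\<rparr>"
  have HG: "H \<subseteq> carrier G" by (rule subgroup.subset[OF H])
  define r where "r s = (SOME x. x \<in> H #> s)" for s
  define \<theta> where "\<theta> s = s \<otimes> inv (r s)" for s
  have r: "r s \<in> H #> s" if "s \<in> carrier G" for s
    unfolding r_def by (rule someI[of _ s]) (rule rcos_self[OF that H])
  have r_closed: "r s \<in> carrier G" if "s \<in> carrier G" for s
    using r[OF that] r_coset_subset_G[OF HG that] by blast
  have \<theta>_in: "\<theta> s \<in> H" if s: "s \<in> carrier G" for s
  proof -
    obtain h where h: "h \<in> H" "r s = h \<otimes> s" using r[OF s] by (auto simp: r_coset_def)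
    then have "\<theta> s = inv h"
      using s HG by (auto simp: \<theta>_def inv_mult_group m_assoc[symmetric])
    then show ?thesis using subgroup.m_inv_closed[OF H h(1)] by simp
  qed
  have \<theta>_equiv: "\<theta> (t \<otimes> s) = t \<otimes> \<theta> s" if "t \<in> H" "s \<in> carrier G" for t s
  proof -
    have "H #> (t \<otimes> s) = H #> s"
      using coset_mult_assoc[of H t s] coset_join2[of t H] that HG H by auto
    then have "r (t \<otimes> s) = r s" by (simp add: r_def)
    then show ?thesis using that HG r_closed by (auto simp: \<theta>_def m_assoc)
  qed
  define Q where "Q F \<epsilon> x \<longleftrightarrow> finite (snd x) \<and> snd x \<subseteq> carrier G \<and> (\<forall>s. 0 \<le> fst x s) \<and>
      (\<forall>s. s \<notin> snd x \<longrightarrow> fst x s = 0) \<and> sum (fst x) (snd x) = 1 \<and>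
      (\<forall>t\<in>F. (\<Sum>s\<in>snd x. \<bar>fst x (t \<otimes> s) - fst x s\<bar>) < \<epsilon>)"
    for F and \<epsilon> :: real and x :: "('a \<Rightarrow> real) \<times> 'a set"
  define I where "I = {(F, \<epsilon>). finite F \<and> F \<subseteq> H \<and> (0::real) < \<epsilon>}"
  have Q_ex: "\<exists>x. Q F \<epsilon> x" if "(F, \<epsilon>) \<in> I" for F \<epsilon>
    using reiter that unfolding reiter_def I_def Q_def by fastforce
  have Q_mono: "Q F \<epsilon> x" if "Q F' \<epsilon>' x" "F \<subseteq> F'" "\<epsilon>' \<le> \<epsilon>" for F F' \<epsilon> \<epsilon>' x
    using that unfolding Q_def by force
  define M where "M x h = (\<Sum>s\<in>snd x. fst x s * h (\<theta> s))" for x and h :: "'a \<Rightarrow> real"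
  define B where "B = {h. bounded_on_group ?H h}"
  have B_iff: "h \<in> B \<longleftrightarrow> (\<exists>K. \<forall>s\<in>H. \<bar>h s\<bar> \<le> K)" for h
    by (simp add: B_def bounded_on_group_def)
  \<comment> \<open>\<open>E h\<close> consists of the eventual upper bounds of the averages of \<open>h\<close>, so its infimum is their upper limit.\<close>
  define E where "E h = {c. \<exists>F \<epsilon>. (F, \<epsilon>) \<in> I \<and> (\<forall>x. Q F \<epsilon> x \<longrightarrow> M x h \<le> c)}" for h
  define p where "p h = Inf (E h)" for h
  have I0: "({}, 1) \<in> I" by (simp add: I_def)
  have M_le: "M x h \<le> c" if "Q F \<epsilon> x" "\<And>s. s \<in> H \<Longrightarrow> h s \<le> c" for F \<epsilon> x h c
  proof -
    have "M x h \<le> (\<Sum>s\<in>snd x. fst x s * c)"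
      unfolding M_def
      by (intro sum_mono mult_left_mono that(2) \<theta>_in) (use that(1) in \<open>auto simp: Q_def\<close>)
    also have "\<dots> = c" using that(1) by (simp add: Q_def flip: sum_distrib_right)
    finally show ?thesis .
  qed
  have M_add: "M x (h + k) = M x h + M x k" for x h k
    by (simp add: M_def sum.distrib algebra_simps)
  have M_scale: "M x (\<lambda>s. c * h s) = c * M x h" for x h and c :: real
    by (simp add: M_def sum_distrib_left algebra_simps)
  have E_upper: "c \<in> E h" if "\<And>s. s \<in> H \<Longrightarrow> h s \<le> c" for h c
    unfolding E_def using I0 M_le that by blast
  have E_lower: "- K \<le> c" if c: "c \<in> E h" and K: "\<And>s. s \<in> H \<Longrightarrow> \<bar>h s\<bar> \<le> K" for h c K
  proof -
    obtain F \<epsilon> where F: "(F, \<epsilon>) \<in> I" "\<And>x. Q F \<epsilon> x \<Longrightarrow> M x h \<le> c"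
      using c by (auto simp: E_def)
    obtain x where x: "Q F \<epsilon> x" using Q_ex[OF F(1)] by blast
    have "M x (\<lambda>s. - 1 * h s) \<le> K" by (rule M_le[OF x]) (use K in force)
    then show ?thesis using F(2)[OF x] M_scale[of x "- 1" h] by simp
  qed
  have E_ne: "E h \<noteq> {}" and E_bdd: "bdd_below (E h)" if h: "h \<in> B" for h
  proof -
    obtain K where K: "\<And>s. s \<in> H \<Longrightarrow> \<bar>h s\<bar> \<le> K" using h by (auto simp: B_iff)
    have "K \<in> E h" by (rule E_upper) (use K in force)
    then show "E h \<noteq> {}" by blast
    show "bdd_below (E h)" using E_lower K by (intro bdd_belowI) blast
  qed
  have p_le: "p h \<le> c" if "h \<in> B" "c \<in> E h" for h c
    unfolding p_def by (rule cInf_lower[OF that(2) E_bdd[OF that(1)]])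
  have B_sub: "add_subgroup B"
    unfolding add_subgroup_def
  proof (intro conjI ballI)
    show "0 \<in> B" by (auto simp: B_iff)
    fix h k assume "h \<in> B" "k \<in> B"
    then obtain K L where "\<And>s. s \<in> H \<Longrightarrow> \<bar>h s\<bar> \<le> K" "\<And>s. s \<in> H \<Longrightarrow> \<bar>k s\<bar> \<le> L"
      by (auto simp: B_iff)
    then have "\<bar>(h + k) s\<bar> \<le> K + L" if "s \<in> H" for s
      using that by (simp add: abs_triangle_ineq[THEN order_trans] add_mono)
    then show "h + k \<in> B" by (auto simp: B_iff)
  qed (simp add: B_iff)
  have scale_B: "(\<lambda>s. c * h s) \<in> B" if h: "h \<in> B" for c h
  proof -
    obtain K where "\<And>s. s \<in> H \<Longrightarrow> \<bar>h s\<bar> \<le> K" using h by (auto simp: B_iff)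
    then have "\<bar>c * h s\<bar> \<le> \<bar>c\<bar> * K" if "s \<in> H" for s
      using that by (simp add: abs_mult mult_left_mono)
    then show ?thesis unfolding B_iff by blast
  qed
  have of_nat_fun: "of_nat n * h = (\<lambda>s. real n * h s)" for n and h :: "'a \<Rightarrow> real"
    by (induction n) (simp_all add: fun_eq_iff algebra_simps)
  have p_scale_le: "p (\<lambda>s. c * h s) \<le> c * p h" if c: "c > 0" and h: "h \<in> B" for c h
  proof -
    have "p (\<lambda>s. c * h s) / c \<le> p h"
      unfolding p_def[of h]
    proof (rule cInf_greatest[OF E_ne[OF h]])
      fix d assume "d \<in> E h"
      then have "c * d \<in> E (\<lambda>s. c * h s)"
        using c by (force simp: E_def M_scale)
      then show "p (\<lambda>s. c * h s) / c \<le> d"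
        using p_le[OF scale_B[OF h]] c by (simp add: field_simps)
    qed
    then show ?thesis using c by (simp add: field_simps)
  qed
  have p_scale: "p (\<lambda>s. c * h s) = c * p h" if c: "c > 0" and h: "h \<in> B" for c h
  proof -
    have "p (\<lambda>s. (1 / c) * (c * h s)) \<le> (1 / c) * p (\<lambda>s. c * h s)"
      by (rule p_scale_le) (use c scale_B[OF h] in auto)
    then have "c * p h \<le> p (\<lambda>s. c * h s)" using c by (simp add: field_simps)
    then show ?thesis using p_scale_le[OF c h] by simp
  qed
  have p_zero: "p 0 = 0"
  proof (rule antisym)
    have "0 \<in> B" using B_sub by (simp add: add_subgroup_def)
    show "p 0 \<le> 0" by (rule p_le[OF \<open>0 \<in> B\<close> E_upper]) simp
    have "- 0 \<le> c" if "c \<in> E 0" for c by (rule E_lower[OF that]) simp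
    then show "0 \<le> p 0" unfolding p_def using E_ne[OF \<open>0 \<in> B\<close>] by (intro cInf_greatest) auto
  qed
  have p_sub: "sublinear_on B p"
    unfolding sublinear_on_def
  proof (intro conjI ballI allI)
    fix h k assume hk: "h \<in> B" "k \<in> B"
    then have "h + k \<in> B" using B_sub by (simp add: add_subgroup_def)
    have *: "c + d \<in> E (h + k)" if "c \<in> E h" "d \<in> E k" for c d
    proof -
      obtain F \<epsilon> where F: "(F, \<epsilon>) \<in> I" "\<And>x. Q F \<epsilon> x \<Longrightarrow> M x h \<le> c"
        using \<open>c \<in> E h\<close> by (auto simp: E_def)
      obtain F' \<epsilon>' where F': "(F', \<epsilon>') \<in> I" "\<And>x. Q F' \<epsilon>' x \<Longrightarrow> M x k \<le> d"
        using \<open>d \<in> E k\<close> by (auto simp: E_def)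
      have "(F \<union> F', min \<epsilon> \<epsilon>') \<in> I" using F(1) F'(1) by (auto simp: I_def)
      moreover have "M x (h + k) \<le> c + d" if x: "Q (F \<union> F') (min \<epsilon> \<epsilon>') x" for x
      proof -
        have "Q F \<epsilon> x" "Q F' \<epsilon>' x" by (rule Q_mono[OF x]; simp)+
        then show ?thesis using F(2) F'(2) by (simp add: M_add add_mono)
      qed
      ultimately show ?thesis unfolding E_def by blast
    qed
    show "p (h + k) \<le> p h + p k"
      unfolding p_def[of h] p_def[of k]
      by (rule le_cInf_add[OF E_ne[OF hk(1)] E_ne[OF hk(2)] p_le[OF \<open>h + k \<in> B\<close> *]])
  next
    fix n h assume "h \<in> B"
    show "p (of_nat n * h) = real n * p h"
    proof (cases "n = 0")
      case True
      then show ?thesis using p_zero by simp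
    next
      case False
      then show ?thesis using p_scale[of "real n" h] \<open>h \<in> B\<close> by (simp add: of_nat_fun)
    qed
  qed
  have "0 \<in> B" using B_sub by (simp add: add_subgroup_def)
  from this obtain w where w_add: "\<And>h k. h \<in> B \<Longrightarrow> k \<in> B \<Longrightarrow> w (h + k) = w h + w k"
    and w_le: "\<And>h. h \<in> B \<Longrightarrow> w h \<le> p h"
    by (rule hahn_banach_additive[OF B_sub p_sub]) blast
  have "w 0 = 0" using w_add[OF \<open>0 \<in> B\<close> \<open>0 \<in> B\<close>] by simp
  have neg_B: "- h \<in> B" if "h \<in> B" for h using B_sub that by (simp add: add_subgroup_def)
  have w_neg: "w (- h) = - w h" if "h \<in> B" for h
    using w_add[OF that neg_B[OF that]] \<open>w 0 = 0\<close> by simp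
  have w_upper: "w h \<le> c" if "h \<in> B" "\<And>s. s \<in> H \<Longrightarrow> h s \<le> c" for h c
    using w_le[OF that(1)] p_le[OF that(1) E_upper[OF that(2)]] by force
  have w_lower: "c \<le> w h" if "h \<in> B" "\<And>s. s \<in> H \<Longrightarrow> c \<le> h s" for h c
    using w_upper[OF neg_B[OF that(1)], of "- c"] w_neg[OF that(1)] that(2) by simp
  have "left_invariant_mean ?H w"
    unfolding left_invariant_mean_def
  proof (intro conjI allI impI ballI)
    fix h k assume "bounded_on_group ?H h" "bounded_on_group ?H k"
    then show "w (\<lambda>s. h s + k s) = w h + w k"
      using w_add[of h k] by (simp add: B_def plus_fun_def)
  next
    fix c h assume "bounded_on_group ?H h"
    then have h: "h \<in> B" by (simp add: B_def)
    obtain K where K: "\<And>s. s \<in> H \<Longrightarrow> \<bar>h s\<bar> \<le> K" using h by (auto simp: B_iff)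
    have bound: "\<bar>w (\<lambda>s. x * h s)\<bar> \<le> K * \<bar>x\<bar>" for x
    proof -
      have le: "\<bar>x * h s\<bar> \<le> K * \<bar>x\<bar>" if "s \<in> H" for s
        using mult_right_mono[OF K[OF that], of "\<bar>x\<bar>"] by (simp add: abs_mult mult.commute)
      have "w (\<lambda>s. x * h s) \<le> K * \<bar>x\<bar>"
        by (rule w_upper[OF scale_B[OF h]]) (rule abs_le_D1[OF le])
      moreover have "- (K * \<bar>x\<bar>) \<le> w (\<lambda>s. x * h s)"
      proof (rule w_lower[OF scale_B[OF h]])
        fix s assume "s \<in> H"
        then show "- (K * \<bar>x\<bar>) \<le> x * h s" using abs_le_D2[OF le, of s] by linarith
      qed
      ultimately show ?thesis by linarith
    qed
    have "w (\<lambda>s. c * h s) = c * w (\<lambda>s. 1 * h s)"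
    proof (rule additive_bounded_imp_real_linear[where C = K])
      fix x y
      have "(\<lambda>s. (x + y) * h s) = (\<lambda>s. x * h s) + (\<lambda>s. y * h s)"
        by (simp add: fun_eq_iff distrib_right)
      then show "w (\<lambda>s. (x + y) * h s) = w (\<lambda>s. x * h s) + w (\<lambda>s. y * h s)"
        using w_add[OF scale_B[OF h, of x] scale_B[OF h, of y]] by (simp only:)
    qed (rule bound)
    then show "w (\<lambda>s. c * h s) = c * w h" by simp
  next
    fix h assume "bounded_on_group ?H h" "\<forall>s\<in>carrier ?H. 0 \<le> h s"
    then show "0 \<le> w h" by (intro w_lower) (auto simp: B_def)
  next
    have "(\<lambda>s. 1) \<in> B" by (auto simp: B_iff)
    then show "w (\<lambda>s. 1) = 1" by (intro antisym w_upper w_lower) simp_all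
  next
    fix h t assume t: "t \<in> carrier ?H" and "bounded_on_group ?H h"
    then have h: "h \<in> B" and tH: "t \<in> H" by (simp_all add: B_def)
    obtain K where K: "\<And>s. s \<in> H \<Longrightarrow> \<bar>h s\<bar> \<le> K" using h by (auto simp: B_iff)
    define ht where "ht s = h (t \<otimes> s)" for s
    have "\<bar>ht s\<bar> \<le> K" if "s \<in> H" for s
      using K subgroup.m_closed[OF H tH that] by (simp add: ht_def)
    then have ht: "ht \<in> B" unfolding B_iff by blast
    have tG: "t \<in> carrier G" using tH HG by blast
    have M_shift: "\<bar>M x ht - M x h\<bar> \<le> 2 * K * \<epsilon>" if x: "Q {t} \<epsilon> x" for x \<epsilon>
    proof -
      have S: "finite (snd x)" "snd x \<subseteq> carrier G" and \<phi>: "\<And>s. 0 \<le> fst x s"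
        "\<And>s. s \<notin> snd x \<Longrightarrow> fst x s = 0" "sum (fst x) (snd x) = 1"
        and \<epsilon>: "(\<Sum>s\<in>snd x. \<bar>fst x (t \<otimes> s) - fst x s\<bar>) < \<epsilon>"
        using x by (simp_all add: Q_def)
      have "M x ht = (\<Sum>s\<in>snd x. fst x s * h (\<theta> (t \<otimes> s)))"
        unfolding M_def ht_def
      proof (rule sum.cong[OF refl])
        fix s assume "s \<in> snd x"
        then have "\<theta> (t \<otimes> s) = t \<otimes> \<theta> s" using \<theta>_equiv[OF tH] S(2) by blast
        then show "fst x s * h (t \<otimes> \<theta> s) = fst x s * h (\<theta> (t \<otimes> s))" by simp
      qed
      moreover have "M x h = (\<Sum>s\<in>snd x. fst x s * h (\<theta> s))" by (simp add: M_def)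
      ultimately show ?thesis
        using sum_left_shift_le[where g = "\<lambda>s. h (\<theta> s)", OF tG S \<phi> \<epsilon> K[OF \<theta>_in]] by simp
    qed
    have "K \<ge> 0" using K[OF tH] by simp
    have small: "w k \<le> 0" if k: "k \<in> B" and M: "\<And>x \<epsilon>. Q {t} \<epsilon> x \<Longrightarrow> M x k \<le> 2 * K * \<epsilon>" for k
    proof (rule field_le_epsilon)
      fix e :: real assume "e > 0"
      define \<epsilon> where "\<epsilon> = e / (2 * (K + 1))"
      have "\<epsilon> > 0" using \<open>e > 0\<close> \<open>K \<ge> 0\<close> by (simp add: \<epsilon>_def)
      then have "({t}, \<epsilon>) \<in> I" using tH by (simp add: I_def)
      then have "2 * K * \<epsilon> \<in> E k" using M unfolding E_def by blast
      then have "w k \<le> 2 * K * \<epsilon>" using w_le[OF k] p_le[OF k] by (meson order_trans)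
      also have "\<dots> \<le> 0 + e" using \<open>e > 0\<close> \<open>K \<ge> 0\<close> by (simp add: \<epsilon>_def field_simps)
      finally show "w k \<le> 0 + e" .
    qed
    have M_neg: "M x (- k) = - M x k" for x k
      using M_scale[of x "- 1" k] by (simp add: fun_Compl_def)
    have B_add: "k + l \<in> B" if "k \<in> B" "l \<in> B" for k l
      using B_sub that by (simp add: add_subgroup_def)
    have "w (ht + - h) \<le> 0"
    proof (rule small[OF B_add[OF ht neg_B[OF h]]])
      fix x \<epsilon> assume x: "Q {t} \<epsilon> x"
      show "M x (ht + - h) \<le> 2 * K * \<epsilon>"
        unfolding M_add M_neg using M_shift[OF x] by linarith
    qed
    moreover have "w (h + - ht) \<le> 0"
    proof (rule small[OF B_add[OF h neg_B[OF ht]]])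
      fix x \<epsilon> assume x: "Q {t} \<epsilon> x"
      show "M x (h + - ht) \<le> 2 * K * \<epsilon>"
        unfolding M_add M_neg using M_shift[OF x] by linarith
    qed
    ultimately have "w ht = w h"
      using w_add[OF ht neg_B[OF h]] w_add[OF h neg_B[OF ht]] w_neg h ht by simp
    moreover have "ht = (\<lambda>s. h (t \<otimes>\<^bsub>?H\<^esub> s))" by (simp add: ht_def fun_eq_iff)
    ultimately show "w (\<lambda>s. h (t \<otimes>\<^bsub>?H\<^esub> s)) = w h" by simp
  qed
  then show ?thesis by (auto simp: amenable_def)
qed

definition l1_norm :: "('x \<Rightarrow> real) \<Rightarrow> real" where
  "l1_norm v = (\<Sum>x | v x \<noteq> 0. \<bar>v x\<bar>)"

definition fin_supp :: "('x \<Rightarrow> real) \<Rightarrow> bool" where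
  "fin_supp v \<longleftrightarrow> finite {x. v x \<noteq> 0}"

lemma fin_supp_add:
  assumes "fin_supp u" "fin_supp v"
  shows "fin_supp (u + v)"
proof -
  have "{x. (u + v) x \<noteq> 0} \<subseteq> {x. u x \<noteq> 0} \<union> {x. v x \<noteq> 0}" by auto
  then show ?thesis using assms unfolding fin_supp_def by (meson finite_Un finite_subset)
qed

lemma fin_supp_scale:
  assumes "fin_supp v"
  shows "fin_supp (\<lambda>x. c * v x)"
  using assms unfolding fin_supp_def by (rule rev_finite_subset) auto

lemma l1_norm_superset:
  assumes "finite X" "\<And>x. x \<notin> X \<Longrightarrow> v x = 0"
  shows "l1_norm v = (\<Sum>x\<in>X. \<bar>v x\<bar>)"
  unfolding l1_norm_def by (rule sum.mono_neutral_left) (use assms in auto)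

lemma l1_norm_nonneg: "0 \<le> l1_norm v"
  unfolding l1_norm_def by (rule sum_nonneg) simp

lemma l1_norm_triangle:
  assumes "fin_supp u" "fin_supp v"
  shows "l1_norm (u + v) \<le> l1_norm u + l1_norm v"
proof -
  let ?X = "{x. u x \<noteq> 0} \<union> {x. v x \<noteq> 0}"
  have fin: "finite ?X" using assms by (simp add: fin_supp_def)
  have "l1_norm (u + v) = (\<Sum>x\<in>?X. \<bar>u x + v x\<bar>)"
    by (subst l1_norm_superset[OF fin]) auto
  also have "\<dots> \<le> (\<Sum>x\<in>?X. \<bar>u x\<bar> + \<bar>v x\<bar>)" by (rule sum_mono) auto
  also have "\<dots> = l1_norm u + l1_norm v"
    using l1_norm_superset[OF fin, of u] l1_norm_superset[OF fin, of v] by (simp add: sum.distrib)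
  finally show ?thesis .
qed

lemma l1_norm_scale: "l1_norm (\<lambda>x. c * v x) = \<bar>c\<bar> * l1_norm v"
proof (cases "c = 0")
  case False
  then have "{x. c * v x \<noteq> 0} = {x. v x \<noteq> 0}" by auto
  then show ?thesis by (simp add: l1_norm_def abs_mult sum_distrib_left)
qed (simp add: l1_norm_def)

lemma l1_norm_uminus: "l1_norm (- v) = l1_norm v"
  by (simp add: l1_norm_def)

lemma l1_norm_zero: "l1_norm 0 = 0"
  by (simp add: l1_norm_def)

lemma sum_fun_apply: "(\<Sum>t\<in>F. f t) x = (\<Sum>t\<in>F. f t x)"
  for f :: "'t \<Rightarrow> 'x \<Rightarrow> real"
  by (induction F rule: infinite_finite_induct) auto

lemma left_invariant_mean_sum:
  assumes m: "left_invariant_mean G m" and "finite F"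
    and b: "\<And>t. t \<in> F \<Longrightarrow> bounded_on_group G (g t)"
  shows "bounded_on_group G (\<lambda>s. \<Sum>t\<in>F. g t s) \<and> m (\<lambda>s. \<Sum>t\<in>F. g t s) = (\<Sum>t\<in>F. m (g t))"
  using \<open>finite F\<close> b
proof (induction F rule: finite_induct)
  case empty
  have "bounded_on_group G (\<lambda>s. 1)" by (auto simp: bounded_on_group_def)
  then have "m (\<lambda>s. 0 * 1) = 0 * m (\<lambda>s. 1)"
    using m unfolding left_invariant_mean_def by blast
  then show ?case by (auto simp: bounded_on_group_def)
next
  case (insert t F)
  then have IH: "bounded_on_group G (\<lambda>s. \<Sum>t\<in>F. g t s)" "bounded_on_group G (g t)"
    "m (\<lambda>s. \<Sum>t\<in>F. g t s) = (\<Sum>t\<in>F. m (g t))" by auto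
  obtain K L where KL: "\<And>s. s \<in> carrier G \<Longrightarrow> \<bar>\<Sum>t\<in>F. g t s\<bar> \<le> K" "\<And>s. s \<in> carrier G \<Longrightarrow> \<bar>g t s\<bar> \<le> L"
    using IH(1,2) by (auto simp: bounded_on_group_def)
  have "\<bar>g t s + (\<Sum>t\<in>F. g t s)\<bar> \<le> L + K" if "s \<in> carrier G" for s
    by (rule order_trans[OF abs_triangle_ineq add_mono]) (use KL that in auto)
  then have "bounded_on_group G (\<lambda>s. g t s + (\<Sum>t\<in>F. g t s))"
    by (auto simp: bounded_on_group_def)
  moreover have "m (\<lambda>s. g t s + (\<Sum>t\<in>F. g t s)) = m (g t) + m (\<lambda>s. \<Sum>t\<in>F. g t s)"
    using m IH(1,2) unfolding left_invariant_mean_def by blast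
  ultimately show ?case using insert IH(3) by simp
qed

text \<open>Day's convexity argument. If Reiter's condition fails for \<open>F\<close> and \<open>\<epsilon>\<close>, then the vectors
  \<open>T \<phi> = (\<phi>(t s) - \<phi>(s))\<close>, indexed by \<open>t \<in> F\<close> and \<open>s\<close>, satisfy \<open>\<parallel>T \<phi>\<parallel>\<^sub>1 \<ge> \<epsilon> \<parallel>\<phi>\<parallel>\<^sub>1\<close> on the cone of all finitely supported
  \<open>\<phi> \<ge> 0\<close>. Hahn--Banach separates this convex set from zero by bounded functions \<open>h\<^sub>t\<close>; evaluating at point masses
  gives \<open>\<Sum>\<^sub>t (h\<^sub>t(t\<^sup>-\<^sup>1 x) - h\<^sub>t(x)) \<ge> \<epsilon>\<close> for every \<open>x\<close>, but an invariant mean annihilates the left-hand side.\<close>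

lemma (in group) reiter_if_amenable:
  assumes "amenable G"
  shows "reiter G (carrier G)"
proof (rule ccontr)
  assume "\<not> reiter G (carrier G)"
  then obtain F \<epsilon> where F: "finite F" "F \<subseteq> carrier G" "(0::real) < \<epsilon>"
    and no: "\<not> (\<exists>\<phi> S. finite S \<and> S \<subseteq> carrier G \<and> (\<forall>s. 0 \<le> \<phi> s) \<and> (\<forall>s. s \<notin> S \<longrightarrow> \<phi> s = 0) \<and>
       sum \<phi> S = 1 \<and> (\<forall>t\<in>F. (\<Sum>s\<in>S. \<bar>\<phi> (t \<otimes> s) - \<phi> s\<bar>) < \<epsilon>))"
    unfolding reiter_def not_all not_imp by (elim exE conjE) (rule that)
  define C where "C = {\<phi> :: 'a \<Rightarrow> real. fin_supp \<phi> \<and> (\<forall>s. 0 \<le> \<phi> s) \<and> (\<forall>s. s \<notin> carrier G \<longrightarrow> \<phi> s = 0)}"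
  define T where "T \<phi> = (\<lambda>x. if fst x \<in> F \<and> snd x \<in> carrier G
      then \<phi> (fst x \<otimes> snd x) - \<phi> (snd x) else 0)" for \<phi> :: "'a \<Rightarrow> real"
  have C_zero: "0 \<in> C" by (simp add: C_def fin_supp_def)
  have C_add: "\<phi> + \<psi> \<in> C" if "\<phi> \<in> C" "\<psi> \<in> C" for \<phi> \<psi>
    using that by (auto simp: C_def fin_supp_add)
  have C_scale: "(\<lambda>s. c * \<phi> s) \<in> C" if "\<phi> \<in> C" "0 \<le> c" for \<phi> c
    using that by (auto simp: C_def fin_supp_scale)
  have T_add: "T (\<phi> + \<psi>) = T \<phi> + T \<psi>" for \<phi> \<psi> by (auto simp: T_def)
  have T_scale: "T (\<lambda>s. c * \<phi> s) = (\<lambda>x. c * T \<phi> x)" for \<phi> c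
    by (auto simp: T_def right_diff_distrib)
  have T_zero: "T 0 = 0" by (auto simp: T_def)
  have T_fin: "fin_supp (T \<phi>)" if "\<phi> \<in> C" for \<phi>
  proof -
    let ?S = "{s. \<phi> s \<noteq> 0}"
    have S: "finite ?S" using that by (simp add: C_def fin_supp_def)
    have "{x. T \<phi> x \<noteq> 0} \<subseteq> F \<times> (?S \<union> (\<Union>t\<in>F. (\<lambda>s. inv t \<otimes> s) ` ?S))"
    proof
      fix x assume "x \<in> {x. T \<phi> x \<noteq> 0}"
      then have x: "fst x \<in> F" "snd x \<in> carrier G" "\<phi> (fst x \<otimes> snd x) \<noteq> 0 \<or> \<phi> (snd x) \<noteq> 0"
        by (auto simp: T_def split: if_splits)
      have "snd x = inv (fst x) \<otimes> (fst x \<otimes> snd x)"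
        using x(1,2) F(2) by (auto simp: m_assoc[symmetric])
      then have "snd x \<in> ?S \<union> (\<Union>t\<in>F. (\<lambda>s. inv t \<otimes> s) ` ?S)" using x by blast
      then show "x \<in> F \<times> (?S \<union> (\<Union>t\<in>F. (\<lambda>s. inv t \<otimes> s) ` ?S))"
        using x(1) by (auto simp: mem_Times_iff)
    qed
    then show ?thesis
      unfolding fin_supp_def by (rule finite_subset) (use S F(1) in auto)
  qed
  have tot_add: "l1_norm (\<phi> + \<psi>) = l1_norm \<phi> + l1_norm \<psi>" if "\<phi> \<in> C" "\<psi> \<in> C" for \<phi> \<psi>
  proof -
    let ?X = "{x. \<phi> x \<noteq> 0} \<union> {x. \<psi> x \<noteq> 0}"
    have fin: "finite ?X" using that by (simp add: C_def fin_supp_def)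
    have "l1_norm (\<phi> + \<psi>) = (\<Sum>x\<in>?X. \<bar>\<phi> x + \<psi> x\<bar>)"
      by (subst l1_norm_superset[OF fin]) auto
    also have "\<dots> = (\<Sum>x\<in>?X. \<bar>\<phi> x\<bar> + \<bar>\<psi> x\<bar>)"
      by (rule sum.cong) (use that in \<open>auto simp: C_def\<close>)
    finally show ?thesis
      using l1_norm_superset[OF fin, of \<phi>] l1_norm_superset[OF fin, of \<psi>] by (simp add: sum.distrib)
  qed
  have gap: "\<epsilon> * l1_norm \<phi> \<le> l1_norm (T \<phi>)" if \<phi>: "\<phi> \<in> C" for \<phi>
  proof (rule ccontr)
    assume "\<not> ?thesis"
    then have less: "l1_norm (T \<phi>) < \<epsilon> * l1_norm \<phi>" by simp
    then have "0 < \<epsilon> * l1_norm \<phi>" using l1_norm_nonneg[of "T \<phi>"] by linarith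
    then have pos: "0 < l1_norm \<phi>" using F(3) by (simp add: zero_less_mult_iff)
    define \<psi> where "\<psi> = (\<lambda>s. (1 / l1_norm \<phi>) * \<phi> s)"
    have \<psi>: "\<psi> \<in> C" unfolding \<psi>_def by (rule C_scale[OF \<phi>]) (use pos in simp)
    have one: "l1_norm \<psi> = 1" using pos by (simp only: \<psi>_def l1_norm_scale) simp
    have "l1_norm (T \<psi>) = l1_norm (T \<phi>) / l1_norm \<phi>"
      using pos by (simp only: \<psi>_def T_scale l1_norm_scale) simp
    then have small: "l1_norm (T \<psi>) < \<epsilon>" using less pos by (simp add: pos_divide_less_eq)
    let ?S = "{s. \<psi> s \<noteq> 0}"
    show False
    proof (rule notE[OF no], intro exI[of _ \<psi>] exI[of _ ?S] conjI allI ballI impI)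
      show S: "finite ?S" "?S \<subseteq> carrier G" and nonneg: "0 \<le> \<psi> s" for s
        using \<psi> by (auto simp: C_def fin_supp_def)
      show "sum \<psi> ?S = 1" using one nonneg by (simp add: l1_norm_def)
      fix t assume t: "t \<in> F"
      let ?X = "{x. T \<psi> x \<noteq> 0} \<union> Pair t ` ?S"
      have X: "finite ?X" using T_fin[OF \<psi>] S(1) by (simp add: fin_supp_def)
      have "(\<Sum>s\<in>?S. \<bar>\<psi> (t \<otimes> s) - \<psi> s\<bar>) = (\<Sum>x\<in>Pair t ` ?S. \<bar>T \<psi> x\<bar>)"
        using S(2) t by (subst sum.reindex) (auto simp: inj_on_def T_def intro!: sum.cong)
      also have "\<dots> \<le> (\<Sum>x\<in>?X. \<bar>T \<psi> x\<bar>)" by (rule sum_mono2[OF X]) auto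
      also have "\<dots> = l1_norm (T \<psi>)" by (rule l1_norm_superset[OF X, symmetric]) auto
      finally show "(\<Sum>s\<in>?S. \<bar>\<psi> (t \<otimes> s) - \<psi> s\<bar>) < \<epsilon>" using small by simp
    qed auto
  qed
  define V where "V = {v :: 'a \<times> 'a \<Rightarrow> real. fin_supp v}"
  \<comment> \<open>The seminorm \<open>l\<^sup>1\<close> lowered along the cone; \<open>gap\<close> keeps it above \<open>- \<parallel>v\<parallel>\<^sub>1\<close>, and \<open>p (- T \<phi>) \<le> - \<epsilon> \<parallel>\<phi>\<parallel>\<^sub>1\<close>.\<close>
  define p where "p v = (INF \<phi>\<in>C. l1_norm (v + T \<phi>) - \<epsilon> * l1_norm \<phi>)" for v
  have V_sub: "add_subgroup V"
    unfolding add_subgroup_def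
  proof (intro conjI ballI)
    show "- v \<in> V" if "v \<in> V" for v using that by (simp add: V_def fin_supp_def)
  qed (auto simp: V_def fin_supp_add, simp add: fin_supp_def)
  have V_T: "T \<phi> \<in> V" if "\<phi> \<in> C" for \<phi> using T_fin[OF that] by (simp add: V_def)
  have V_add: "u + v \<in> V" if "u \<in> V" "v \<in> V" for u v
    using V_sub that by (simp add: add_subgroup_def)
  have V_neg: "- v \<in> V" if "v \<in> V" for v using V_sub that by (simp add: add_subgroup_def)
  have V_scale: "(\<lambda>x. c * v x) \<in> V" if "v \<in> V" for v c
    using that by (simp add: V_def fin_supp_scale)
  have tri: "l1_norm (u + v) \<le> l1_norm u + l1_norm v" if "u \<in> V" "v \<in> V" for u v
    using that by (simp add: V_def l1_norm_triangle)
  have lower: "- l1_norm v \<le> l1_norm (v + T \<phi>) - \<epsilon> * l1_norm \<phi>" if "v \<in> V" "\<phi> \<in> C" for v \<phi>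
  proof -
    have "l1_norm (- v + (v + T \<phi>)) \<le> l1_norm (- v) + l1_norm (v + T \<phi>)"
      by (intro tri V_neg V_add V_T that)
    then show ?thesis using gap[OF that(2)] by (simp add: l1_norm_uminus)
  qed
  have p_le: "p v \<le> l1_norm (v + T \<phi>) - \<epsilon> * l1_norm \<phi>" if "v \<in> V" "\<phi> \<in> C" for v \<phi>
    unfolding p_def by (rule cINF_lower[OF bdd_belowI2 that(2)]) (rule lower[OF that(1)])
  have p_greatest: "c \<le> p v" if "\<And>\<phi>. \<phi> \<in> C \<Longrightarrow> c \<le> l1_norm (v + T \<phi>) - \<epsilon> * l1_norm \<phi>" for c v
    unfolding p_def by (rule cINF_greatest) (use C_zero that in auto)
  have p_scale_le: "p (\<lambda>x. c * v x) \<le> c * p v" if c: "0 < c" and v: "v \<in> V" for c v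
  proof -
    have "p (\<lambda>x. c * v x) / c \<le> p v"
    proof (rule p_greatest)
      fix \<phi> assume \<phi>: "\<phi> \<in> C"
      have "(\<lambda>x. c * v x) + T (\<lambda>s. c * \<phi> s) = (\<lambda>x. c * (v + T \<phi>) x)"
        by (simp add: T_scale fun_eq_iff distrib_left)
      then have "l1_norm ((\<lambda>x. c * v x) + T (\<lambda>s. c * \<phi> s)) = c * l1_norm (v + T \<phi>)"
        using c by (simp only: l1_norm_scale abs_of_pos)
      moreover have "l1_norm (\<lambda>s. c * \<phi> s) = c * l1_norm \<phi>"
        using c by (simp only: l1_norm_scale abs_of_pos)
      ultimately have "p (\<lambda>x. c * v x) \<le> c * l1_norm (v + T \<phi>) - \<epsilon> * (c * l1_norm \<phi>)"
        using p_le[OF V_scale[OF v] C_scale[OF \<phi>], of c c] c by simp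
      then show "p (\<lambda>x. c * v x) / c \<le> l1_norm (v + T \<phi>) - \<epsilon> * l1_norm \<phi>"
        using c by (simp add: field_simps)
    qed
    then show ?thesis using c by (simp add: field_simps)
  qed
  have p_scale: "p (\<lambda>x. c * v x) = c * p v" if c: "0 < c" and v: "v \<in> V" for c v
  proof -
    have "p (\<lambda>x. (1 / c) * (c * v x)) \<le> (1 / c) * p (\<lambda>x. c * v x)"
      by (rule p_scale_le) (use c V_scale[OF v] in auto)
    then have "c * p v \<le> p (\<lambda>x. c * v x)" using c by (simp add: field_simps)
    then show ?thesis using p_scale_le[OF c v] by simp
  qed
  have V0: "0 \<in> V" using V_sub by (simp add: add_subgroup_def)
  have p_zero: "p 0 = 0"
  proof (rule antisym)
    show "p 0 \<le> 0" using p_le[OF V0 C_zero] by (simp add: T_zero l1_norm_zero)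
    show "0 \<le> p 0" by (rule p_greatest) (use lower[OF V0] in \<open>simp add: l1_norm_zero\<close>)
  qed
  have of_nat_fun: "of_nat n * v = (\<lambda>x. real n * v x)" for n and v :: "'a \<times> 'a \<Rightarrow> real"
    by (induction n) (simp_all add: fun_eq_iff algebra_simps)
  have p_sub: "sublinear_on V p"
    unfolding sublinear_on_def
  proof (intro conjI ballI allI)
    fix u v assume uv: "u \<in> V" "v \<in> V"
    have *: "p (u + v) \<le> (l1_norm (u + T \<phi>) - \<epsilon> * l1_norm \<phi>) + (l1_norm (v + T \<psi>) - \<epsilon> * l1_norm \<psi>)"
      if "\<phi> \<in> C" "\<psi> \<in> C" for \<phi> \<psi>
    proof -
      have "p (u + v) \<le> l1_norm ((u + v) + T (\<phi> + \<psi>)) - \<epsilon> * l1_norm (\<phi> + \<psi>)"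
        by (intro p_le V_add C_add uv that)
      also have "(u + v) + T (\<phi> + \<psi>) = (u + T \<phi>) + (v + T \<psi>)" by (simp add: T_add add_ac)
      also have "l1_norm \<dots> \<le> l1_norm (u + T \<phi>) + l1_norm (v + T \<psi>)"
        by (intro tri V_add V_T uv that)
      finally show ?thesis unfolding tot_add[OF that] distrib_left by linarith
    qed
    show "p (u + v) \<le> p u + p v"
      unfolding p_def[of u] p_def[of v] by (rule le_cInf_add) (use * C_zero in auto)
  next
    fix n v assume "v \<in> V"
    then show "p (of_nat n * v) = real n * p v"
      using p_scale[of "real n" v] p_zero by (cases "n = 0") (simp_all add: of_nat_fun)
  qed
  obtain w where w_add: "\<And>u v. u \<in> V \<Longrightarrow> v \<in> V \<Longrightarrow> w (u + v) = w u + w v"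
    and w_le: "\<And>v. v \<in> V \<Longrightarrow> w v \<le> p v"
    by (rule hahn_banach_additive[OF V_sub p_sub V0]) blast
  have w0: "w 0 = 0" using w_add[OF V0 V0] by simp
  have w_neg: "w (- v) = - w v" if "v \<in> V" for v
    using w_add[OF that V_neg[OF that]] w0 by simp
  have w_norm: "w v \<le> l1_norm v" if "v \<in> V" for v
    using w_le[OF that] p_le[OF that C_zero] by (simp add: T_zero l1_norm_zero)
  have w_sum: "sum v X \<in> V \<and> w (sum v X) = (\<Sum>i\<in>X. w (v i))" if "finite X" "\<And>i. i \<in> X \<Longrightarrow> v i \<in> V"
    for X :: "'a set" and v
    using that by (induction X rule: finite_induct) (auto simp: w0 V0 w_add V_add)
  define e where "e y = (\<lambda>x. if x = y then 1 else 0 :: real)" for y :: "'a \<times> 'a"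
  have e_V: "e y \<in> V" for y by (simp add: e_def V_def fin_supp_def)
  have e_norm: "l1_norm (e y) = 1" for y
    by (subst l1_norm_superset[of "{y}"]) (auto simp: e_def)
  define h where "h t s = w (e (t, s))" for t s
  have h_bound: "\<bar>h t s\<bar> \<le> 1" for t s
    using w_norm[OF e_V, of "(t, s)"] w_norm[OF V_neg[OF e_V], of "(t, s)"] w_neg[OF e_V, of "(t, s)"]
    by (simp add: h_def l1_norm_uminus e_norm)
  have key: "\<epsilon> \<le> (\<Sum>t\<in>F. h t (inv t \<otimes> x) + - 1 * h t x)" if x: "x \<in> carrier G" for x
  proof -
    define \<delta> where "\<delta> s = (if s = x then 1 else 0 :: real)" for s
    have \<delta>: "\<delta> \<in> C" using x by (auto simp: C_def \<delta>_def fin_supp_def)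
    have \<delta>1: "l1_norm \<delta> = 1"
      by (subst l1_norm_superset[of "{x}"]) (auto simp: \<delta>_def)
    have T\<delta>: "T \<delta> = (\<Sum>t\<in>F. e (t, inv t \<otimes> x) + - e (t, x))"
    proof
      fix y :: "'a \<times> 'a"
      obtain t s where y: "y = (t, s)" by (cases y)
      have "(\<Sum>t'\<in>F. e (t', inv t' \<otimes> x) + - e (t', x)) y
          = (\<Sum>t'\<in>F. if t' = t then e (t, inv t \<otimes> x) y - e (t, x) y else 0)"
        unfolding sum_fun_apply by (rule sum.cong) (auto simp: y e_def)
      also have "\<dots> = (if t \<in> F then e (t, inv t \<otimes> x) y - e (t, x) y else 0)"
        using F(1) by simp
      also have "\<dots> = T \<delta> y"
      proof (cases "t \<in> F")
        case True
        then have t: "t \<in> carrier G" using F(2) by blast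
        have "s = inv t \<otimes> x \<longleftrightarrow> s \<in> carrier G \<and> t \<otimes> s = x"
          using t x by (metis inv_closed inv_solve_left m_closed)
        then show ?thesis using True x by (auto simp: T_def y e_def \<delta>_def)
      qed (simp add: T_def y)
      finally show "T \<delta> y = (\<Sum>t\<in>F. e (t, inv t \<otimes> x) + - e (t, x)) y" by simp
    qed
    have "w (- T \<delta>) \<le> l1_norm (- T \<delta> + T \<delta>) - \<epsilon> * l1_norm \<delta>"
      by (rule order_trans[OF w_le p_le]) (use V_neg V_T \<delta> in auto)
    then have "\<epsilon> \<le> w (T \<delta>)" using w_neg[OF V_T[OF \<delta>]] by (simp add: l1_norm_zero \<delta>1)
    also have "\<dots> = (\<Sum>t\<in>F. w (e (t, inv t \<otimes> x) + - e (t, x)))"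
      unfolding T\<delta> using w_sum[OF F(1), of "\<lambda>t. e (t, inv t \<otimes> x) + - e (t, x)"] V_add V_neg e_V by blast
    also have "\<dots> = (\<Sum>t\<in>F. h t (inv t \<otimes> x) + - 1 * h t x)"
      by (rule sum.cong[OF refl])
        (simp only: w_add[OF e_V V_neg[OF e_V]] w_neg[OF e_V] h_def mult_minus1)
    finally show ?thesis .
  qed
  obtain m where m: "left_invariant_mean G m" using assms by (auto simp: amenable_def)
  have bh: "bounded_on_group G (\<lambda>s. h t (f s))" for t f
    unfolding bounded_on_group_def using h_bound by blast
  have bd: "bounded_on_group G (\<lambda>s. h t (inv t \<otimes> s) + - 1 * h t s)" for t
  proof -
    have "\<bar>h t (inv t \<otimes> s) + - 1 * h t s\<bar> \<le> 2" for s
      using h_bound[of t "inv t \<otimes> s"] h_bound[of t s] by linarith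
    then show ?thesis unfolding bounded_on_group_def by blast
  qed
  have bn: "bounded_on_group G (\<lambda>s. - 1 * h t s)" for t
    unfolding bounded_on_group_def using h_bound[of t] by (intro exI[of _ 1]) simp
  have "m (\<lambda>s. h t (inv t \<otimes> s) + - 1 * h t s) = 0" if "t \<in> F" for t
  proof -
    have t: "inv t \<in> carrier G" using that F(2) by auto
    have "m (\<lambda>s. h t (inv t \<otimes> s) + - 1 * h t s) = m (\<lambda>s. h t (inv t \<otimes> s)) + m (\<lambda>s. - 1 * h t s)"
      using m bh[of t "\<lambda>s. inv t \<otimes> s"] bn unfolding left_invariant_mean_def by blast
    also have "m (\<lambda>s. - 1 * h t s) = - 1 * m (h t)"
      using m bh[of t "\<lambda>s. s"] unfolding left_invariant_mean_def by blast
    also have "m (\<lambda>s. h t (inv t \<otimes> s)) = m (h t)"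
      using m bh[of t "\<lambda>s. s"] t unfolding left_invariant_mean_def by blast
    finally show ?thesis by simp
  qed
  then have zero: "m (\<lambda>s. \<Sum>t\<in>F. h t (inv t \<otimes> s) + - 1 * h t s) = 0"
    and b: "bounded_on_group G (\<lambda>s. \<Sum>t\<in>F. h t (inv t \<otimes> s) + - 1 * h t s)"
    using left_invariant_mean_sum[OF m F(1), of "\<lambda>t s. h t (inv t \<otimes> s) + - 1 * h t s"] bd by auto
  let ?g = "\<lambda>s. \<Sum>t\<in>F. h t (inv t \<otimes> s) + - 1 * h t s"
  have c1: "bounded_on_group G (\<lambda>s. 1)" and c\<epsilon>: "bounded_on_group G (\<lambda>s. - \<epsilon> * 1)"
    by (auto simp: bounded_on_group_def)
  obtain K where K: "\<And>s. s \<in> carrier G \<Longrightarrow> \<bar>?g s\<bar> \<le> K" using b by (auto simp: bounded_on_group_def)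
  have "\<bar>?g s + - \<epsilon> * 1\<bar> \<le> K + \<epsilon>" if "s \<in> carrier G" for s
    using K[OF that] F(3) by linarith
  then have "bounded_on_group G (\<lambda>s. ?g s + - \<epsilon> * 1)" unfolding bounded_on_group_def by blast
  moreover have "\<forall>s\<in>carrier G. 0 \<le> ?g s + - \<epsilon> * 1" using key by simp
  ultimately have "0 \<le> m (\<lambda>s. ?g s + - \<epsilon> * 1)"
    using m unfolding left_invariant_mean_def by blast
  also have "\<dots> = m ?g + m (\<lambda>s. - \<epsilon> * 1)"
    using m b c\<epsilon> unfolding left_invariant_mean_def by blast
  also have "m (\<lambda>s. - \<epsilon> * 1) = - \<epsilon> * m (\<lambda>s. 1)"
    using m c1 unfolding left_invariant_mean_def by blast
  also have "m (\<lambda>s. 1) = 1" using m unfolding left_invariant_mean_def by blast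
  finally show False using zero F(3) by simp
qed

section \<open>A finitary form of property (EP)\<close>

definition EP_approx ::
  "('g, 'm) monoid_scheme \<Rightarrow> ('g, 'a) star_bundle \<Rightarrow> real \<Rightarrow> ('g \<times> 'a) set \<Rightarrow> real \<Rightarrow> ('g \<Rightarrow> 'a) \<Rightarrow> bool"
  where
  "EP_approx G A C Z \<epsilon> f \<longleftrightarrow>
     f \<in> carrier G \<rightarrow> carrier (fiber A \<one>\<^bsub>G\<^esub>) \<and> finite (bundle_support G A f) \<and>
     nrm (fiber A \<one>\<^bsub>G\<^esub>) (EP_square G A f) \<le> C \<and>
     (\<forall>t a. (t, a) \<in> Z \<longrightarrow> nrm (fiber A t) (EP_sum G A f t a \<ominus>\<^bsub>fiber A t\<^esub> a) < \<epsilon>)"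

text \<open>Nets are eliminated: finitely many pairs \<open>(t, a)\<close> and one \<open>\<epsilon>\<close> are handled by a single function, with a bound \<open>C\<close>
  independent of them. Conversely such functions form a net indexed by finite sets of pairs and the errors
  \<open>1 / (n + 1)\<close>.\<close>

lemma property_EP_iff_finite_approximation:
  "property_EP G A \<longleftrightarrow>
     (\<exists>C. \<forall>Z \<epsilon>. finite Z \<and> Z \<subseteq> (SIGMA t:carrier G. carrier (fiber A t)) \<and> 0 < \<epsilon> \<longrightarrow>
        (\<exists>f. EP_approx G A C Z \<epsilon> f))"
  (is "_ \<longleftrightarrow> (\<exists>C. \<forall>Z \<epsilon>. ?pre Z \<epsilon> \<longrightarrow> (\<exists>f. EP_approx G A C Z \<epsilon> f))")
proof
  assume "property_EP G A"
  then obtain I :: "(('a \<Rightarrow> 'c) \<times> ('a \<Rightarrow> 'c) set) set" and leq f where net: "EP_net G A I leq f"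
    unfolding property_EP_def by blast
  then have "\<exists>C. \<forall>i\<in>I. nrm (fiber A \<one>\<^bsub>G\<^esub>) (EP_square G A (f i)) \<le> C"
    by (simp add: EP_net_def)
  then obtain C where C: "\<And>i. i \<in> I \<Longrightarrow> nrm (fiber A \<one>\<^bsub>G\<^esub>) (EP_square G A (f i)) \<le> C"
    by blast
  have dir: "directed_preorder I leq" using net by (simp add: EP_net_def)
  let ?close = "\<lambda>i t a \<epsilon>. nrm (fiber A t) (EP_sum G A (f i) t a \<ominus>\<^bsub>fiber A t\<^esub> a) < \<epsilon>"
  have ev: "\<exists>i0\<in>I. \<forall>i\<in>I. leq i0 i \<longrightarrow>
      (\<forall>t a. (t, a) \<in> Z \<longrightarrow> ?close i t a \<epsilon>)"
    if "finite Z" "Z \<subseteq> (SIGMA t:carrier G. carrier (fiber A t))" "0 < \<epsilon>" for Z and \<epsilon> :: real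
    using that(1,2)
  proof (induction Z rule: finite_induct)
    case empty
    have "I \<noteq> {}" using dir by (simp add: directed_preorder_def)
    then show ?case by auto
  next
    case (insert z Z)
    obtain t a where z: "z = (t, a)" "t \<in> carrier G" "a \<in> carrier (fiber A t)"
      using insert.prems by auto
    have "Z \<subseteq> (SIGMA t:carrier G. carrier (fiber A t))" using insert.prems by blast
    from insert.IH[OF this] obtain i1 where i1: "i1 \<in> I" "\<And>i t a. i \<in> I \<Longrightarrow> leq i1 i \<Longrightarrow>
        (t, a) \<in> Z \<Longrightarrow> ?close i t a \<epsilon>"
      by blast
    have "\<forall>\<epsilon>>0. \<exists>i0\<in>I. \<forall>i\<in>I. leq i0 i \<longrightarrow>
        ?close i t a \<epsilon>"
      using net z(2,3) unfolding EP_net_def by simp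
    then obtain i2 where i2: "i2 \<in> I" "\<And>i. i \<in> I \<Longrightarrow> leq i2 i \<Longrightarrow>
        ?close i t a \<epsilon>"
      using \<open>0 < \<epsilon>\<close> by blast
    obtain i0 where i0: "i0 \<in> I" "leq i1 i0" "leq i2 i0"
      using dir i1(1) i2(1) unfolding directed_preorder_def by blast
    have trans: "leq j i" if "j \<in> I" "leq j i0" "i \<in> I" "leq i0 i" for i j
      using dir i0(1) that unfolding directed_preorder_def by blast
    show ?case
    proof (intro bexI[of _ i0] ballI impI allI)
      fix i t' a' assume i: "i \<in> I" "leq i0 i" and "(t', a') \<in> insert z Z"
      then consider "t' = t" "a' = a" | "(t', a') \<in> Z" using z(1) by blast
      then show "?close i t' a' \<epsilon>"
      proof cases
        case 1
        then show ?thesis using i2(2)[OF i(1) trans[OF i2(1) i0(3) i]] by simp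
      next
        case 2
        then show ?thesis by (rule i1(2)[OF i(1) trans[OF i1(1) i0(2) i]])
      qed
    qed (rule i0(1))
  qed
  have "\<exists>f. EP_approx G A C Z \<epsilon> f" if pre: "?pre Z \<epsilon>" for Z \<epsilon>
  proof -
    have "finite Z" "Z \<subseteq> (SIGMA t:carrier G. carrier (fiber A t))" "0 < \<epsilon>" using pre by blast+
    from ev[OF this] obtain i0 where i0: "i0 \<in> I" "\<And>i t a. i \<in> I \<Longrightarrow> leq i0 i \<Longrightarrow>
        (t, a) \<in> Z \<Longrightarrow> ?close i t a \<epsilon>"
      by blast
    have refl: "leq i0 i0" using dir i0(1) by (simp add: directed_preorder_def)
    have "f i0 \<in> carrier G \<rightarrow> carrier (fiber A \<one>\<^bsub>G\<^esub>) \<and> finite (bundle_support G A (f i0))"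
      using net i0(1) by (simp add: EP_net_def)
    then have "EP_approx G A C Z \<epsilon> (f i0)"
      unfolding EP_approx_def using C[OF i0(1)] i0(2)[OF i0(1) refl] by blast
    then show ?thesis by blast
  qed
  then show "\<exists>C. \<forall>Z \<epsilon>. ?pre Z \<epsilon> \<longrightarrow> (\<exists>f. EP_approx G A C Z \<epsilon> f)" by blast
next
  assume "\<exists>C. \<forall>Z \<epsilon>. ?pre Z \<epsilon> \<longrightarrow> (\<exists>f. EP_approx G A C Z \<epsilon> f)"
  then obtain C where C: "\<And>Z \<epsilon>. ?pre Z \<epsilon> \<Longrightarrow> \<exists>f. EP_approx G A C Z \<epsilon> f" by blast
  define I where "I = {(Z, n::nat). finite Z \<and> Z \<subseteq> (SIGMA t:carrier G. carrier (fiber A t))}"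
  define leq where "leq i j \<longleftrightarrow> fst i \<subseteq> fst j \<and> snd i \<le> snd j"
    for i j :: "('a \<times> 'c) set \<times> nat"
  define f where "f i = (SOME f. EP_approx G A C (fst i) (1 / real (Suc (snd i))) f)" for i
  have f: "EP_approx G A C (fst i) (1 / real (Suc (snd i))) (f i)" if "i \<in> I" for i
  proof -
    have "\<exists>f. EP_approx G A C (fst i) (1 / real (Suc (snd i))) f"
      by (rule C) (use that in \<open>auto simp: I_def\<close>)
    then show ?thesis unfolding f_def by (rule someI_ex)
  qed
  let ?close = "\<lambda>i t a \<epsilon>. nrm (fiber A t) (EP_sum G A (f i) t a \<ominus>\<^bsub>fiber A t\<^esub> a) < \<epsilon>"
  have "EP_net G A I leq f"
    unfolding EP_net_def
  proof (intro conjI ballI allI impI)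
    show "directed_preorder I leq"
      unfolding directed_preorder_def
    proof (intro conjI ballI)
      show "I \<noteq> {}" by (auto simp: I_def)
      fix i j assume "i \<in> I" "j \<in> I"
      then show "\<exists>k\<in>I. leq i k \<and> leq j k"
        by (intro bexI[of _ "(fst i \<union> fst j, max (snd i) (snd j))"]) (auto simp: I_def leq_def)
    qed (auto simp: leq_def)
    show "f i \<in> carrier G \<rightarrow> carrier (fiber A \<one>\<^bsub>G\<^esub>)" "finite (bundle_support G A (f i))"
      if "i \<in> I" for i using f[OF that] by (simp_all add: EP_approx_def)
    show "\<exists>C. \<forall>i\<in>I. nrm (fiber A \<one>\<^bsub>G\<^esub>) (EP_square G A (f i)) \<le> C"
      by (intro exI[of _ C] ballI) (use f in \<open>simp add: EP_approx_def\<close>)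
    fix t a and \<epsilon> :: real
    assume t: "t \<in> carrier G" "a \<in> carrier (fiber A t)" and "0 < \<epsilon>"
    then obtain n where n: "1 / real (Suc n) < \<epsilon>" using reals_Archimedean[of \<epsilon>]
      by (auto simp: inverse_eq_divide)
    have "({(t, a)}, n) \<in> I" using t by (simp add: I_def)
    moreover have "?close i t a \<epsilon>"
      if i: "i \<in> I" "leq ({(t, a)}, n) i" for i
    proof -
      have "(t, a) \<in> fst i" "n \<le> snd i" using i(2) by (auto simp: leq_def)
      then have "nrm (fiber A t) (EP_sum G A (f i) t a \<ominus>\<^bsub>fiber A t\<^esub> a) < 1 / real (Suc (snd i))"
        using f[OF i(1)] unfolding EP_approx_def by blast
      also have "\<dots> \<le> 1 / real (Suc n)" using \<open>n \<le> snd i\<close> by (simp add: field_simps)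
      finally show ?thesis using n by simp
    qed
    ultimately show "\<exists>i0\<in>I. \<forall>i\<in>I. leq i0 i \<longrightarrow>
        ?close i t a \<epsilon>" by blast
  qed
  then show "property_EP G A" by (rule EP_net_imp_property_EP)
qed

section \<open>Property (EP) for pull-backs\<close>

lemma (in abelian_monoid) finsum_Times:
  assumes "finite X" "finite Y" "\<And>x y. x \<in> X \<Longrightarrow> y \<in> Y \<Longrightarrow> f (x, y) \<in> carrier G"
  shows "(\<Oplus>z\<in>X \<times> Y. f z) = (\<Oplus>x\<in>X. \<Oplus>y\<in>Y. f (x, y))"
  using assms(1,3)
proof (induction X rule: finite_induct)
  case (insert x X)
  have "insert x X \<times> Y = Pair x ` Y \<union> X \<times> Y" by auto
  then have "(\<Oplus>z\<in>insert x X \<times> Y. f z) = (\<Oplus>z\<in>Pair x ` Y. f z) \<oplus> (\<Oplus>z\<in>X \<times> Y. f z)"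
    using insert assms(2) by (simp only:) (rule finsum_Un_disjoint, auto)
  also have "(\<Oplus>z\<in>Pair x ` Y. f z) = (\<Oplus>y\<in>Y. f (x, y))"
    using insert by (intro finsum_reindex) (auto simp: inj_on_def)
  also have "(\<Oplus>z\<in>X \<times> Y. f z) = (\<Oplus>x\<in>X. \<Oplus>y\<in>Y. f (x, y))"
    using insert by simp
  finally show ?case
    using insert by (subst finsum_insert) (auto intro!: finsum_closed)
qed simp

context cbanach_space
begin

lemma finsum_smult_const:
  assumes "finite X" "e \<in> carrier V"
  shows "(\<Oplus>x\<in>X. c x \<odot> e) = (\<Sum>x\<in>X. c x) \<odot> e"
  using assms(1)
proof (induction X rule: finite_induct)
  case (insert x X)
  then show ?case using assms(2) by (simp add: finsum_insert smult_add_left)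
qed (use assms in simp)

lemma nrm_finsum_smult_diff_le:
  assumes "finite X" "\<And>x. x \<in> X \<Longrightarrow> e x \<in> carrier V"
  shows "nrm V ((\<Oplus>x\<in>X. c x \<odot> e x) \<ominus> (\<Oplus>x\<in>X. e x)) \<le> (\<Sum>x\<in>X. cmod (c x - 1) * nrm V (e x))"
proof -
  have cl: "(\<Oplus>x\<in>X. (c x - 1) \<odot> e x) \<in> carrier V" "(\<Oplus>x\<in>X. e x) \<in> carrier V"
    using assms(2) by (auto intro!: finsum_closed)
  have "(\<Oplus>x\<in>X. c x \<odot> e x) = (\<Oplus>x\<in>X. (c x - 1) \<odot> e x \<oplus> e x)"
  proof (rule finsum_cong')
    fix x assume "x \<in> X"
    then show "c x \<odot> e x = (c x - 1) \<odot> e x \<oplus> e x"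
      using smult_add_left[of "e x" "c x - 1" 1] assms(2) by simp
  qed (use assms(2) in auto)
  also have "\<dots> = (\<Oplus>x\<in>X. (c x - 1) \<odot> e x) \<oplus> (\<Oplus>x\<in>X. e x)"
    using assms(2) by (intro finsum_addf) auto
  finally have "(\<Oplus>x\<in>X. c x \<odot> e x) \<ominus> (\<Oplus>x\<in>X. e x) = (\<Oplus>x\<in>X. (c x - 1) \<odot> e x)"
    using cl by (simp add: a_minus_def a_assoc r_neg)
  also have "nrm V \<dots> \<le> (\<Sum>x\<in>X. nrm V ((c x - 1) \<odot> e x))"
    by (rule nrm_finsum_le) (use assms in auto)
  also have "\<dots> = (\<Sum>x\<in>X. cmod (c x - 1) * nrm V (e x))"
    by (rule sum.cong) (use assms in \<open>auto simp: nrm_smult\<close>)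
  finally show ?thesis .
qed

end

text \<open>From \<open>(sqrt b - sqrt a)\<^sup>2 \<le> |b - a|\<close>, closeness in the \<open>l\<^sup>1\<close> norm of \<open>\<phi>\<close> and \<open>\<phi>'\<close> gives closeness in the \<open>l\<^sup>2\<close> norm of their
  square roots. The Cauchy--Schwarz step is done termwise, by \<open>2 \<delta> \<alpha> \<beta> \<le> \<delta>\<^sup>2 \<alpha>\<^sup>2 + \<beta>\<^sup>2\<close>.\<close>

lemma sqrt_overlap_near_one:
  fixes \<phi> \<phi>' :: "'x \<Rightarrow> real"
  assumes nonneg: "\<And>x. 0 \<le> \<phi> x" "\<And>x. 0 \<le> \<phi>' x" and one: "sum \<phi> S = 1"
    and \<delta>: "0 < \<delta>" "(\<Sum>x\<in>S. \<bar>\<phi>' x - \<phi> x\<bar>) \<le> \<delta>\<^sup>2"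
  shows "\<bar>(\<Sum>x\<in>S. sqrt (\<phi>' x) * sqrt (\<phi> x)) - 1\<bar> \<le> \<delta>"
proof -
  have "(\<Sum>x\<in>S. sqrt (\<phi>' x) * sqrt (\<phi> x)) - 1 = (\<Sum>x\<in>S. sqrt (\<phi> x) * (sqrt (\<phi>' x) - sqrt (\<phi> x)))"
  proof -
    have "(\<Sum>x\<in>S. sqrt (\<phi> x) * sqrt (\<phi> x)) = 1" using one nonneg by simp
    then show ?thesis by (simp add: right_diff_distrib sum_subtractf mult.commute)
  qed
  also have "\<bar>\<dots>\<bar> \<le> (\<Sum>x\<in>S. (\<delta> * \<phi> x + \<bar>\<phi>' x - \<phi> x\<bar> / \<delta>) / 2)"
  proof (rule order_trans[OF sum_abs sum_mono])
    fix x
    define a b where "a = sqrt (\<phi> x)" and "b = sqrt (\<phi>' x)"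
    have ab: "0 \<le> a" "0 \<le> b" "a * a = \<phi> x" "b * b = \<phi>' x"
      using nonneg by (auto simp: a_def b_def)
    have "(b - a)\<^sup>2 \<le> \<bar>b * b - a * a\<bar>"
    proof -
      have "(b - a)\<^sup>2 = \<bar>b - a\<bar> * \<bar>b - a\<bar>" by (simp add: power2_eq_square)
      also have "\<dots> \<le> \<bar>b - a\<bar> * \<bar>b + a\<bar>" using ab by (intro mult_left_mono) auto
      also have "\<dots> = \<bar>b * b - a * a\<bar>" by (simp add: abs_mult[symmetric] algebra_simps)
      finally show ?thesis .
    qed
    moreover have "2 * \<delta> * \<bar>a * (b - a)\<bar> \<le> \<delta>\<^sup>2 * (a * a) + (b - a)\<^sup>2"
    proof -
      have "0 \<le> (\<delta> * a - \<bar>b - a\<bar>)\<^sup>2" by simp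
      moreover have "(\<delta> * a - \<bar>b - a\<bar>)\<^sup>2 = \<delta>\<^sup>2 * (a * a) + (b - a)\<^sup>2 - 2 * \<delta> * \<bar>a * (b - a)\<bar>"
        using ab(1) by (simp add: power2_diff[of "\<delta> * a"] power_mult_distrib abs_mult power2_eq_square[of a])
      ultimately show ?thesis by simp
    qed
    ultimately have "2 * \<delta> * \<bar>a * (b - a)\<bar> \<le> \<delta>\<^sup>2 * \<phi> x + \<bar>\<phi>' x - \<phi> x\<bar>" using ab by simp
    then have "\<bar>a * (b - a)\<bar> \<le> (\<delta>\<^sup>2 * \<phi> x + \<bar>\<phi>' x - \<phi> x\<bar>) / (2 * \<delta>)"
      using \<delta>(1) by (simp add: pos_le_divide_eq mult_ac)
    also have "\<dots> = (\<delta> * \<phi> x + \<bar>\<phi>' x - \<phi> x\<bar> / \<delta>) / 2"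
      using \<delta>(1) by (simp add: field_simps power2_eq_square)
    finally show "\<bar>sqrt (\<phi> x) * (sqrt (\<phi>' x) - sqrt (\<phi> x))\<bar> \<le> (\<delta> * \<phi> x + \<bar>\<phi>' x - \<phi> x\<bar> / \<delta>) / 2"
      by (simp add: a_def b_def)
  qed
  also have "\<dots> = (\<delta> * sum \<phi> S + (\<Sum>x\<in>S. \<bar>\<phi>' x - \<phi> x\<bar>) / \<delta>) / 2"
    by (simp add: sum_distrib_left sum_divide_distrib[symmetric] sum.distrib)
  also have "\<dots> \<le> (\<delta> * 1 + \<delta>\<^sup>2 / \<delta>) / 2"
    using one \<delta> by (intro divide_right_mono add_mono) auto
  also have "\<dots> = \<delta>" using \<delta>(1) by (simp add: power2_eq_square)
  finally show ?thesis .
qed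

definition EP_term :: "('g, 'm) monoid_scheme \<Rightarrow> ('g, 'a) star_bundle \<Rightarrow> 'g \<Rightarrow> 'a \<Rightarrow> 'a \<Rightarrow> 'a \<Rightarrow> 'a" where
  "EP_term G A t a u v = bmult A t \<one>\<^bsub>G\<^esub> (bmult A \<one>\<^bsub>G\<^esub> t (bstar A \<one>\<^bsub>G\<^esub> u) a) v"

context fell_bundle
begin

lemma EP_term_closed:
  assumes "t \<in> carrier G" "a \<in> carrier (fiber A t)" "u \<in> carrier (fiber A \<one>)" "v \<in> carrier (fiber A \<one>)"
  shows "EP_term G A t a u v \<in> carrier (fiber A t)"
  unfolding EP_term_def
  using bmult_closed[of t \<one> "bmult A \<one> t (bstar A \<one> u) a" v] bmult_closed[of \<one> t "bstar A \<one> u" a]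
    bstar_closed[of \<one> u] assms by simp

lemma EP_term_smult:
  assumes "t \<in> carrier G" "a \<in> carrier (fiber A t)" "u \<in> carrier (fiber A \<one>)" "v \<in> carrier (fiber A \<one>)"
  shows "EP_term G A t a (complex_of_real \<alpha> \<odot>\<^bsub>fiber A \<one>\<^esub> u) (complex_of_real \<beta> \<odot>\<^bsub>fiber A \<one>\<^esub> v)
    = complex_of_real (\<alpha> * \<beta>) \<odot>\<^bsub>fiber A t\<^esub> EP_term G A t a u v"
proof -
  interpret E: cbanach_space "fiber A \<one>" by (rule fiber_banach) simp
  interpret T: cbanach_space "fiber A t" by (rule fiber_banach) fact
  have su: "bstar A \<one> u \<in> carrier (fiber A \<one>)" using bstar_closed[of \<one> u] assms by simp
  have sua: "bmult A \<one> t (bstar A \<one> u) a \<in> carrier (fiber A t)"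
    using bmult_closed[of \<one> t "bstar A \<one> u" a] su assms by simp
  have "bstar A \<one> (complex_of_real \<alpha> \<odot>\<^bsub>fiber A \<one>\<^esub> u) = complex_of_real \<alpha> \<odot>\<^bsub>fiber A \<one>\<^esub> bstar A \<one> u"
    using bstar_smult[of \<one> u "complex_of_real \<alpha>"] assms by simp
  then show ?thesis
    unfolding EP_term_def
    using assms su sua bmult_closed[of t \<one> "bmult A \<one> t (bstar A \<one> u) a" v]
      bmult_smult_left[of \<one> t "bstar A \<one> u" a] 
      bmult_smult_left[of t \<one> "bmult A \<one> t (bstar A \<one> u) a" "complex_of_real \<beta> \<odot>\<^bsub>fiber A \<one>\<^esub> v"]
      bmult_smult_right[of t \<one> "bmult A \<one> t (bstar A \<one> u) a" v]
    by (simp add: T.smult_smult)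
qed

lemma bstar_bmult_smult:
  assumes "u \<in> carrier (fiber A \<one>)"
  shows "bmult A \<one> \<one> (bstar A \<one> (complex_of_real \<alpha> \<odot>\<^bsub>fiber A \<one>\<^esub> u)) (complex_of_real \<alpha> \<odot>\<^bsub>fiber A \<one>\<^esub> u)
    = complex_of_real (\<alpha> * \<alpha>) \<odot>\<^bsub>fiber A \<one>\<^esub> bmult A \<one> \<one> (bstar A \<one> u) u"
proof -
  interpret E: cstar_algebra "fiber A \<one>" "bmult A \<one> \<one>" "bstar A \<one>"
    by (rule cstar_algebra_unit_fiber)
  show ?thesis
    using assms by (simp add: E.adj_smult E.mul_smult_left E.mul_smult_right E.smult_smult)
qed

end

lemma pullback_simps [simp]:
  "fiber (pullback q D) s = fiber D (q s)"
  "bmult (pullback q D) s t = bmult D (q s) (q t)"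
  "bstar (pullback q D) s = bstar D (q s)"
  by (simp_all add: pullback_def)

lemma (in cbanach_space) nrm_minus_triangle:
  assumes "x \<in> carrier V" "y \<in> carrier V" "z \<in> carrier V"
  shows "nrm V (x \<ominus> z) \<le> nrm V (x \<ominus> y) + nrm V (y \<ominus> z)"
proof -
  have "x \<ominus> z = (x \<ominus> y) \<oplus> (y \<ominus> z)"
    using assms by (simp add: a_minus_def a_assoc r_neg1)
  then show ?thesis using nrm_triangle[of "x \<ominus> y" "y \<ominus> z"] assms by simp
qed

text \<open>The function \<open>F(c(x) n) = sqrt(\<phi>(n)) f(x)\<close>. Left coset representatives are needed, so that translation by \<open>t\<close> acts on
  the coordinate \<open>n\<close> by a left translation, by \<open>k t x\<close>, and not by conjugation with \<open>t\<close>. The vector \<open>\<phi>\<close> is chosen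
  after \<open>f\<close>, with an error that takes the norms \<open>L\<close> of the finitely many summands into account.\<close>

lemma (in group_hom) property_EP_pullback:
  assumes surj: "h ` carrier G = carrier H"
    and fell: "fell_bundle H D" and EP: "property_EP H D"
    and reiter: "reiter (G\<lparr>carrier := kernel G H h\<rparr>) (kernel G H h)"
  shows "property_EP G (pullback h D)"
proof -
  interpret D: fell_bundle H D by fact
  let ?A = "fiber D \<one>\<^bsub>H\<^esub>"
  let ?mul = "bmult D \<one>\<^bsub>H\<^esub> \<one>\<^bsub>H\<^esub>" and ?adj = "bstar D \<one>\<^bsub>H\<^esub>"
  interpret E: cstar_algebra ?A ?mul ?adj
    by (rule D.cstar_algebra_unit_fiber)
  let ?N = "kernel G H h"
  have N: "n \<in> carrier G" "h n = \<one>\<^bsub>H\<^esub>" if "n \<in> ?N" for n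
    using that by (auto simp: kernel_def)
  define c where "c x = (SOME s. s \<in> carrier G \<and> h s = x)" for x
  have c: "c x \<in> carrier G" "h (c x) = x" if "x \<in> carrier H" for x
  proof -
    have "x \<in> h ` carrier G" using that by (simp add: surj)
    then have "\<exists>s. s \<in> carrier G \<and> h s = x" by blast
    then have "c x \<in> carrier G \<and> h (c x) = x" unfolding c_def by (rule someI_ex)
    then show "c x \<in> carrier G" "h (c x) = x" by auto
  qed
  define k where "k t x = inv (c (h t \<otimes>\<^bsub>H\<^esub> x)) \<otimes> (t \<otimes> c x)" for t x
  have k: "k t x \<in> ?N" if "t \<in> carrier G" "x \<in> carrier H" for t x
  proof -
    have tx: "h t \<otimes>\<^bsub>H\<^esub> x \<in> carrier H" using that by simp
    have "h (k t x) = inv\<^bsub>H\<^esub> (h (c (h t \<otimes>\<^bsub>H\<^esub> x))) \<otimes>\<^bsub>H\<^esub> (h t \<otimes>\<^bsub>H\<^esub> h (c x))"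
      using that(1) c(1)[OF tx] c(1)[OF that(2)] by (simp add: k_def)
    also have "\<dots> = \<one>\<^bsub>H\<^esub>" unfolding c(2)[OF tx] c(2)[OF that(2)] using tx by simp
    finally have "h (k t x) = \<one>\<^bsub>H\<^esub>" .
    moreover have "k t x \<in> carrier G" using that(1) c(1)[OF tx] c(1)[OF that(2)] by (simp add: k_def)
    ultimately show ?thesis by (simp add: kernel_def)
  qed
  from EP obtain C where C: "\<forall>Z \<epsilon>. finite Z \<and> Z \<subseteq> (SIGMA t:carrier H. carrier (fiber D t)) \<and> 0 < \<epsilon>
      \<longrightarrow> (\<exists>f. EP_approx H D C Z \<epsilon> f)"
    unfolding property_EP_iff_finite_approximation by (elim exE) (rule that)
  have "\<exists>F. EP_approx G (pullback h D) C Z \<epsilon> F"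
    if Z: "finite Z" "Z \<subseteq> (SIGMA t:carrier G. carrier (fiber (pullback h D) t))" and "0 < \<epsilon>"
    for Z \<epsilon>
  proof -
    have Z_mem: "t \<in> carrier G" "a \<in> carrier (fiber D (h t))" if "(t, a) \<in> Z" for t a
      using Z(2) that by auto
    let ?Z = "(\<lambda>(t, a). (h t, a)) ` Z"
    have "finite ?Z \<and> ?Z \<subseteq> (SIGMA t:carrier H. carrier (fiber D t)) \<and> 0 < \<epsilon> / 2"
      using Z(1) Z_mem \<open>0 < \<epsilon>\<close> by auto
    from C[rule_format, OF this] obtain f where f: "EP_approx H D C ?Z (\<epsilon> / 2) f" by blast
    define X where "X = bundle_support H D f"
    have f_mem: "f x \<in> carrier ?A" if "x \<in> carrier H" for x
      using f that by (auto simp: EP_approx_def)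
    have X: "finite X" "X \<subseteq> carrier H" "\<And>x. x \<in> carrier H \<Longrightarrow> x \<in> X \<longleftrightarrow> f x \<noteq> \<zero>\<^bsub>?A\<^esub>"
      using f by (auto simp: EP_approx_def X_def bundle_support_def)
    define e where "e t a x = EP_term H D (h t) a (f (h t \<otimes>\<^bsub>H\<^esub> x)) (f x)" for t a x
    have e_mem: "e t a x \<in> carrier (fiber D (h t))" if "(t, a) \<in> Z" "x \<in> carrier H" for t a x
      unfolding e_def using that Z_mem by (intro D.EP_term_closed f_mem) auto
    define L where "L = 1 + (\<Sum>(t, a)\<in>Z. \<Sum>x\<in>X. nrm (fiber D (h t)) (e t a x))"
    have e_nonneg: "0 \<le> nrm (fiber D (h t)) (e t a x)" if "(t, a) \<in> Z" "x \<in> X" for t a x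
    proof -
      interpret T: cbanach_space "fiber D (h t)" by (rule D.fiber_banach) (use Z_mem that in simp)
      show ?thesis using e_mem that X(2) by (intro T.nrm_nonneg) auto
    qed
    have L: "1 \<le> L" and L_ge: "(\<Sum>x\<in>X. nrm (fiber D (h t)) (e t a x)) \<le> L" if "(t, a) \<in> Z" for t a
    proof -
      have "0 \<le> (\<Sum>(t, a)\<in>Z. \<Sum>x\<in>X. nrm (fiber D (h t)) (e t a x))"
        by (intro sum_nonneg) (auto intro!: sum_nonneg e_nonneg)
      then show "1 \<le> L" by (simp add: L_def)
      have "(\<lambda>(t, a). \<Sum>x\<in>X. nrm (fiber D (h t)) (e t a x)) (t, a)
          \<le> (\<Sum>(t, a)\<in>Z. \<Sum>x\<in>X. nrm (fiber D (h t)) (e t a x))"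
        by (rule member_le_sum[OF that]) (use Z(1) in \<open>auto intro!: sum_nonneg e_nonneg\<close>)
      then show "(\<Sum>x\<in>X. nrm (fiber D (h t)) (e t a x)) \<le> L" by (simp add: L_def)
    qed
    define \<delta> where "\<delta> = \<epsilon> / (2 * max 1 L)"
    have \<delta>: "0 < \<delta>" using \<open>0 < \<epsilon>\<close> by (simp add: \<delta>_def)
    define K where "K = (\<lambda>((t, a), x). k t x) ` (Z \<times> X)"
    have K_mem: "k t x \<in> K" if "(t, a) \<in> Z" "x \<in> X" for t a x
      unfolding K_def by (rule image_eqI[of _ _ "((t, a), x)"]) (use that in auto)
    have "finite K \<and> K \<subseteq> ?N \<and> 0 < \<delta>\<^sup>2"
      using Z(1) X(1,2) k Z_mem \<delta> by (auto simp: K_def)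
    from reiter[unfolded reiter_def, rule_format, OF this]
    obtain \<phi> S where "finite S \<and> S \<subseteq> ?N \<and> (\<forall>s. 0 \<le> \<phi> s) \<and> (\<forall>s. s \<notin> S \<longrightarrow> \<phi> s = 0) \<and>
        sum \<phi> S = 1 \<and> (\<forall>t\<in>K. (\<Sum>s\<in>S. \<bar>\<phi> (t \<otimes> s) - \<phi> s\<bar>) < \<delta>\<^sup>2)"
      by auto
    then have S: "finite S" "S \<subseteq> ?N" and \<phi>: "\<And>s. 0 \<le> \<phi> s" "\<And>s. s \<notin> S \<Longrightarrow> \<phi> s = 0"
      "sum \<phi> S = 1" "\<And>t. t \<in> K \<Longrightarrow> (\<Sum>s\<in>S. \<bar>\<phi> (t \<otimes> s) - \<phi> s\<bar>) < \<delta>\<^sup>2"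
      by simp_all
    define \<psi> where "\<psi> n = sqrt (\<phi> n)" for n
    define Y where "Y = {n \<in> S. \<phi> n \<noteq> 0}"
    have Y: "finite Y" "Y \<subseteq> ?N" using S by (auto simp: Y_def)
    have \<psi>_eq: "\<psi> n = 0 \<longleftrightarrow> n \<notin> Y" for n using \<phi>(2) by (auto simp: Y_def \<psi>_def)
    have \<psi>_sum: "(\<Sum>n\<in>Y. g n * \<psi> n) = (\<Sum>n\<in>S. g n * \<psi> n)" for g
      by (rule sum.mono_neutral_left) (use S in \<open>auto simp: Y_def \<psi>_def\<close>)
    have \<psi>_one: "(\<Sum>n\<in>Y. \<psi> n * \<psi> n) = 1"
      unfolding \<psi>_sum using \<phi>(1,3) by (simp add: \<psi>_def)
    define w where "w t x = (\<Sum>n\<in>Y. \<psi> (k t x \<otimes> n) * \<psi> n)" for t x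
    have w: "\<bar>w t x - 1\<bar> \<le> \<delta>" if "(t, a) \<in> Z" "x \<in> X" for t a x
      unfolding w_def \<psi>_sum unfolding \<psi>_def
      by (rule sqrt_overlap_near_one[OF \<phi>(1) \<phi>(1) \<phi>(3) \<delta> less_imp_le[OF \<phi>(4)[OF K_mem[OF that]]]])
    define F where "F s = complex_of_real (\<psi> (inv (c (h s)) \<otimes> s)) \<odot>\<^bsub>?A\<^esub> f (h s)" for s
    \<comment> \<open>The coordinates \<open>(x, n)\<close> on \<open>G\<close>, which turn sums over the support of \<open>F\<close> into double sums.\<close>
    define \<iota> where "\<iota> z = c (fst z) \<otimes> snd z" for z
    have \<iota>_mem: "\<iota> (x, n) \<in> carrier G" and h_\<iota>: "h (\<iota> (x, n)) = x"
      if "x \<in> carrier H" "n \<in> ?N" for x n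
      using that c[OF that(1)] N[OF that(2)] by (simp_all add: \<iota>_def)
    have F_shift: "F (t \<otimes> \<iota> (x, n))
        = complex_of_real (\<psi> (k t x \<otimes> n)) \<odot>\<^bsub>?A\<^esub> f (h t \<otimes>\<^bsub>H\<^esub> x)"
      if "t \<in> carrier G" "x \<in> carrier H" "n \<in> ?N" for t x n
    proof -
      have tx: "h t \<otimes>\<^bsub>H\<^esub> x \<in> carrier H" using that by simp
      have "h (t \<otimes> \<iota> (x, n)) = h t \<otimes>\<^bsub>H\<^esub> x"
        using that \<iota>_mem h_\<iota> by simp
      moreover have "inv (c (h t \<otimes>\<^bsub>H\<^esub> x)) \<otimes> (t \<otimes> \<iota> (x, n)) = k t x \<otimes> n"
        using that c(1)[OF tx] c(1)[OF that(2)] N(1)[OF that(3)] by (simp add: k_def \<iota>_def G.m_assoc)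
      ultimately show ?thesis by (simp add: F_def)
    qed
    have F_\<iota>: "F (\<iota> (x, n)) = complex_of_real (\<psi> n) \<odot>\<^bsub>?A\<^esub> f x"
      if "x \<in> carrier H" "n \<in> ?N" for x n
    proof -
      have "inv (c x) \<otimes> \<iota> (x, n) = n"
        using that c(1)[OF that(1)] N(1)[OF that(2)] by (simp add: \<iota>_def G.m_assoc[symmetric])
      then show ?thesis using h_\<iota>[OF that] by (simp add: F_def)
    qed
    have F_mem: "F \<in> carrier G \<rightarrow> carrier ?A"
      by (auto simp: F_def f_mem)
    have inj: "inj_on \<iota> (X \<times> Y)"
    proof (rule inj_onI, clarify)
      fix x n x' n' assume m: "x \<in> X" "n \<in> Y" "x' \<in> X" "n' \<in> Y" and eq: "\<iota> (x, n) = \<iota> (x', n')"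
      have "x \<in> carrier H" "n \<in> ?N" "x' \<in> carrier H" "n' \<in> ?N" using m X(2) Y(2) by auto
      note m' = this
      have "x = x'" using h_\<iota>[OF m'(1,2)] h_\<iota>[OF m'(3,4)] eq by simp
      moreover have "n = n'"
        using eq \<open>x = x'\<close> c(1)[OF m'(1)] N(1)[OF m'(2)] N(1)[OF m'(4)] by (simp add: \<iota>_def)
      ultimately show "x = x' \<and> n = n'" by simp
    qed
    have supp: "bundle_support G (pullback h D) F = \<iota> ` (X \<times> Y)"
    proof (intro equalityI subsetI)
      fix s assume "s \<in> bundle_support G (pullback h D) F"
      then have s: "s \<in> carrier G" "F s \<noteq> \<zero>\<^bsub>?A\<^esub>" by (auto simp: bundle_support_def)
      have qs: "h s \<in> carrier H" using s(1) by simp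
      define n where "n = inv (c (h s)) \<otimes> s"
      have n: "s = \<iota> (h s, n)"
        using s(1) c(1)[OF qs] by (simp add: \<iota>_def n_def G.m_assoc[symmetric])
      have "n \<in> Y"
      proof (rule ccontr)
        assume "n \<notin> Y"
        then have "\<psi> n = 0" by (simp add: \<psi>_eq)
        then show False using s(2) f_mem[OF qs] by (simp add: F_def n_def)
      qed
      moreover have "h s \<in> X"
      proof (rule ccontr)
        assume "h s \<notin> X"
        then have "f (h s) = \<zero>\<^bsub>?A\<^esub>" using X(3)[OF qs] by simp
        then show False using s(2) by (simp add: F_def)
      qed
      ultimately show "s \<in> \<iota> ` (X \<times> Y)" using n by blast
    next
      fix s assume "s \<in> \<iota> ` (X \<times> Y)"
      then obtain x n where xn: "x \<in> X" "n \<in> Y" "s = \<iota> (x, n)" by auto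
      have xH: "x \<in> carrier H" and nN: "n \<in> ?N" using xn X(2) Y(2) by auto
      have "\<psi> n \<noteq> 0" using xn(2) \<psi>_eq by simp
      have "F s \<noteq> \<zero>\<^bsub>?A\<^esub>"
      proof
        assume "F s = \<zero>\<^bsub>?A\<^esub>"
        then have "cmod (complex_of_real (\<psi> n)) * nrm ?A (f x) = 0"
          using F_\<iota>[OF xH nN] xn(3) E.nrm_smult[OF f_mem[OF xH], of "complex_of_real (\<psi> n)"] by simp
        then have "f x = \<zero>\<^bsub>?A\<^esub>"
          using \<open>\<psi> n \<noteq> 0\<close> E.nrm_eq_zero[OF f_mem[OF xH]] by simp
        then show False using X(3)[OF xH] xn(1) by simp
      qed
      then show "s \<in> bundle_support G (pullback h D) F"
        using \<iota>_mem[OF xH nN] xn(3) by (simp add: bundle_support_def)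
    qed
    have square: "EP_square G (pullback h D) F = EP_square H D f"
    proof -
      let ?s = "\<lambda>x. ?mul (?adj (f x)) (f x)"
      let ?S = "\<lambda>s. ?mul (?adj (F s)) (F s)"
      have "EP_square G (pullback h D) F = (\<Oplus>\<^bsub>?A\<^esub> s\<in>\<iota> ` (X \<times> Y). ?S s)"
        by (simp add: EP_square_def supp)
      also have "\<dots> = (\<Oplus>\<^bsub>?A\<^esub> z\<in>X \<times> Y. ?S (\<iota> z))"
        by (rule E.finsum_reindex[OF _ inj]) (use F_mem \<iota>_mem X(2) Y(2) in \<open>auto simp: Pi_iff subset_iff\<close>)
      also have "\<dots> = (\<Oplus>\<^bsub>?A\<^esub> x\<in>X. \<Oplus>\<^bsub>?A\<^esub> n\<in>Y. ?S (\<iota> (x, n)))"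
        by (rule E.finsum_Times[OF X(1) Y(1)]) (use F_mem \<iota>_mem X(2) Y(2) in \<open>auto simp: Pi_iff subset_iff\<close>)
      also have "\<dots> = (\<Oplus>\<^bsub>?A\<^esub> x\<in>X. ?s x)"
      proof (rule E.finsum_cong'[OF refl])
        show "?s \<in> X \<rightarrow> carrier ?A" using f_mem X(2) by auto
        fix x assume "x \<in> X"
        then have xH: "x \<in> carrier H" using X(2) by blast
        have "(\<Oplus>\<^bsub>?A\<^esub> n\<in>Y. ?S (\<iota> (x, n)))
            = (\<Oplus>\<^bsub>?A\<^esub> n\<in>Y. complex_of_real (\<psi> n * \<psi> n) \<odot>\<^bsub>?A\<^esub> ?s x)"
        proof (rule E.finsum_cong'[OF refl])
          fix n assume "n \<in> Y"
          then have "n \<in> ?N" using Y(2) by blast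
          show "?S (\<iota> (x, n)) = complex_of_real (\<psi> n * \<psi> n) \<odot>\<^bsub>?A\<^esub> ?s x"
            unfolding F_\<iota>[OF xH \<open>n \<in> ?N\<close>] by (rule D.bstar_bmult_smult[OF f_mem[OF xH]])
        qed (use f_mem[OF xH] in auto)
        also have "\<dots> = complex_of_real (\<Sum>n\<in>Y. \<psi> n * \<psi> n) \<odot>\<^bsub>?A\<^esub> ?s x"
          unfolding of_real_sum by (rule E.finsum_smult_const[OF Y(1)]) (use f_mem[OF xH] in auto)
        also have "\<dots> = ?s x" using f_mem[OF xH] by (simp add: \<psi>_one)
        finally show "(\<Oplus>\<^bsub>?A\<^esub> n\<in>Y. ?S (\<iota> (x, n))) = ?s x" .
      qed
      also have "\<dots> = EP_square H D f" by (simp add: EP_square_def X_def)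
      finally show ?thesis .
    qed
    have approx: "nrm (fiber D (h t)) (EP_sum G (pullback h D) F t a \<ominus>\<^bsub>fiber D (h t)\<^esub> a) < \<epsilon>"
      if ta: "(t, a) \<in> Z" for t a
    proof -
      have t: "t \<in> carrier G" and ht: "h t \<in> carrier H" and a: "a \<in> carrier (fiber D (h t))"
        using Z_mem[OF ta] by auto
      let ?V = "fiber D (h t)" and ?F = "EP_sum G (pullback h D) F t a" and ?f = "EP_sum H D f (h t) a"
      interpret T: cbanach_space ?V by (rule D.fiber_banach[OF ht])
      let ?e = "\<lambda>s. EP_term H D (h t) a (F (t \<otimes> s)) (F s)"
      have closed: "?e s \<in> carrier ?V" if "s \<in> carrier G" for s
        by (rule D.EP_term_closed[OF ht a]) (use F_mem t that in auto)
      have ex: "e t a x \<in> carrier ?V" if "x \<in> X" for x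
        using e_mem[OF ta] X(2) that by blast
      have "?F = (\<Oplus>\<^bsub>?V\<^esub> s\<in>\<iota> ` (X \<times> Y). ?e s)"
        by (simp add: EP_sum_def supp EP_term_def)
      also have "\<dots> = (\<Oplus>\<^bsub>?V\<^esub> z\<in>X \<times> Y. ?e (\<iota> z))"
        by (rule T.finsum_reindex[OF _ inj]) (use closed \<iota>_mem X(2) Y(2) in \<open>auto simp: subset_iff\<close>)
      also have "\<dots> = (\<Oplus>\<^bsub>?V\<^esub> x\<in>X. \<Oplus>\<^bsub>?V\<^esub> n\<in>Y. ?e (\<iota> (x, n)))"
        by (rule T.finsum_Times[OF X(1) Y(1)]) (use closed \<iota>_mem X(2) Y(2) in \<open>auto simp: subset_iff\<close>)
      also have "\<dots> = (\<Oplus>\<^bsub>?V\<^esub> x\<in>X. complex_of_real (w t x) \<odot>\<^bsub>?V\<^esub> e t a x)"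
      proof (rule T.finsum_cong'[OF refl])
        show "(\<lambda>x. complex_of_real (w t x) \<odot>\<^bsub>?V\<^esub> e t a x) \<in> X \<rightarrow> carrier ?V"
          using ex by auto
        fix x assume x: "x \<in> X"
        then have xH: "x \<in> carrier H" using X(2) by blast
        have "(\<Oplus>\<^bsub>?V\<^esub> n\<in>Y. ?e (\<iota> (x, n)))
            = (\<Oplus>\<^bsub>?V\<^esub> n\<in>Y. complex_of_real (\<psi> (k t x \<otimes> n) * \<psi> n) \<odot>\<^bsub>?V\<^esub> e t a x)"
        proof (rule T.finsum_cong'[OF refl])
          fix n assume "n \<in> Y"
          then have n: "n \<in> ?N" using Y(2) by blast
          show "?e (\<iota> (x, n)) = complex_of_real (\<psi> (k t x \<otimes> n) * \<psi> n) \<odot>\<^bsub>?V\<^esub> e t a x"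
            unfolding F_\<iota>[OF xH n] F_shift[OF t xH n] e_def
            by (rule D.EP_term_smult[OF ht a]) (use f_mem ht xH in auto)
        qed (use ex[OF x] in auto)
        also have "\<dots> = complex_of_real (w t x) \<odot>\<^bsub>?V\<^esub> e t a x"
          unfolding of_real_sum w_def by (rule T.finsum_smult_const[OF Y(1) ex[OF x]])
        finally show "(\<Oplus>\<^bsub>?V\<^esub> n\<in>Y. ?e (\<iota> (x, n)))
            = complex_of_real (w t x) \<odot>\<^bsub>?V\<^esub> e t a x" .
      qed
      finally have sum_eq: "?F
          = (\<Oplus>\<^bsub>?V\<^esub> x\<in>X. complex_of_real (w t x) \<odot>\<^bsub>?V\<^esub> e t a x)" .
      have sum_f: "?f = (\<Oplus>\<^bsub>?V\<^esub> x\<in>X. e t a x)"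
        by (simp add: EP_sum_def X_def e_def EP_term_def)
      have closed_sums: "?F \<in> carrier ?V"
        "?f \<in> carrier ?V"
        unfolding sum_eq sum_f using ex by (auto intro!: T.finsum_closed)
      have "nrm ?V (?F \<ominus>\<^bsub>?V\<^esub> ?f)
          \<le> (\<Sum>x\<in>X. cmod (complex_of_real (w t x) - 1) * nrm ?V (e t a x))"
        unfolding sum_eq sum_f by (rule T.nrm_finsum_smult_diff_le[OF X(1) ex])
      also have "\<dots> \<le> (\<Sum>x\<in>X. \<delta> * nrm ?V (e t a x))"
      proof (rule sum_mono, rule mult_right_mono)
        fix x assume "x \<in> X"
        have "cmod (complex_of_real (w t x) - 1) = \<bar>w t x - 1\<bar>"
          by (metis norm_of_real of_real_1 of_real_diff)
        then show "cmod (complex_of_real (w t x) - 1) \<le> \<delta>" using w[OF ta \<open>x \<in> X\<close>] by simp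
        show "0 \<le> nrm ?V (e t a x)" by (rule e_nonneg[OF ta \<open>x \<in> X\<close>])
      qed
      also have "\<dots> = \<delta> * (\<Sum>x\<in>X. nrm ?V (e t a x))" by (simp add: sum_distrib_left)
      also have "\<dots> \<le> \<delta> * max 1 L"
        using L_ge[OF ta] \<delta> by (intro mult_left_mono) auto
      also have "\<dots> = \<epsilon> / 2" by (simp add: \<delta>_def)
      finally have 1: "nrm ?V (?F \<ominus>\<^bsub>?V\<^esub> ?f)
          \<le> \<epsilon> / 2" .
      have 2: "nrm ?V (?f \<ominus>\<^bsub>?V\<^esub> a) < \<epsilon> / 2"
        using f ta by (force simp: EP_approx_def)
      show ?thesis
        using T.nrm_minus_triangle[OF closed_sums a] 1 2 by simp
    qed
    have "EP_approx G (pullback h D) C Z \<epsilon> F"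
      unfolding EP_approx_def square supp
      using F_mem X(1) Y(1) approx f by (simp add: EP_approx_def)
    then show ?thesis by blast
  qed
  then show ?thesis
    unfolding property_EP_iff_finite_approximation by (intro exI[of _ C] allI impI) (elim conjE)
qed

section \<open>Almost invariant vectors from property (EP)\<close>

lemma (in cbanach_space) additive_functional_scale:
  assumes add: "\<And>a b. a \<in> carrier V \<Longrightarrow> b \<in> carrier V \<Longrightarrow> \<tau> (a \<oplus> b) = \<tau> a + \<tau> b"
    and bound: "\<And>a. a \<in> carrier V \<Longrightarrow> \<bar>\<tau> a\<bar> \<le> nrm V a"
    and a: "a \<in> carrier V"
  shows "\<tau> (complex_of_real r \<odot> a) = r * \<tau> a"
proof -
  have "\<tau> (complex_of_real r \<odot> a) = r * \<tau> (complex_of_real 1 \<odot> a)"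
  proof (rule additive_bounded_imp_real_linear[where C = "nrm V a"])
    fix x y
    show "\<tau> (complex_of_real (x + y) \<odot> a) = \<tau> (complex_of_real x \<odot> a) + \<tau> (complex_of_real y \<odot> a)"
      using a by (simp add: smult_add_left add)
  next
    fix x
    have "\<bar>\<tau> (complex_of_real x \<odot> a)\<bar> \<le> nrm V (complex_of_real x \<odot> a)" using a by (intro bound) simp
    then show "\<bar>\<tau> (complex_of_real x \<odot> a)\<bar> \<le> nrm V a * \<bar>x\<bar>"
      using a by (simp add: nrm_smult mult.commute)
  qed
  then show ?thesis using a by simp
qed

text \<open>For the semi-inner product \<open>\<langle>x, y\<rangle> = \<tau>(x\<^sup>* y)\<close> this bounds \<open>|\<parallel>x\<parallel>\<^sup>2 - \<parallel>y\<parallel>\<^sup>2| = |\<langle>x - y, x + y\<rangle>|\<close> by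
  \<open>k/2 \<parallel>x - y\<parallel>\<^sup>2 + 1/(2k) \<parallel>x + y\<parallel>\<^sup>2\<close>, a form of Cauchy--Schwarz that can be summed over many pairs. The vectors used
  are \<open>k (x - y) \<plusminus> (x + y)\<close>.\<close>

lemma (in cstar_algebra) positive_functional_gap:
  assumes add: "\<And>a b. a \<in> carrier V \<Longrightarrow> b \<in> carrier V \<Longrightarrow> \<tau> (a \<oplus> b) = \<tau> a + \<tau> b"
    and bound: "\<And>a. a \<in> carrier V \<Longrightarrow> \<bar>\<tau> a\<bar> \<le> nrm V a"
    and sym: "\<And>a. a \<in> carrier V \<Longrightarrow> \<tau> (adj a) = \<tau> a"
    and pos: "\<And>a. a \<in> carrier V \<Longrightarrow> 0 \<le> \<tau> (adj a \<cdot> a)"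
    and x: "x \<in> carrier V" and y: "y \<in> carrier V"
  shows "2 * k * \<bar>\<tau> (adj x \<cdot> x) - \<tau> (adj y \<cdot> y)\<bar>
    \<le> k\<^sup>2 * (\<tau> (adj x \<cdot> x) + \<tau> (adj y \<cdot> y) - 2 * \<tau> (adj x \<cdot> y))
      + (\<tau> (adj x \<cdot> x) + \<tau> (adj y \<cdot> y) + 2 * \<tau> (adj x \<cdot> y))"
proof -
  have quadratic: "0 \<le> \<alpha> * \<alpha> * \<tau> (adj x \<cdot> x) + 2 * \<alpha> * \<beta> * \<tau> (adj x \<cdot> y) + \<beta> * \<beta> * \<tau> (adj y \<cdot> y)"
    for \<alpha> \<beta>
  proof -
    note scale = additive_functional_scale[OF add bound]
    have yx: "\<tau> (adj y \<cdot> x) = \<tau> (adj x \<cdot> y)"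
      using sym[of "adj x \<cdot> y"] x y by (simp add: adj_mul adj_adj)
    let ?a = "complex_of_real \<alpha>" and ?b = "complex_of_real \<beta>"
    let ?z = "?a \<odot> x \<oplus> ?b \<odot> y"
    have "adj ?z \<cdot> ?z = complex_of_real (\<alpha> * \<alpha>) \<odot> (adj x \<cdot> x) \<oplus> complex_of_real (\<alpha> * \<beta>) \<odot> (adj x \<cdot> y)
        \<oplus> (complex_of_real (\<alpha> * \<beta>) \<odot> (adj y \<cdot> x) \<oplus> complex_of_real (\<beta> * \<beta>) \<odot> (adj y \<cdot> y))"
      using x y
      by (simp add: adj_add adj_smult mul_add_left mul_add_right mul_smult_left mul_smult_right
          smult_smult mult.commute a_ac smult_add_right)
    then have "\<tau> (adj ?z \<cdot> ?z) = (\<alpha> * \<alpha>) * \<tau> (adj x \<cdot> x) + (\<alpha> * \<beta>) * \<tau> (adj x \<cdot> y)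
        + ((\<alpha> * \<beta>) * \<tau> (adj x \<cdot> y) + (\<beta> * \<beta>) * \<tau> (adj y \<cdot> y))"
      using x y by (simp only: add scale yx smult_closed' a_closed mul_closed adj_closed)
    then show ?thesis using pos[of ?z] x y by (simp add: algebra_simps)
  qed
  from quadratic[of "k + 1" "1 - k"] quadratic[of "k - 1" "- 1 - k"] show ?thesis
    by (auto simp: abs_if power2_eq_square algebra_simps)
qed

lemma sum_of_additive_functional:
  assumes "cbanach_space V" and "finite X" "\<And>x. x \<in> X \<Longrightarrow> f x \<in> carrier V"
    and add: "\<And>a b. a \<in> carrier V \<Longrightarrow> b \<in> carrier V \<Longrightarrow> \<tau> (a \<oplus>\<^bsub>V\<^esub> b) = \<tau> a + (\<tau> b :: real)"
  shows "\<tau> (\<Oplus>\<^bsub>V\<^esub>x\<in>X. f x) = (\<Sum>x\<in>X. \<tau> (f x))"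
proof -
  interpret cbanach_space V by fact
  have zero: "\<tau> \<zero>\<^bsub>V\<^esub> = 0" using add[of "\<zero>\<^bsub>V\<^esub>" "\<zero>\<^bsub>V\<^esub>"] by simp
  show ?thesis
    using assms(2,3)
  proof (induction X rule: finite_induct)
    case (insert x X)
    have "f x \<in> carrier V" "f \<in> X \<rightarrow> carrier V" using insert.prems by auto
    then show ?case using insert by (simp add: finsum_insert add finsum_closed)
  qed (simp add: zero)
qed

text \<open>The Reiter vector is \<open>P(s) = \<tau>(v(s)\<^sup>* v(s))\<close> divided by its total mass. In the notation \<open>R s s' = \<tau>(v(s)\<^sup>* v(s'))\<close>, (EP)
  controls \<open>\<Sum> R (t s) s\<close> within \<open>\<eta>\<close>, so \<open>\<Sum> \<parallel>v(t s) - v(s)\<parallel>\<^sup>2 \<le> 4 \<eta>\<close>, and the gap inequality turns this into an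
  \<open>l\<^sup>1\<close> estimate.\<close>

lemma (in group_hom) reiter_kernel_if_property_EP_pullback:
  assumes fell: "fell_bundle H D"
    and nonzero: "x \<in> carrier H" "b \<in> carrier (fiber D x)" "b \<noteq> \<zero>\<^bsub>fiber D x\<^esub>"
    and EP: "property_EP G (pullback h D)"
  shows "reiter G (kernel G H h)"
  unfolding reiter_def
proof (intro allI impI, elim conjE)
  fix T and \<epsilon> :: real
  assume T: "finite T" "T \<subseteq> kernel G H h" and \<epsilon>: "0 < \<epsilon>"
  interpret D: fell_bundle H D by fact
  let ?A = "fiber D \<one>\<^bsub>H\<^esub>"
  let ?mul = "bmult D \<one>\<^bsub>H\<^esub> \<one>\<^bsub>H\<^esub>" and ?adj = "bstar D \<one>\<^bsub>H\<^esub>"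
  interpret E: cstar_algebra ?A ?mul ?adj
    by (rule D.cstar_algebra_unit_fiber)
  have "carrier ?A \<noteq> {\<zero>\<^bsub>?A\<^esub>}"
  proof
    interpret X: cbanach_space "fiber D x" by (rule D.fiber_banach[OF nonzero(1)])
    assume triv: "carrier ?A = {\<zero>\<^bsub>?A\<^esub>}"
    have "bmult D (inv\<^bsub>H\<^esub> x) x (bstar D x b) b \<in> carrier ?A"
      using D.bmult_closed[of "inv\<^bsub>H\<^esub> x" x "bstar D x b" b] D.bstar_closed[of x b] nonzero by simp
    then have "bmult D (inv\<^bsub>H\<^esub> x) x (bstar D x b) b = \<zero>\<^bsub>?A\<^esub>" unfolding triv by simp
    then have "(nrm (fiber D x) b)\<^sup>2 = 0" using D.cstar_identity[OF nonzero(1,2)] by simp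
    then show False using X.nrm_eq_zero[OF nonzero(2)] nonzero(3) by simp
  qed
  then obtain \<tau> u where add: "\<And>a b. a \<in> carrier ?A \<Longrightarrow> b \<in> carrier ?A \<Longrightarrow> \<tau> (a \<oplus>\<^bsub>?A\<^esub> b) = \<tau> a + \<tau> b"
    and bound: "\<And>a. a \<in> carrier ?A \<Longrightarrow> \<bar>\<tau> a\<bar> \<le> nrm ?A a"
    and sym: "\<And>a. a \<in> carrier ?A \<Longrightarrow> \<tau> (?adj a) = \<tau> a"
    and pos: "\<And>a. a \<in> carrier ?A \<Longrightarrow> 0 \<le> \<tau> (?mul (?adj a) a)"
    and u: "u \<in> carrier ?A" "?adj u = u" "0 < \<tau> (?mul u u)"
    by (rule E.positive_functional) (rule that)
  define a where "a = ?mul u u"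
  define \<kappa> where "\<kappa> = \<tau> a"
  have a: "a \<in> carrier ?A" and \<kappa>: "0 < \<kappa>" using u by (simp_all add: a_def \<kappa>_def)
  \<comment> \<open>Total variation is at most \<open>2 k \<eta> + 2 (\<kappa> + \<eta>) / k\<close>; the choice \<open>\<eta> = \<kappa> / k\<^sup>2\<close> makes both terms
    of order \<open>\<kappa> / k\<close>, while the mass is at least \<open>\<kappa> / 2\<close>.\<close>
  define k where "k = max 2 (11 / \<epsilon>)"
  have k: "2 \<le> k" "11 \<le> k * \<epsilon>"
    using \<epsilon> by (auto simp: k_def max_def field_simps)
  define \<eta> where "\<eta> = \<kappa> / k\<^sup>2"
  have k2: "4 \<le> k\<^sup>2" using power_mono[OF k(1), of 2] by simp
  have \<eta>: "0 < \<eta>" "k\<^sup>2 * \<eta> = \<kappa>" "\<eta> \<le> \<kappa> / 4"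
    using \<kappa> k k2 by (auto simp: \<eta>_def field_simps)
  from EP obtain C where C: "\<forall>Z \<epsilon>. finite Z \<and> Z \<subseteq> (SIGMA t:carrier G. carrier (fiber (pullback h D) t)) \<and> 0 < \<epsilon>
      \<longrightarrow> (\<exists>f. EP_approx G (pullback h D) C Z \<epsilon> f)"
    unfolding property_EP_iff_finite_approximation by (elim exE) (rule that)
  let ?T = "insert \<one> T"
  have TG: "t \<in> carrier G" "h t = \<one>\<^bsub>H\<^esub>" if "t \<in> ?T" for t
    using that T(2) by (auto simp: kernel_def)
  let ?Z = "(\<lambda>t. (t, a)) ` ?T"
  have "finite ?Z \<and> ?Z \<subseteq> (SIGMA t:carrier G. carrier (fiber (pullback h D) t)) \<and> 0 < \<eta>"
    using T(1) TG a \<eta>(1) by auto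
  from C[rule_format, OF this] obtain f where f: "EP_approx G (pullback h D) C ?Z \<eta> f" by blast
  define S where "S = bundle_support G (pullback h D) f"
  have f_mem: "f s \<in> carrier ?A" if "s \<in> carrier G" for s
    using f that by (auto simp: EP_approx_def)
  have S: "finite S" "S \<subseteq> carrier G" "\<And>s. s \<in> carrier G \<Longrightarrow> s \<notin> S \<Longrightarrow> f s = \<zero>\<^bsub>?A\<^esub>"
    using f by (auto simp: EP_approx_def S_def bundle_support_def)
  define v where "v s = ?mul u (f s)" for s
  have v_mem: "v s \<in> carrier ?A" if "s \<in> carrier G" for s
    using f_mem[OF that] u by (simp add: v_def)
  define R where "R s s' = \<tau> (?mul (?adj (v s)) (v s'))" for s s'
  define P where "P s = R s s" for s
  have P_nonneg: "0 \<le> P s" if "s \<in> carrier G" for s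
    using pos[OF v_mem[OF that]] by (simp add: P_def R_def)
  have "\<tau> \<zero>\<^bsub>?A\<^esub> = 0" using add[of "\<zero>\<^bsub>?A\<^esub>" "\<zero>\<^bsub>?A\<^esub>"] by simp
  then have P_zero: "P s = 0" if "s \<in> carrier G" "s \<notin> S" for s
    using S(3)[OF that] u(1) by (simp add: P_def R_def v_def)
  have near: "\<bar>(\<Sum>s\<in>S. R (t \<otimes> s) s) - \<kappa>\<bar> < \<eta>" if t: "t \<in> ?T" for t
  proof -
    have tG: "t \<in> carrier G" and ht: "h t = \<one>\<^bsub>H\<^esub>" using TG[OF t] by auto
    let ?f = "EP_sum G (pullback h D) f t a"
    let ?e = "\<lambda>s. ?mul (?mul (?adj (f (t \<otimes> s))) a) (f s)"
    have e: "?e s \<in> carrier ?A" "\<tau> (?e s) = R (t \<otimes> s) s" if s: "s \<in> carrier G" for s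
    proof -
      have m: "f s \<in> carrier ?A" "f (t \<otimes> s) \<in> carrier ?A" using f_mem tG s by auto
      show "?e s \<in> carrier ?A" using m a by simp
      have "?e s = ?mul (?adj (v (t \<otimes> s))) (v s)"
        using m u(1,2) by (simp add: v_def a_def E.adj_mul E.mul_assoc)
      then show "\<tau> (?e s) = R (t \<otimes> s) s" by (simp add: R_def)
    qed
    have sum: "?f = (\<Oplus>\<^bsub>?A\<^esub>s\<in>S. ?e s)"
      by (simp add: EP_sum_def S_def ht)
    have mem: "?f \<in> carrier ?A"
      unfolding sum using e(1) S(2) by (intro E.finsum_closed) auto
    have \<tau>sum: "\<tau> (?f) = (\<Sum>s\<in>S. R (t \<otimes> s) s)"
    proof -
      have "\<tau> (?f) = (\<Sum>s\<in>S. \<tau> (?e s))"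
        unfolding sum
        by (rule sum_of_additive_functional[OF E.cbanach_space_axioms S(1) _ add]) (use e(1) S(2) in auto)
      also have "\<dots> = (\<Sum>s\<in>S. R (t \<otimes> s) s)"
        by (rule sum.cong[OF refl]) (use e(2) S(2) in blast)
      finally show ?thesis .
    qed
    have "(t, a) \<in> ?Z" using t by blast
    then have "nrm (fiber (pullback h D) t) (?f \<ominus>\<^bsub>fiber (pullback h D) t\<^esub> a) < \<eta>"
      using f unfolding EP_approx_def by blast
    then have "nrm ?A (?f \<ominus>\<^bsub>?A\<^esub> a) < \<eta>"
      by (simp add: ht)
    moreover have "\<tau> (?f \<ominus>\<^bsub>?A\<^esub> a) = \<tau> (?f) - \<kappa>"
    proof -
      have "\<tau> ((?f \<ominus>\<^bsub>?A\<^esub> a) \<oplus>\<^bsub>?A\<^esub> a)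
          = \<tau> (?f \<ominus>\<^bsub>?A\<^esub> a) + \<tau> a"
        using mem a by (intro add) auto
      moreover have "(?f \<ominus>\<^bsub>?A\<^esub> a) \<oplus>\<^bsub>?A\<^esub> a = ?f"
        using mem a by (simp add: a_minus_def E.a_assoc E.l_neg)
      ultimately show ?thesis by (simp add: \<kappa>_def)
    qed
    moreover have "\<bar>\<tau> (?f \<ominus>\<^bsub>?A\<^esub> a)\<bar> \<le> nrm ?A (?f \<ominus>\<^bsub>?A\<^esub> a)"
      using mem a by (intro bound) auto
    ultimately show ?thesis using \<tau>sum by simp
  qed
  have "(\<Sum>s\<in>S. R (\<one> \<otimes> s) s) = (\<Sum>s\<in>S. P s)"
    by (rule sum.cong[OF refl]) (use S(2) in \<open>auto simp: P_def\<close>)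
  then have P_total: "\<bar>sum P S - \<kappa>\<bar> < \<eta>" using near[of "\<one>"] by simp
  then have P_ge: "\<kappa> / 2 \<le> sum P S" using \<eta>(3) \<kappa> by linarith
  have shift: "(\<Sum>s\<in>S. P (t \<otimes> s)) \<le> sum P S" if t: "t \<in> T" for t
  proof -
    have tG: "t \<in> carrier G" using TG t by auto
    have inj: "inj_on (\<lambda>s. t \<otimes> s) S"
      using S(2) tG by (intro inj_onI) (metis G.Units_eq G.Units_l_cancel subsetD)
    have "(\<Sum>s\<in>S. P (t \<otimes> s)) = (\<Sum>s\<in>(\<lambda>s. t \<otimes> s) ` S. P s)"
      by (simp add: sum.reindex[OF inj])
    also have "\<dots> \<le> (\<Sum>s\<in>(\<lambda>s. t \<otimes> s) ` S \<union> S. P s)"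
      by (rule sum_mono2) (use S tG P_nonneg in auto)
    also have "\<dots> = sum P S"
      by (rule sum.mono_neutral_right) (use S tG P_zero in auto)
    finally show ?thesis .
  qed
  have variation: "(\<Sum>s\<in>S. \<bar>P (t \<otimes> s) - P s\<bar>) \<le> 5 * \<kappa> / k" if t: "t \<in> T" for t
  proof -
    have tG: "t \<in> carrier G" using TG t by auto
    define x y z where "x = (\<Sum>s\<in>S. P (t \<otimes> s))" and "y = sum P S" and "z = (\<Sum>s\<in>S. R (t \<otimes> s) s)"
    have xyz: "x \<le> y" "y < \<kappa> + \<eta>" "\<kappa> - \<eta> < z" "z < \<kappa> + \<eta>"
      using shift[OF t] P_total near[of t] t by (auto simp: x_def y_def z_def abs_less_iff)
    have "2 * k * (\<Sum>s\<in>S. \<bar>P (t \<otimes> s) - P s\<bar>) = (\<Sum>s\<in>S. 2 * k * \<bar>P (t \<otimes> s) - P s\<bar>)"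
      by (simp add: sum_distrib_left)
    also have "\<dots> \<le> (\<Sum>s\<in>S. k\<^sup>2 * (P (t \<otimes> s) + P s - 2 * R (t \<otimes> s) s)
        + (P (t \<otimes> s) + P s + 2 * R (t \<otimes> s) s))"
    proof (rule sum_mono)
      fix s assume "s \<in> S"
      then have "v (t \<otimes> s) \<in> carrier ?A" "v s \<in> carrier ?A" using v_mem S(2) tG by auto
      from E.positive_functional_gap[OF add bound sym pos this, of k]
      show "2 * k * \<bar>P (t \<otimes> s) - P s\<bar> \<le> k\<^sup>2 * (P (t \<otimes> s) + P s - 2 * R (t \<otimes> s) s)
        + (P (t \<otimes> s) + P s + 2 * R (t \<otimes> s) s)"
        by (simp add: P_def R_def)
    qed
    also have "\<dots> = k\<^sup>2 * (x + y - 2 * z) + (x + y + 2 * z)"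
      by (simp add: x_def y_def z_def sum.distrib sum_subtractf sum_distrib_left[symmetric])
    also have "\<dots> \<le> k\<^sup>2 * (4 * \<eta>) + 4 * (\<kappa> + \<eta>)"
      using xyz by (intro add_mono mult_left_mono) auto
    also have "\<dots> = 4 * (k\<^sup>2 * \<eta>) + 4 * (\<kappa> + \<eta>)" by simp
    also have "\<dots> \<le> 10 * \<kappa>" unfolding \<eta>(2) distrib_left using \<eta>(3) \<kappa> by simp
    finally show ?thesis using k(1) by (simp add: field_simps)
  qed
  define \<phi> where "\<phi> s = (if s \<in> S then P s / sum P S else 0)" for s
  have total_pos: "0 < sum P S" using P_ge \<kappa> by linarith
  show "\<exists>\<phi> S. finite S \<and> S \<subseteq> carrier G \<and> (\<forall>s. 0 \<le> \<phi> s) \<and> (\<forall>s. s \<notin> S \<longrightarrow> \<phi> s = 0) \<and>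
      sum \<phi> S = 1 \<and> (\<forall>t\<in>T. (\<Sum>s\<in>S. \<bar>\<phi> (t \<otimes> s) - \<phi> s\<bar>) < \<epsilon>)"
  proof (intro exI[of _ \<phi>] exI[of _ S] conjI allI impI ballI)
    show "0 \<le> \<phi> s" for s
      using P_nonneg S(2) total_pos by (auto simp: \<phi>_def)
    show "sum \<phi> S = 1"
      using total_pos by (simp add: \<phi>_def sum_divide_distrib[symmetric])
    fix t assume t: "t \<in> T"
    have tG: "t \<in> carrier G" using TG t by auto
    have \<phi>_eq: "\<phi> s = P s / sum P S" if "s \<in> carrier G" for s
      using P_zero[OF that] by (simp add: \<phi>_def)
    have "(\<Sum>s\<in>S. \<bar>\<phi> (t \<otimes> s) - \<phi> s\<bar>) = (\<Sum>s\<in>S. \<bar>P (t \<otimes> s) - P s\<bar> / sum P S)"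
    proof (rule sum.cong[OF refl])
      fix s assume "s \<in> S"
      then have "s \<in> carrier G" using S(2) by blast
      then show "\<bar>\<phi> (t \<otimes> s) - \<phi> s\<bar> = \<bar>P (t \<otimes> s) - P s\<bar> / sum P S"
        using tG total_pos by (simp add: \<phi>_eq diff_divide_distrib[symmetric])
    qed
    also have "\<dots> = (\<Sum>s\<in>S. \<bar>P (t \<otimes> s) - P s\<bar>) / sum P S" by (simp add: sum_divide_distrib)
    also have "\<dots> \<le> (5 * \<kappa> / k) / sum P S"
      using variation[OF t] total_pos by (intro divide_right_mono) auto
    also have "\<dots> < \<epsilon>"
    proof -
      have "5 * \<kappa> < \<epsilon> * sum P S * k"
      proof -
        have "11 * (\<kappa> / 2) \<le> (k * \<epsilon>) * sum P S"
          using k(2) P_ge \<kappa> k(1) \<epsilon> by (intro mult_mono) auto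
        then show ?thesis using \<kappa> by (simp add: mult_ac)
      qed
      then show ?thesis using total_pos k(1) by (simp add: field_simps)
    qed
    finally show "(\<Sum>s\<in>S. \<bar>\<phi> (t \<otimes> s) - \<phi> s\<bar>) < \<epsilon>" .
  qed (use S in \<open>auto simp: \<phi>_def\<close>)
qed

section \<open>The quotient map\<close>

lemma (in normal) kernel_r_coset: "kernel G (G Mod H) (\<lambda>s. H #> s) = H"
proof -
  have "s \<in> H" if "s \<in> carrier G" "H #> s = H" for s
    using coset_join1[OF that(2,1)] subgroup_axioms by blast
  moreover have "s \<in> carrier G" "H #> s = H" if "s \<in> H" for s
    using coset_join2[OF _ subgroup_axioms that] subset that by auto
  ultimately show ?thesis by (auto simp: kernel_def)
qed

theorem theorem6p5:
  fixes G :: "('g, 'm) monoid_scheme" and N :: "'g set" and D :: "('g set, 'a) star_bundle"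
  assumes "group G" and "N \<lhd> G" and "fell_bundle (G Mod N) D"
  shows "(property_EP (G Mod N) D \<and> amenable (G\<lparr>carrier := N\<rparr>)
           \<longrightarrow> property_EP G (pullback (\<lambda>s. N #>\<^bsub>G\<^esub> s) D))
       \<and> ((\<exists>x\<in>carrier (G Mod N). carrier (fiber D x) \<noteq> {\<zero>\<^bsub>fiber D x\<^esub>})
           \<and> property_EP G (pullback (\<lambda>s. N #>\<^bsub>G\<^esub> s) D)
           \<longrightarrow> amenable (G\<lparr>carrier := N\<rparr>))"
proof -
  interpret normal N G by fact
  let ?q = "\<lambda>s. N #>\<^bsub>G\<^esub> s"
  have hom: "group_hom G (G Mod N) ?q"
    by (intro group_hom.intro group_hom_axioms.intro is_group factorgroup_is_group r_coset_hom_Mod)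
  note ker = kernel_r_coset
  have 1: "property_EP G (pullback ?q D)"
    if EP: "property_EP (G Mod N) D" and am: "amenable (G\<lparr>carrier := N\<rparr>)"
  proof (rule group_hom.property_EP_pullback[OF hom _ assms(3) EP])
    show "?q ` carrier G = carrier (G Mod N)" by (simp add: carrier_FactGroup)
    have "group (G\<lparr>carrier := N\<rparr>)" by (rule subgroup_is_group) (rule is_group)
    from group.reiter_if_amenable[OF this am]
    show "reiter (G\<lparr>carrier := kernel G (G Mod N) ?q\<rparr>) (kernel G (G Mod N) ?q)"
      by (simp add: ker)
  qed
  have 2: "amenable (G\<lparr>carrier := N\<rparr>)"
    if x: "x \<in> carrier (G Mod N)" "carrier (fiber D x) \<noteq> {\<zero>\<^bsub>fiber D x\<^esub>}"
      and EP: "property_EP G (pullback ?q D)" for x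
  proof -
    interpret D: fell_bundle "G Mod N" D by fact
    interpret X: cbanach_space "fiber D x" by (rule D.fiber_banach[OF x(1)])
    obtain b where b: "b \<in> carrier (fiber D x)" "b \<noteq> \<zero>\<^bsub>fiber D x\<^esub>"
      using x(2) X.zero_closed by blast
    have "reiter G N"
      using group_hom.reiter_kernel_if_property_EP_pullback[OF hom assms(3) x(1) b EP] by (simp add: ker)
    then show ?thesis by (rule amenable_if_reiter[OF subgroup_axioms])
  qed
  from 1 2 show ?thesis by blast
qed

end
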